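(* Let $e(CP_n)$ denote the number of edges of the random Catalan-pair graph $CP_n$. Then $$\mathbb{E}[e(CP_n)] \sim \frac{1}{\pi}\, n\log n \qquad (n\to\infty).$$ Moreover, for every $\epsilon>0$, $$\Pr\Big[\,\big|e(CP_n)-\tfrac{1}{\pi}n\log n\big|<\epsilon\, n\log n\,\Big]\to 1 \qquad (n\to\infty).$$
   Context: A Catalan-arc matching of size $m$ on $2m$ points $p_1<\dots<p_{2m}$ of a line is a perfect matching of these points (drawn as semicircular arcs on one side of the line) with no two arcs crossing, i.e. there are no $a<b<c<d$ with $\{p_a,p_c\}$ and $\{p_b,p_d\}$ both arcs. There are $C_m=\frac{1}{m+1}\binom{2m}{m}$ such matchings. The random Catalan-pair graph $CP_n$ is generated as follows: take the points $1,2,\dots,2n$ on a line; color each of the points $1,\dots,2n-1$ red or blue independently and uniformly at random, and color point $2n$ so that the total number of red points (hence also of blue points) is even. If there are $2k$ red points, choose independently and uniformly at random a Catalan-arc matching of size $k$ on the red points (arcs drawn above the line) and one of size $n-k$ on the blue points (arcs drawn below). $CP_n$ has one vertex for each of the $n$ arcs, and two vertices are adjacent iff the endpoints of the two arcs alternate (i.e. the arcs are $\{a,c\}$ and $\{b,d\}$ with $a<b<c<d$); this can only happen for arcs of different colors, so $CP_n$ is bipartite. $\log$ is the natural logarithm. *)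

theory Defs
  imports "HOL-Probability.Probability" "HOL-Library.Landau_Symbols"
begin

definition arcs_alternate :: "nat \<times> nat \<Rightarrow> nat \<times> nat \<Rightarrow> bool" where
  "arcs_alternate A B \<longleftrightarrow> fst A < fst B \<and> fst B < snd A \<and> snd A < snd B"

definition catalan_matching :: "nat set \<Rightarrow> (nat \<times> nat) set \<Rightarrow> bool" where
  "catalan_matching S M \<longleftrightarrow>
     (\<forall>A\<in>M. fst A < snd A \<and> fst A \<in> S \<and> snd A \<in> S) \<and>
     (\<forall>x\<in>S. \<exists>!A. A \<in> M \<and> (x = fst A \<or> x = snd A)) \<and>
     (\<forall>A\<in>M. \<forall>B\<in>M. \<not> arcs_alternate A B)"

text \<open>Coloring of points 1..2n: points 1..2n-1 colored by c (True = red);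
  point 2n colored so that the number of red points is even.\<close>
definition full_coloring :: "nat \<Rightarrow> (nat \<Rightarrow> bool) \<Rightarrow> nat \<Rightarrow> bool" where
  "full_coloring n c i =
     (if i < 2*n then c i else odd (card {j\<in>{1..2*n-1}. c j}))"

definition CP_arcs :: "nat \<Rightarrow> (nat \<times> nat) set pmf" where
  "CP_arcs n = do {
     c \<leftarrow> pmf_of_set (PiE {1..2*n-1} (\<lambda>_. UNIV :: bool set));
     let R = {i\<in>{1..2*n}. full_coloring n c i};
     let B = {i\<in>{1..2*n}. \<not> full_coloring n c i};
     Mr \<leftarrow> pmf_of_set {M. catalan_matching R M};
     Mb \<leftarrow> pmf_of_set {M. catalan_matching B M};
     return_pmf (Mr \<union> Mb) }"

text \<open>Number of edges of the graph whose vertices are the arcs, adjacent iff endpoints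
  alternate (each edge counted once, as the ordered pair with smaller left endpoint first).\<close>
definition CP_edges :: "(nat \<times> nat) set \<Rightarrow> nat" where
  "CP_edges M = card {(A, B). A \<in> M \<and> B \<in> M \<and> arcs_alternate A B}"

end

theory Submission
  imports Defs "HOL-Real_Asymp.Real_Asymp"
begin

text \<open>
  Fix the colouring, with \<open>2k\<close> red and \<open>2q\<close> blue points, and write \<open>C\<^sub>i\<close> for the Catalan numbers. Two red
  points with \<open>2i\<close> red points in between are joined with probability \<open>C\<^sub>i C\<^sub>k\<^sub>-\<^sub>1\<^sub>-\<^sub>i / C\<^sub>k\<close>, which is at
  least its limit \<open>C\<^sub>i / 4\<^sup>i\<^sup>+\<^sup>1\<close>. Hence the mean number of blue arcs leaving a window of \<open>m\<close> blue points
  is at most its value in the limiting model, which is \<open>sqrt (8 m / pi)\<close> up to a constant. Summing over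
  the red arcs, with the Cauchy--Schwarz inequality over all red pairs of equal rank distance, every
  colouring gives at most \<open>(2 / pi) sqrt (k q) ln n + O(n)\<close> edges on average, and \<open>2 sqrt (k q) \<le> n\<close>.

  For a matching lower bound in probability, record only which points open an arc. Up to a factor
  polynomial in \<open>n\<close>, any event about these orientations is at most as likely as for independent fair
  coins. Cut the points into blocks of length \<open>n\<close> over a power of \<open>ln n\<close> and count the edges inside the blocks:
  these counts are independent, their sum has mean \<open>(1 - o(1)) n ln n / pi\<close> if the colouring is balanced,
  and except with negligible probability each is bounded by its mean times a power of the
  logarithm, so Hoeffding's inequality beats the polynomial factor. Finally, a variable with mean at most
  \<open>(1 + o(1)) \<mu>\<close> that is rarely below \<open>(1 - o(1)) \<mu>\<close> is concentrated at \<open>\<mu>\<close>.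
\<close>

subsection \<open>Central binomial coefficients and Catalan numbers\<close>

text \<open>Where 1 / pi comes from: in a balanced colouring about \<open>n\<close> points are red,
  and each is joined to the red point \<open>2 * i + 1\<close> places further with probability about
  \<open>cbin i / (4 * (i + 1))\<close>. Such an arc has about \<open>2 * i\<close> blue points
  under it and thus about \<open>sqrt (8 / pi) * sqrt (2 * i)\<close> crossings. Since
  \<open>cbin i\<close> is about \<open>sqrt (2 / pi) / sqrt (2 * i)\<close>, the product is about 1
  / (pi (i + 1)), and the sum over \<open>i\<close> is harmonic. So every logarithmic scale of arc
  lengths contributes equally, and dropping the arcs shorter than a power of ln n or longer than n
  over such a power changes the factor ln n only by O(ln ln n). This is why the graph can be cut
  into blocks at all: long arcs are the strongly dependent part of a matching, and they are
  negligible in number. About 2 (ln n)^8 blocks already make the Hoeffding bound smaller than every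
  power of n.\<close>

definition cbin :: "nat \<Rightarrow> real" where
  "cbin t = real ((2 * t) choose t) / 4 ^ t"

definition catalan :: "nat \<Rightarrow> real" where
  "catalan k = real ((2 * k) choose k) / real (k + 1)"

lemma cbin_0 [simp]: "cbin 0 = 1"
  by (simp add: cbin_def)

lemma cbin_pos [simp]: "cbin t > 0"
  by (simp add: cbin_def zero_less_binomial)

lemma central_binomial_Suc:
  "real (Suc t) * real ((2 * Suc t) choose Suc t) = 2 * real (2 * t + 1) * real ((2 * t) choose t)"
proof -
  have f: "real ((2 * s) choose s) = fact (2 * s) / (fact s * fact s)" for s
    by (subst binomial_fact) (auto simp: mult_2)
  have "fact (2 * Suc t) = (2 * real t + 2) * (2 * real t + 1) * fact (2 * t)"
    by (simp add: algebra_simps)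
  then have "fact (2 * Suc t) / (fact (Suc t) * fact (Suc t)) * real (Suc t) =
      2 * real (2 * t + 1) * (fact (2 * t) / (fact t * fact t) :: real)"
    by (simp add: divide_simps) (simp add: algebra_simps)
  then show ?thesis
    unfolding f by (simp only: mult.commute)
qed

lemma cbin_Suc: "cbin (Suc t) = cbin t * (2 * real t + 1) / (2 * real t + 2)"
proof -
  have "real ((2 * Suc t) choose Suc t) = 2 * real (2 * t + 1) * real ((2 * t) choose t) / real (Suc t)"
    using central_binomial_Suc[of t] by (simp only: eq_divide_eq mult.commute) simp
  then have "cbin (Suc t) = 2 * (2 * real t + 1) * real ((2 * t) choose t) / (real t + 1) / (4 * 4 ^ t)"
    unfolding cbin_def by (simp add: add.commute del: mult_Suc_right)
  also have "\<dots> = cbin t * (2 * real t + 1) / (2 * real t + 2)"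
    unfolding cbin_def by (simp add: divide_simps) (simp add: algebra_simps)
  finally show ?thesis .
qed

lemma cbin_antimono: "s \<le> t \<Longrightarrow> cbin t \<le> cbin s"
proof (induction rule: dec_induct)
  case (step t)
  have "cbin t * ((2 * real t + 1) / (2 * real t + 2)) \<le> cbin t * 1"
    by (intro mult_left_mono) (auto simp: less_imp_le)
  with step show ?case by (simp add: cbin_Suc)
qed simp

lemma catalan_cbin: "catalan k = 4 ^ k * cbin k / real (k + 1)"
  by (simp add: catalan_def cbin_def)

lemma catalan_pos [simp]: "catalan k > 0"
  by (simp add: catalan_cbin)

lemma catalan_0 [simp]: "catalan 0 = 1"
  by (simp add: catalan_def)

lemma catalan_Suc: "catalan (Suc k) = catalan k * (4 * real k + 2) / (real k + 2)"
  by (simp add: catalan_cbin cbin_Suc divide_simps) (simp add: algebra_simps)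

text \<open>The right-hand side is the coefficient of x^i in (1 - sqrt (1 - 4 x)) / (2 x), the
  Catalan generating function. In this form the Catalan recursion becomes an instance of
  Vandermonde's identity.\<close>

lemma catalan_gbinomial: "catalan i = 2 * (-4) ^ i * ((1 / 2 :: real) gchoose Suc i)"
proof (induction i)
  case (Suc i)
  have "(1 / 2 :: real) gchoose Suc (Suc i) =
      ((1 / 2) gchoose Suc i) * (1 / 2 - real (Suc i)) / real (Suc (Suc i))"
    using gbinomial_absorb_comp[of "1 / 2 :: real" "Suc i"]
      gbinomial_absorption[of "Suc i" "1 / 2 :: real"]
    by (simp add: field_simps)
  then have eq: "((1 / 2 :: real) gchoose Suc (Suc i)) * (real i + 2) = - (((1 / 2) gchoose Suc i) * (real i + 1 / 2))"
    by (simp add: field_simps)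
  have "2 * (-4) ^ Suc i * ((1 / 2 :: real) gchoose Suc (Suc i)) * (real i + 2) =
      - 8 * (-4) ^ i * (((1 / 2 :: real) gchoose Suc (Suc i)) * (real i + 2))"
    by (simp add: algebra_simps)
  also have "\<dots> = catalan i * (4 * real i + 2)"
    unfolding eq Suc.IH by (simp add: algebra_simps)
  finally show ?case
    by (simp add: catalan_Suc divide_simps)
qed simp

text \<open>The Catalan recursion is Vandermonde's identity for the exponents \<open>1/2 + 1/2 = 1\<close>.\<close>
lemma catalan_convolution:
  "catalan (Suc k) = (\<Sum>i\<le>k. catalan i * catalan (k - i))"
proof -
  define b where "b j = ((1 / 2 :: real) gchoose j)" for j
  have b0: "b 0 = 1" by (simp add: b_def)
  have "(\<Sum>j\<le>Suc (Suc k). b j * b (Suc (Suc k) - j)) = (1 :: real) gchoose Suc (Suc k)"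
    using gbinomial_Vandermonde[of "1 / 2 :: real" "1 / 2" "Suc (Suc k)"]
    by (simp add: b_def atLeast0AtMost)
  also have "\<dots> = 0"
    using binomial_gbinomial[of 1 "Suc (Suc k)", where ?'a = real] by simp
  \<comment> \<open>The terms j = 0 and j = k + 2 both equal \<open>b (Suc (Suc k))\<close>, because
    \<open>b 0 = 1\<close>. They become the new Catalan number.\<close>
  also have "(\<Sum>j\<le>Suc (Suc k). b j * b (Suc (Suc k) - j)) =
      (\<Sum>j\<le>k. b (Suc j) * b (Suc k - j)) + 2 * b (Suc (Suc k))"
    by (subst sum.atMost_Suc_shift, subst sum.atMost_Suc) (simp add: b0)
  finally have *: "(\<Sum>j\<le>k. b (Suc j) * b (Suc k - j)) = - 2 * b (Suc (Suc k))" by simp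
  have "(\<Sum>i\<le>k. catalan i * catalan (k - i)) = (\<Sum>i\<le>k. 4 * (-4) ^ k * (b (Suc i) * b (Suc k - i)))"
  proof (rule sum.cong)
    fix i assume "i \<in> {..k}"
    then have "(-4 :: real) ^ i * (-4) ^ (k - i) = (-4) ^ k" and "Suc k - i = Suc (k - i)"
      by (auto simp flip: power_add)
    then show "catalan i * catalan (k - i) = 4 * (-4) ^ k * (b (Suc i) * b (Suc k - i))"
      by (simp add: catalan_gbinomial b_def mult.assoc mult.left_commute)
  qed simp
  also have "\<dots> = 4 * (-4) ^ k * (- 2 * b (Suc (Suc k)))"
    by (simp add: * flip: sum_distrib_left)
  also have "\<dots> = catalan (Suc k)"
    by (simp add: catalan_gbinomial b_def)
  finally show ?thesis by simp
qed

text \<open>Each Wallis factor is the reciprocal of the ratio of consecutive values of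
  \<open>(cbin t)^2 * (2 * t + 1)\<close>, so the limit of the Wallis product yields the exact
  constant in the asymptotics of \<open>cbin\<close>.\<close>

lemma cbin_sq_wallis: "(cbin t)\<^sup>2 * (2 * real t + 1) * (\<Prod>k=1..t. (4 * real k^2) / (4 * real k^2 - 1)) = 1"
proof (induction t)
  case (Suc t)
  have pos: "4 * (real t + 1)^2 - 1 = (2 * real t + 1) * (2 * real t + 3)"
    by (simp add: power2_eq_square algebra_simps)
  have nz: "(2 * real t + 1) * (2 * real t + 3) \<noteq> 0" by (metis add_increasing add_nonneg_pos mult_pos_pos of_nat_0_le_iff less_irrefl zero_less_one zero_less_numeral mult_nonneg_nonneg zero_le_numeral)
  let ?P = "(\<Prod>k=1..t. (4 * real k^2) / (4 * real k^2 - 1))"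
  have "(cbin (Suc t))\<^sup>2 * (2 * real (Suc t) + 1) * ((4 * real (Suc t)^2) / (4 * real (Suc t)^2 - 1)) =
        (cbin t)\<^sup>2 * (2 * real t + 1)"
  proof -
    have "(cbin (Suc t))\<^sup>2 * (2 * real (Suc t) + 1) * ((4 * real (Suc t)^2) / (4 * real (Suc t)^2 - 1)) =
      (cbin t * (2 * real t + 1) / (2 * real t + 2))\<^sup>2 * (2 * real t + 3) *
        ((2 * real t + 2)^2 / ((2 * real t + 1) * (2 * real t + 3)))"
      unfolding cbin_Suc pos[symmetric] by (simp add: power2_eq_square algebra_simps)
    also have "\<dots> = (cbin t)\<^sup>2 * (2 * real t + 1)"
      using nz by (simp add: power2_eq_square divide_simps)
    finally show ?thesis .
  qed
  then have "(cbin (Suc t))\<^sup>2 * (2 * real (Suc t) + 1) * (?P * ((4 * real (Suc t)^2) / (4 * real (Suc t)^2 - 1))) =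
        (cbin t)\<^sup>2 * (2 * real t + 1) * ?P"
    by (subst mult.commute[of ?P], subst mult.assoc[symmetric]) simp
  also have "\<dots> = 1" by (rule Suc.IH)
  finally show ?case by (subst prod.nat_ivl_Suc') (simp_all only: mult_ac)
qed simp

lemma wallis_prod_pos: "(\<Prod>k=1..t. (4 * real k^2) / (4 * real k^2 - 1)) > 0"
proof (intro prod_pos ballI)
  fix k :: nat assume "k \<in> {1..t}"
  then have "real k ^ 2 \<ge> 1" by (intro one_le_power) simp
  then show "0 < (4 * real k^2) / (4 * real k^2 - 1)" by (intro divide_pos_pos) (linarith+)
qed

lemma cbin_sq_eq: "(cbin t)\<^sup>2 * (2 * real t + 1) = inverse (\<Prod>k=1..t. (4 * real k^2) / (4 * real k^2 - 1))"
  using cbin_sq_wallis[of t] by (intro inverse_unique[symmetric]) (simp only: mult_ac)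

lemma cbin_sq_lim: "(\<lambda>t. (cbin t)\<^sup>2 * (2 * real t + 1)) \<longlonglongrightarrow> 2 / pi"
proof -
  have "(\<lambda>t. inverse (\<Prod>k=1..t. (4 * real k^2) / (4 * real k^2 - 1))) \<longlonglongrightarrow> inverse (pi / 2)"
    by (intro tendsto_inverse wallis) auto
  then show ?thesis by (simp add: cbin_sq_eq)
qed

text \<open>The normalisations \<open>2 * t + 1\<close> here and \<open>t\<close> in
  \<open>cbin_sq_upper\<close> lie on opposite sides: the first product decreases to its limit, the
  second increases to it. So both bounds hold for every \<open>t\<close> with the sharp
  constant.\<close>

lemma cbin_sq_lower: "2 / pi \<le> (cbin t)\<^sup>2 * (2 * real t + 1)"
proof (rule decseq_ge[OF _ cbin_sq_lim])
  show "decseq (\<lambda>t. (cbin t)\<^sup>2 * (2 * real t + 1))"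
  proof (rule decseq_SucI)
    fix t
    have "(2 * real t + 1)^2 * (2 * real t + 3) \<le> (2 * real t + 2)^2 * (2 * real t + 1)"
      by (simp add: power2_eq_square algebra_simps)
    then have "(2 * real t + 1)^2 / (2 * real t + 2)^2 * (2 * real t + 3) \<le> 2 * real t + 1"
      by (simp add: divide_simps mult.commute)
    then have "(cbin t)\<^sup>2 * ((2 * real t + 1)^2 / (2 * real t + 2)^2 * (2 * real t + 3)) \<le> (cbin t)\<^sup>2 * (2 * real t + 1)"
      by (intro mult_left_mono) auto
    then show "(cbin (Suc t))\<^sup>2 * (2 * real (Suc t) + 1) \<le> (cbin t)\<^sup>2 * (2 * real t + 1)"
      by (simp add: cbin_Suc power_divide power_mult_distrib add.commute mult.assoc)
  qed
qed

lemma cbin_sq_upper: "(cbin t)\<^sup>2 * real t \<le> 1 / pi"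
proof (rule incseq_le)
  show "incseq (\<lambda>t. (cbin t)\<^sup>2 * real t)"
  proof (rule incseq_SucI)
    fix t
    have "(2 * real t + 2)^2 * real t \<le> (2 * real t + 1)^2 * (real t + 1)"
      by (simp add: power2_eq_square algebra_simps)
    then have "real t \<le> (2 * real t + 1)^2 / (2 * real t + 2)^2 * (real t + 1)"
      by (simp add: divide_simps mult.commute)
    then have "(cbin t)\<^sup>2 * real t \<le> (cbin t)\<^sup>2 * ((2 * real t + 1)^2 / (2 * real t + 2)^2 * (real t + 1))"
      by (intro mult_left_mono) auto
    then show "(cbin t)\<^sup>2 * real t \<le> (cbin (Suc t))\<^sup>2 * real (Suc t)"
      by (simp add: cbin_Suc power_divide power_mult_distrib add.commute[of 1])
  qed
  have "(\<lambda>t. (cbin t)\<^sup>2 * (2 * real t + 1) * (real t / (2 * real t + 1))) \<longlonglongrightarrow> 2 / pi * (1 / 2)"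
    by (intro tendsto_mult cbin_sq_lim) real_asymp
  moreover have "(cbin t)\<^sup>2 * (2 * real t + 1) * (real t / (2 * real t + 1)) = (cbin t)\<^sup>2 * real t" for t
    by (simp add: divide_simps)
  ultimately show "(\<lambda>t. (cbin t)\<^sup>2 * real t) \<longlonglongrightarrow> 1 / pi" by simp
qed

lemma cbin_lower: "sqrt (2 / pi) / sqrt (2 * real t + 1) \<le> cbin t"
proof (rule power2_le_imp_le)
  show "(sqrt (2 / pi) / sqrt (2 * real t + 1))\<^sup>2 \<le> (cbin t)\<^sup>2"
    using cbin_sq_lower[of t] by (simp add: power_divide divide_simps mult_ac)
qed (simp add: less_imp_le)

lemma cbin_upper: "t > 0 \<Longrightarrow> cbin t \<le> sqrt (2 / pi) / sqrt (2 * real t)"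
proof (rule power2_le_imp_le)
  show "t > 0 \<Longrightarrow> (cbin t)\<^sup>2 \<le> (sqrt (2 / pi) / sqrt (2 * real t))\<^sup>2"
    using cbin_sq_upper[of t] by (simp add: power_divide divide_simps mult_ac)
qed simp

text \<open>A relative error of 1 / (i + 1) is affordable: in the sum over arcs it meets the weight
  1 / (i + 1), and inverse squares are summable. The case i = 0 is separate because
  \<open>cbin_upper\<close> says nothing there.\<close>

lemma cbin_sqrt_upper: "cbin i * sqrt (2 * real i + 1) \<le> sqrt (2 / pi) * (1 + 1 / (real i + 1))"
proof (cases "i = 0")
  case True
  have "1 \<le> sqrt (2 / pi) * 2"
    by (rule power2_le_imp_le) (use pi_less_4 in \<open>auto simp: power_mult_distrib divide_simps\<close>)
  then show ?thesis using True by simp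
next
  case False
  have "cbin i * sqrt (2 * real i + 1) \<le> sqrt (2 / pi) / sqrt (2 * real i) * sqrt (2 * real i + 1)"
    using False by (intro mult_right_mono cbin_upper) auto
  also have "\<dots> = sqrt (2 / pi) * sqrt (1 + 1 / (2 * real i))"
    using False by (simp add: add_divide_distrib flip: real_sqrt_divide real_sqrt_mult)
  also have "sqrt (1 + 1 / (2 * real i)) \<le> 1 + 1 / (real i + 1)"
  proof (rule real_le_lsqrt)
    have "1 / (2 * real i) \<le> 1 / (real i + 1)"
      using False by (intro divide_left_mono) auto
    then have "1 + 1 / (2 * real i) \<le> 1 + 1 / (real i + 1)" by simp
    also have "\<dots> \<le> (1 + 1 / (real i + 1))\<^sup>2"
      by (intro self_le_power) auto
    finally show "1 + 1 / (2 * real i) \<le> (1 + 1 / (real i + 1))\<^sup>2" .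
  qed auto
  finally show ?thesis by (simp add: mult_left_mono)
qed

subsection \<open>The limiting arc probabilities\<close>

text \<open>The probability that, among infinitely many points with independent fair orientations, two
  given points at distance \<open>d\<close> are joined by an arc.\<close>
definition arcp :: "nat \<Rightarrow> real" where
  "arcp d = (if odd d then catalan (d div 2) / 4 ^ Suc (d div 2) else 0)"

lemma arcp_nonneg [simp]: "arcp d \<ge> 0"
  by (simp add: arcp_def less_imp_le)

lemma arcp_odd: "arcp (Suc (2 * i)) = cbin i / (4 * (real i + 1))"
  by (simp add: arcp_def catalan_cbin add.commute)

text \<open>This is the probability that a fair walk of \<open>s\<close> steps never drops below its
  start. Equivalently, given that a point opens an arc, its partner is not among the next
  \<open>s\<close> points. By parity the values at 2 j - 1 and 2 j agree, whence the rounding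
  up.\<close>

definition unmatched :: "nat \<Rightarrow> real" where
  "unmatched s = cbin (Suc s div 2)"

text \<open>The sum telescopes, since \<open>2 * arcp (Suc (2 * i))\<close> is
  \<open>cbin i - cbin (Suc i)\<close>. The factor 2 conditions on the point opening an arc.\<close>

lemma sum_arcp: "2 * (\<Sum>d<s. arcp (Suc d)) = 1 - unmatched s"
proof (induction s)
  case (Suc s)
  show ?case
  proof (cases "even s")
    case True
    then obtain i where i: "s = 2 * i" by blast
    have "2 * arcp (Suc s) = cbin i - cbin (Suc i)"
      by (simp add: i arcp_odd cbin_Suc divide_simps) (simp add: algebra_simps)
    with Suc show ?thesis by (simp add: i unmatched_def)
  next
    case False
    then have "arcp (Suc s) = 0" "Suc (Suc s) div 2 = Suc s div 2"
      by (auto simp: arcp_def elim!: oddE)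
    with Suc show ?thesis by (simp add: unmatched_def)
  qed
qed (simp add: unmatched_def)

lemma unmatched_nonneg [simp]: "unmatched s \<ge> 0"
  by (simp add: unmatched_def less_imp_le)

lemma unmatched_antimono: "s \<le> t \<Longrightarrow> unmatched t \<le> unmatched s"
  unfolding unmatched_def by (intro cbin_antimono div_le_mono) simp

lemma unmatched_upper: "s > 0 \<Longrightarrow> unmatched s \<le> sqrt (2 / pi) / sqrt (real s)"
proof -
  assume "s > 0"
  then have t: "Suc s div 2 > 0" "2 * (Suc s div 2) \<ge> s" by auto
  have "unmatched s \<le> sqrt (2 / pi) / sqrt (2 * real (Suc s div 2))"
    unfolding unmatched_def by (rule cbin_upper) (fact t(1))
  also have "\<dots> \<le> sqrt (2 / pi) / sqrt (real s)"
  proof (intro divide_left_mono real_sqrt_le_mono mult_pos_pos)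
    show "real s \<le> 2 * real (Suc s div 2)" using t(2) by linarith
  qed (use t \<open>s > 0\<close> in auto)
  finally show ?thesis .
qed

lemma unmatched_lower: "sqrt (2 / pi) / sqrt (real s + 2) \<le> unmatched s"
proof -
  have t: "2 * (Suc s div 2) + 1 \<le> s + 2" by auto
  have t': "2 * real (Suc s div 2) + 1 \<le> real s + 2"
    using t by linarith
  have "sqrt (2 / pi) / sqrt (real s + 2) \<le> sqrt (2 / pi) / sqrt (2 * real (Suc s div 2) + 1)"
    using t' by (intro divide_left_mono real_sqrt_le_mono mult_pos_pos) auto
  also have "\<dots> \<le> unmatched s" unfolding unmatched_def by (rule cbin_lower)
  finally show ?thesis .
qed

text \<open>The mean number of arcs leaving a window of \<open>m\<close> consecutive points.\<close>
definition leaving :: "nat \<Rightarrow> real" where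
  "leaving m = (\<Sum>s<m. unmatched s)"

text \<open>Comparing 1 / sqrt s with 2 (sqrt s - sqrt (s - 1)) makes the sum of the bounds
  \<open>unmatched_upper\<close> telescope. The summand 1 is the term s = 0, to which that bound
  does not apply.\<close>

lemma leaving_upper: "leaving m \<le> 1 + sqrt (8 / pi) * sqrt (real m)"
proof (cases m)
  case (Suc j)
  have "leaving (Suc j) \<le> 1 + sqrt (8 / pi) * sqrt (real j)"
  proof (induction j)
    case (Suc j)
    have e: "sqrt (8 / pi) = 2 * sqrt (2 / pi)"
      by (rule real_sqrt_unique) (auto simp: power_mult_distrib)
    have "1 / sqrt (real (Suc j)) \<le> 2 * (sqrt (real (Suc j)) - sqrt (real j))"
    proof -
      have "(sqrt (real (Suc j)) - sqrt (real j)) * (sqrt (real (Suc j)) + sqrt (real j)) = 1"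
        by (simp add: algebra_simps)
      moreover have "(sqrt (real (Suc j)) - sqrt (real j)) * (sqrt (real (Suc j)) + sqrt (real j)) \<le>
           (sqrt (real (Suc j)) - sqrt (real j)) * (2 * sqrt (real (Suc j)))"
        by (intro mult_left_mono) auto
      ultimately have "1 \<le> 2 * (sqrt (real (Suc j)) - sqrt (real j)) * sqrt (real (Suc j))"
        by (simp only: mult_ac)
      then show ?thesis by (subst pos_divide_le_eq) auto
    qed
    then have "sqrt (2 / pi) * (1 / sqrt (real (Suc j))) \<le> sqrt (2 / pi) * (2 * (sqrt (real (Suc j)) - sqrt (real j)))"
      by (intro mult_left_mono) auto
    then have "unmatched (Suc j) \<le> sqrt (8 / pi) * (sqrt (real (Suc j)) - sqrt (real j))"
      using unmatched_upper[of "Suc j"] by (simp only: e mult_ac) simp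
    then show ?case using Suc by (simp add: leaving_def algebra_simps)
  qed (simp add: leaving_def unmatched_def)
  also have "\<dots> \<le> 1 + sqrt (8 / pi) * sqrt (real m)" using Suc by (simp add: mult_left_mono)
  finally show ?thesis using Suc by simp
qed (simp add: leaving_def)

text \<open>The same telescoping from below, now with shifted argument s + 2; the constant 3 pays
  for the starting value sqrt (8 / pi) sqrt 2.\<close>

lemma leaving_lower: "sqrt (8 / pi) * sqrt (real m) - 3 \<le> leaving m"
proof -
  have e: "sqrt (8 / pi) = 2 * sqrt (2 / pi)"
    by (rule real_sqrt_unique) (auto simp: power_mult_distrib)
  have "sqrt (8 / pi) * (sqrt (real m + 2) - sqrt 2) \<le> leaving m"
  proof (induction m)
    case (Suc m)
    let ?a = "sqrt (real m + 3)" and ?b = "sqrt (real m + 2)"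
    have "2 * (?a - ?b) \<le> 1 / ?b"
    proof -
      have "(?a - ?b) * (?a + ?b) = 1" by (simp add: algebra_simps)
      moreover have "(?a - ?b) * (2 * ?b) \<le> (?a - ?b) * (?a + ?b)"
        by (intro mult_left_mono) auto
      ultimately have "2 * (?a - ?b) * ?b \<le> 1" by (simp only: mult_ac)
      then show ?thesis by (subst pos_le_divide_eq) auto
    qed
    then have "sqrt (2 / pi) * (2 * (?a - ?b)) \<le> sqrt (2 / pi) * (1 / ?b)"
      by (intro mult_left_mono) auto
    then have "sqrt (8 / pi) * (?a - ?b) \<le> unmatched m"
      using unmatched_lower[of m] by (simp only: e mult_ac) simp
    then show ?case using Suc by (simp add: leaving_def algebra_simps)
  qed (simp add: leaving_def)
  moreover have "sqrt (8 / pi) * sqrt 2 \<le> 3"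
    unfolding real_sqrt_mult[symmetric]
    by (rule real_le_lsqrt) (use pi_gt3 in \<open>auto simp: divide_simps\<close>)
  moreover have "sqrt (8 / pi) * sqrt (real m) \<le> sqrt (8 / pi) * sqrt (real m + 2)"
    by (intro mult_left_mono) auto
  ultimately show ?thesis unfolding right_diff_distrib by linarith
qed

subsection \<open>Ranks in finite sets of natural numbers\<close>

lemma bij_betw_rank:
  fixes S :: "nat set"
  assumes "finite S"
  shows "bij_betw (\<lambda>z. card (S \<inter> {..<z})) S {..<card S}"
proof -
  have inj: "inj_on (\<lambda>z. card (S \<inter> {..<z})) S"
  proof (rule linorder_inj_onI')
    fix x y assume "x \<in> S" "y \<in> S" "x < y"
    then have "S \<inter> {..<x} \<subset> S \<inter> {..<y}" by auto
    then have "card (S \<inter> {..<x}) < card (S \<inter> {..<y})"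
      using assms by (intro psubset_card_mono) auto
    then show "card (S \<inter> {..<x}) \<noteq> card (S \<inter> {..<y})" by simp
  qed
  moreover have "(\<lambda>z. card (S \<inter> {..<z})) ` S \<subseteq> {..<card S}"
    using assms by (auto intro!: psubset_card_mono)
  ultimately show ?thesis
    using assms by (simp add: bij_betw_def card_image card_subset_eq)
qed

lemma bij_betw_corank:
  fixes S :: "nat set"
  assumes "finite S"
  shows "bij_betw (\<lambda>z. card (S \<inter> {z<..})) S {..<card S}"
proof -
  have inj: "inj_on (\<lambda>z. card (S \<inter> {z<..})) S"
  proof (rule linorder_inj_onI')
    fix x y assume "x \<in> S" "y \<in> S" "x < y"
    then have "S \<inter> {y<..} \<subset> S \<inter> {x<..}" by auto
    then have "card (S \<inter> {y<..}) < card (S \<inter> {x<..})"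
      using assms by (intro psubset_card_mono) auto
    then show "card (S \<inter> {x<..}) \<noteq> card (S \<inter> {y<..})" by simp
  qed
  moreover have "(\<lambda>z. card (S \<inter> {z<..})) ` S \<subseteq> {..<card S}"
    using assms by (auto intro!: psubset_card_mono)
  ultimately show ?thesis
    using assms by (simp add: bij_betw_def card_image card_subset_eq)
qed

text \<open>Arc probabilities depend only on how many points of the class lie in between. Passing to
  ranks therefore turns a sum over a class scattered arbitrarily on the line into a sum over an
  initial segment.\<close>

lemma sum_rank:
  fixes S :: "nat set"
  shows "finite S \<Longrightarrow> (\<Sum>z\<in>S. f (card (S \<inter> {..<z}))) = (\<Sum>j<card S. f j)"
  by (rule sum.reindex_bij_betw[OF bij_betw_rank, of S f])

lemma sum_corank:
  fixes S :: "nat set"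
  shows "finite S \<Longrightarrow> (\<Sum>z\<in>S. f (card (S \<inter> {z<..}))) = (\<Sum>j<card S. f j)"
  by (rule sum.reindex_bij_betw[OF bij_betw_corank, of S f])

subsection \<open>Counting non-crossing matchings\<close>

abbreviation matchings :: "nat set \<Rightarrow> (nat \<times> nat) set set" where
  "matchings S \<equiv> {M. catalan_matching S M}"

lemma matching_arcD:
  assumes "catalan_matching S M" "A \<in> M"
  shows "fst A < snd A" "fst A \<in> S" "snd A \<in> S"
  using assms unfolding catalan_matching_def by simp_all

lemma matching_unique:
  assumes "catalan_matching S M" "A \<in> M" "B \<in> M" "z = fst A \<or> z = snd A" "z = fst B \<or> z = snd B"
  shows "A = B"
proof -
  have "z \<in> S" using assms matching_arcD[OF assms(1)] by metis
  then have "\<exists>!A. A \<in> M \<and> (z = fst A \<or> z = snd A)"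
    using assms(1) by (simp add: catalan_matching_def)
  then show ?thesis using assms by blast
qed

lemma matching_covers:
  assumes "catalan_matching S M" "z \<in> S"
  obtains A where "A \<in> M" "z = fst A \<or> z = snd A"
proof -
  have "\<exists>!A. A \<in> M \<and> (z = fst A \<or> z = snd A)"
    using assms unfolding catalan_matching_def by simp
  then show ?thesis using that by blast
qed

lemma matching_noncrossing:
  assumes "catalan_matching S M" "A \<in> M" "B \<in> M"
  shows "\<not> (fst A < fst B \<and> fst B < snd A \<and> snd A < snd B)"
  using assms unfolding catalan_matching_def arcs_alternate_def by simp

lemma catalan_matchingI:
  assumes "\<And>A. A \<in> M \<Longrightarrow> fst A < snd A \<and> fst A \<in> S \<and> snd A \<in> S"
    and "\<And>z. z \<in> S \<Longrightarrow> \<exists>A\<in>M. z = fst A \<or> z = snd A"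
    and "\<And>z A B. A \<in> M \<Longrightarrow> B \<in> M \<Longrightarrow> z = fst A \<or> z = snd A \<Longrightarrow> z = fst B \<or> z = snd B \<Longrightarrow> A = B"
    and "\<And>A B. A \<in> M \<Longrightarrow> B \<in> M \<Longrightarrow> fst A < fst B \<Longrightarrow> fst B < snd A \<Longrightarrow> snd A < snd B \<Longrightarrow> False"
  shows "catalan_matching S M"
  unfolding catalan_matching_def arcs_alternate_def
proof (intro conjI ballI)
  fix z assume "z \<in> S"
  then obtain A where "A \<in> M" "z = fst A \<or> z = snd A" using assms(2) by blast
  then show "\<exists>!A. A \<in> M \<and> (z = fst A \<or> z = snd A)" using assms(3) by (intro ex1I[of _ A]) blast+
qed (use assms in blast)+

lemma matching_subset: "catalan_matching S M \<Longrightarrow> M \<subseteq> S \<times> S"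
  using matching_arcD by fastforce

lemma finite_matching: "finite S \<Longrightarrow> catalan_matching S M \<Longrightarrow> finite M"
  by (rule finite_subset[OF matching_subset]) auto

lemma finite_matchings: "finite S \<Longrightarrow> finite (matchings S)"
  by (rule finite_subset[of _ "Pow (S \<times> S)"]) (use matching_subset in auto)

text \<open>Non-crossing, applied in both orders, excludes an arc with exactly one end under
  \<open>(x, y)\<close>. This dichotomy is what splits a matching at one of its arcs.\<close>

lemma matching_nested_or_outside:
  assumes M: "catalan_matching S M" "(x, y) \<in> M" "A \<in> M" "A \<noteq> (x, y)"
  shows "(x < fst A \<and> snd A < y) \<or> (fst A \<notin> {x..y} \<and> snd A \<notin> {x..y})"
proof -
  have "fst A \<noteq> x" "fst A \<noteq> y" "snd A \<noteq> x" "snd A \<noteq> y"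
    using matching_unique[OF M(1) M(2) M(3)] M(4) by auto
  moreover have "fst A < snd A" "x < y" using matching_arcD[OF M(1)] M by auto
  ultimately show ?thesis
    using matching_noncrossing[OF M(1) M(2) M(3)] matching_noncrossing[OF M(1) M(3) M(2)]
    by auto
qed

lemma matching_inside:
  assumes M: "catalan_matching S M" "(x, y) \<in> M"
  shows "catalan_matching (S \<inter> {x<..<y}) {A \<in> M. x < fst A \<and> snd A < y}"
proof (rule catalan_matchingI)
  fix A assume "A \<in> {A \<in> M. x < fst A \<and> snd A < y}"
  then show "fst A < snd A \<and> fst A \<in> S \<inter> {x<..<y} \<and> snd A \<in> S \<inter> {x<..<y}"
    using matching_arcD[OF M(1), of A] by auto
next
  fix z assume z: "z \<in> S \<inter> {x<..<y}"
  then obtain A where A: "A \<in> M" "z = fst A \<or> z = snd A" using matching_covers[OF M(1)] by blast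
  then have "A \<noteq> (x, y)" using z by auto
  then have "x < fst A \<and> snd A < y"
    using matching_nested_or_outside[OF M A(1)] A(2) z by auto
  then show "\<exists>A\<in>{A \<in> M. x < fst A \<and> snd A < y}. z = fst A \<or> z = snd A"
    using A by blast
next
  fix z A B assume "A \<in> {A \<in> M. x < fst A \<and> snd A < y}" "B \<in> {A \<in> M. x < fst A \<and> snd A < y}"
    "z = fst A \<or> z = snd A" "z = fst B \<or> z = snd B"
  then show "A = B" using matching_unique[OF M(1)] by blast
next
  fix A B assume "A \<in> {A \<in> M. x < fst A \<and> snd A < y}" "B \<in> {A \<in> M. x < fst A \<and> snd A < y}"
    "fst A < fst B" "fst B < snd A" "snd A < snd B"
  then show False using matching_noncrossing[OF M(1)] by blast
qed

lemma matching_outside: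
  assumes M: "catalan_matching S M" "(x, y) \<in> M"
  shows "catalan_matching (S - {x..y}) {A \<in> M. fst A \<notin> {x..y} \<and> snd A \<notin> {x..y}}"
proof (rule catalan_matchingI)
  fix A assume "A \<in> {A \<in> M. fst A \<notin> {x..y} \<and> snd A \<notin> {x..y}}"
  then show "fst A < snd A \<and> fst A \<in> S - {x..y} \<and> snd A \<in> S - {x..y}"
    using matching_arcD[OF M(1), of A] by auto
next
  fix z assume z: "z \<in> S - {x..y}"
  then obtain A where A: "A \<in> M" "z = fst A \<or> z = snd A" using matching_covers[OF M(1)] by blast
  have "x < y" using matching_arcD[OF M(1) M(2)] by simp
  then have "A \<noteq> (x, y)" using z A by auto
  then have "fst A \<notin> {x..y} \<and> snd A \<notin> {x..y}"
    using matching_nested_or_outside[OF M A(1)] A(2) z matching_arcD(1)[OF M(1) A(1)] by auto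
  then show "\<exists>A\<in>{A \<in> M. fst A \<notin> {x..y} \<and> snd A \<notin> {x..y}}. z = fst A \<or> z = snd A"
    using A by blast
next
  fix z A B assume "A \<in> {A \<in> M. fst A \<notin> {x..y} \<and> snd A \<notin> {x..y}}" "B \<in> {A \<in> M. fst A \<notin> {x..y} \<and> snd A \<notin> {x..y}}"
    "z = fst A \<or> z = snd A" "z = fst B \<or> z = snd B"
  then show "A = B" using matching_unique[OF M(1)] by blast
next
  fix A B assume "A \<in> {A \<in> M. fst A \<notin> {x..y} \<and> snd A \<notin> {x..y}}" "B \<in> {A \<in> M. fst A \<notin> {x..y} \<and> snd A \<notin> {x..y}}"
    "fst A < fst B" "fst B < snd A" "snd A < snd B"
  then show False using matching_noncrossing[OF M(1)] by blast
qed

lemma matching_join: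
  assumes xy: "x < y" "x \<in> S" "y \<in> S"
    and M1: "catalan_matching (S \<inter> {x<..<y}) M1" and M2: "catalan_matching (S - {x..y}) M2"
  shows "catalan_matching S (insert (x, y) (M1 \<union> M2))"
proof -
  have a1: "A \<in> M1 \<Longrightarrow> fst A < snd A \<and> fst A \<in> S \<and> snd A \<in> S \<and> x < fst A \<and> snd A < y" for A
    using matching_arcD[OF M1] by auto
  have a2: "A \<in> M2 \<Longrightarrow> fst A < snd A \<and> fst A \<in> S \<and> snd A \<in> S \<and> fst A \<notin> {x..y} \<and> snd A \<notin> {x..y}" for A
    using matching_arcD[OF M2] by auto
  show ?thesis
  proof (rule catalan_matchingI)
    fix A assume "A \<in> insert (x, y) (M1 \<union> M2)"
    then consider "A = (x, y)" | "A \<in> M1" | "A \<in> M2" by blast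
    then show "fst A < snd A \<and> fst A \<in> S \<and> snd A \<in> S"
      by cases (use a1[of A] a2[of A] xy in simp_all)
  next
    fix z assume "z \<in> S"
    then consider "z = x \<or> z = y" | "z \<in> S \<inter> {x<..<y}" | "z \<in> S - {x..y}" by force
    then show "\<exists>A\<in>insert (x, y) (M1 \<union> M2). z = fst A \<or> z = snd A"
    proof cases
      case 2 then show ?thesis using matching_covers[OF M1] by blast
    next
      case 3 then show ?thesis using matching_covers[OF M2] by blast
    qed auto
  next
    fix z A B
    assume AB: "A \<in> insert (x, y) (M1 \<union> M2)" "B \<in> insert (x, y) (M1 \<union> M2)"
      "z = fst A \<or> z = snd A" "z = fst B \<or> z = snd B"
    have e: "(z = x \<or> z = y) \<and> C = (x, y) \<or> (x < z \<and> z < y) \<and> C \<in> M1 \<or> z \<notin> {x..y} \<and> C \<in> M2"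
      if "C \<in> insert (x, y) (M1 \<union> M2)" "z = fst C \<or> z = snd C" for C
    proof -
      from that(1) consider "C = (x, y)" | "C \<in> M1" | "C \<in> M2" by blast
      then show ?thesis
        by cases (use a1[of C] a2[of C] that(2) in auto)
    qed
    have eA: "(z = x \<or> z = y) \<and> A = (x, y) \<or> (x < z \<and> z < y) \<and> A \<in> M1 \<or> z \<notin> {x..y} \<and> A \<in> M2"
      and eB: "(z = x \<or> z = y) \<and> B = (x, y) \<or> (x < z \<and> z < y) \<and> B \<in> M1 \<or> z \<notin> {x..y} \<and> B \<in> M2"
      using e AB by blast+
    consider "z = x \<or> z = y" | "x < z" "z < y" | "z \<notin> {x..y}" by force
    then show "A = B"
    proof cases
      case 1
      then have "A = (x, y)" "B = (x, y)" using eA eB xy by auto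
      then show ?thesis by simp
    next
      case 2
      then have "A \<in> M1" "B \<in> M1" using eA eB by auto
      then show ?thesis using matching_unique[OF M1] AB by blast
    next
      case 3
      then have "A \<in> M2" "B \<in> M2" using eA eB xy by auto
      then show ?thesis using matching_unique[OF M2] AB by blast
    qed
  next
    fix A B
    assume AB: "A \<in> insert (x, y) (M1 \<union> M2)" "B \<in> insert (x, y) (M1 \<union> M2)"
      and c: "fst A < fst B" "fst B < snd A" "snd A < snd B"
    have "\<not> (A \<in> M1 \<and> B \<in> M1)" "\<not> (A \<in> M2 \<and> B \<in> M2)"
      using matching_noncrossing[OF M1] matching_noncrossing[OF M2] c by blast+
    moreover from AB(1) consider "A = (x, y)" | "A \<in> M1" | "A \<in> M2" by blast
    then have "(A = (x, y) \<and> B \<noteq> (x, y)) \<or> (A \<in> M1 \<and> x < fst A \<and> snd A < y) \<or>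
        (A \<in> M2 \<and> fst A \<notin> {x..y} \<and> snd A \<notin> {x..y})"
      by cases (use a1[of A] a2[of A] c in auto)
    moreover from AB(2) consider "B = (x, y)" | "B \<in> M1" | "B \<in> M2" by blast
    then have "(B = (x, y)) \<or> (B \<in> M1 \<and> x < fst B \<and> snd B < y) \<or>
        (B \<in> M2 \<and> fst B \<notin> {x..y} \<and> snd B \<notin> {x..y})"
      by cases (use a1[of B] a2[of B] in auto)
    ultimately show False using c by auto
  qed
qed

text \<open>An arc decouples the points under it from those outside: restricting to the two sides is
  inverse to \<open>matching_join\<close>.\<close>

lemma card_matchings_with_arc:
  assumes xy: "x < y" "x \<in> S" "y \<in> S"
  shows "card {M \<in> matchings S. (x, y) \<in> M} =
    card (matchings (S \<inter> {x<..<y})) * card (matchings (S - {x..y}))"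
proof -
  let ?f = "\<lambda>(M1, M2). insert (x, y) (M1 \<union> M2)"
  let ?g = "\<lambda>M. ({A \<in> M. x < fst A \<and> snd A < y}, {A \<in> M. fst A \<notin> {x..y} \<and> snd A \<notin> {x..y}})"
  have "bij_betw ?f (matchings (S \<inter> {x<..<y}) \<times> matchings (S - {x..y})) {M \<in> matchings S. (x, y) \<in> M}"
  proof (rule bij_betwI[where g = ?g])
    show "?f \<in> matchings (S \<inter> {x<..<y}) \<times> matchings (S - {x..y}) \<rightarrow> {M \<in> matchings S. (x, y) \<in> M}"
      using matching_join[OF xy] by auto
    show "?g \<in> {M \<in> matchings S. (x, y) \<in> M} \<rightarrow> matchings (S \<inter> {x<..<y}) \<times> matchings (S - {x..y})"
      using matching_inside matching_outside by auto
    fix p assume "p \<in> matchings (S \<inter> {x<..<y}) \<times> matchings (S - {x..y})"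
    then obtain M1 M2 where p: "p = (M1, M2)" and M1: "catalan_matching (S \<inter> {x<..<y}) M1"
      and M2: "catalan_matching (S - {x..y}) M2" by auto
    have a1: "A \<in> M1 \<Longrightarrow> fst A < snd A \<and> x < fst A \<and> snd A < y" for A
      using matching_arcD[OF M1] by auto
    have a2: "A \<in> M2 \<Longrightarrow> fst A \<notin> {x..y} \<and> snd A \<notin> {x..y} \<and> fst A < snd A" for A
      using matching_arcD[OF M2] by auto
    have "{A \<in> insert (x, y) (M1 \<union> M2). x < fst A \<and> snd A < y} = M1"
    proof (rule set_eqI)
      fix A show "A \<in> {A \<in> insert (x, y) (M1 \<union> M2). x < fst A \<and> snd A < y} \<longleftrightarrow> A \<in> M1"
        using a1[of A] a2[of A] xy by auto
    qed
    moreover have "{A \<in> insert (x, y) (M1 \<union> M2). fst A \<notin> {x..y} \<and> snd A \<notin> {x..y}} = M2"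
    proof (rule set_eqI)
      fix A show "A \<in> {A \<in> insert (x, y) (M1 \<union> M2). fst A \<notin> {x..y} \<and> snd A \<notin> {x..y}} \<longleftrightarrow> A \<in> M2"
        using a1[of A] a2[of A] xy by auto
    qed
    ultimately show "?g (?f p) = p" unfolding p prod.case by (rule arg_cong2[of _ _ _ _ Pair])
  next
    fix M assume "M \<in> {M \<in> matchings S. (x, y) \<in> M}"
    then have M: "catalan_matching S M" "(x, y) \<in> M" by auto
    show "?f (?g M) = M" unfolding prod.case
    proof (rule set_eqI)
      fix A show "A \<in> insert (x, y) ({A \<in> M. x < fst A \<and> snd A < y} \<union>
          {A \<in> M. fst A \<notin> {x..y} \<and> snd A \<notin> {x..y}}) \<longleftrightarrow> A \<in> M"
        using matching_nested_or_outside[OF M, of A] M(2) by blast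
    qed
  qed
  then have "card (matchings (S \<inter> {x<..<y}) \<times> matchings (S - {x..y})) = card {M \<in> matchings S. (x, y) \<in> M}"
    by (rule bij_betw_same_card)
  then show ?thesis by (simp add: card_cartesian_product)
qed

section \<open>The Catalan recursion for the number of matchings\<close>

lemma catalan_nonzero [simp]: "catalan k \<noteq> 0"
  using catalan_pos[of k] by linarith

text \<open>The value 0 at odd sizes lets the recursion run over all partners of a point without a
  parity restriction.\<close>

definition matching_count :: "nat \<Rightarrow> real" where
  "matching_count j = (if even j then catalan (j div 2) else 0)"

lemma sum_even_index:
  fixes f :: "nat \<Rightarrow> real"
  assumes "\<And>j. odd j \<Longrightarrow> f j = 0"
  shows "(\<Sum>j<2 * k + 1. f j) = (\<Sum>i\<le>k. f (2 * i))"
  by (induction k) (use assms in \<open>auto simp: lessThan_Suc\<close>)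

lemma matching_count_convolution:
  "(\<Sum>j<Suc n. matching_count j * matching_count (n - j)) = matching_count (Suc (Suc n))"
proof (cases "even n")
  case True
  then obtain k where n: "n = 2 * k" by blast
  have "(\<Sum>j<Suc n. matching_count j * matching_count (n - j)) =
      (\<Sum>i\<le>k. matching_count (2 * i) * matching_count (n - 2 * i))"
    using sum_even_index[of "\<lambda>j. matching_count j * matching_count (n - j)" k]
    by (simp add: n matching_count_def)
  also have "\<dots> = (\<Sum>i\<le>k. catalan i * catalan (k - i))"
    by (intro sum.cong) (auto simp: n matching_count_def simp flip: diff_mult_distrib2)
  finally show ?thesis by (simp add: catalan_convolution matching_count_def n)
next
  case False
  have "matching_count j * matching_count (n - j) = 0" if "j < Suc n" for j
    using False that by (cases "even j") (auto simp: matching_count_def)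
  then have "(\<Sum>j<Suc n. matching_count j * matching_count (n - j)) = 0"
    by (intro sum.neutral) auto
  then show ?thesis using False by (simp add: matching_count_def)
qed

text \<open>Strong induction, splitting by the partner \<open>y\<close> of the least point. The
  point sets under and outside that arc are arbitrary finite sets, but only their sizes enter, and
  by ranks the sum over \<open>y\<close> is the convolution
  \<open>matching_count_convolution\<close>.\<close>

theorem card_matchings:
  "finite S \<Longrightarrow> real (card (matchings S)) = matching_count (card S)"
proof (induction "card S" arbitrary: S rule: less_induct)
  case less
  show ?case
  proof (cases "S = {}")
    case True
    have "matchings {} = {{}}" by (auto simp: catalan_matching_def)
    then show ?thesis using True by (simp add: matching_count_def)
  next
    case False
    define x where "x = Min S"
    define S' where "S' = S - {x}"
    have x: "x \<in> S" and xmin: "\<And>y. y \<in> S' \<Longrightarrow> x < y"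
      using False less.prems by (auto simp: x_def S'_def order_less_le)
    have fin: "finite S'" using less.prems by (simp add: S'_def)
    have cS: "card S = Suc (card S')"
      using card.remove[OF less.prems x] by (simp add: S'_def)
    have "matchings S = (\<Union>y\<in>S'. {M \<in> matchings S. (x, y) \<in> M})"
    proof (intro set_eqI iffI)
      fix M assume M: "M \<in> matchings S"
      then obtain A where A: "A \<in> M" "x = fst A \<or> x = snd A"
        using matching_covers x by blast
      have "fst A < snd A" "fst A \<in> S" "snd A \<in> S" using matching_arcD M A by auto
      moreover have "fst A = x"
        using A(2) \<open>fst A < snd A\<close> \<open>fst A \<in> S\<close> xmin[of "fst A"] by (auto simp: S'_def)
      ultimately have "fst A = x" "snd A \<in> S'" by (auto simp: S'_def)
      then show "M \<in> (\<Union>y\<in>S'. {M \<in> matchings S. (x, y) \<in> M})" using A M by (cases A) auto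
    qed auto
    then have "card (matchings S) = card (\<Union>y\<in>S'. {M \<in> matchings S. (x, y) \<in> M})" by (rule arg_cong)
    also have "\<dots> = (\<Sum>y\<in>S'. card {M \<in> matchings S. (x, y) \<in> M})"
    proof (rule card_UN_disjoint)
      show "\<forall>i\<in>S'. finite {M \<in> matchings S. (x, i) \<in> M}"
        using finite_matchings[OF less.prems] by (auto intro: rev_finite_subset)
      show "\<forall>i\<in>S'. \<forall>j\<in>S'. i \<noteq> j \<longrightarrow> {M \<in> matchings S. (x, i) \<in> M} \<inter> {M \<in> matchings S. (x, j) \<in> M} = {}"
      proof (intro ballI impI)
        fix i j :: nat assume "i \<noteq> j"
        then have "\<not> (catalan_matching S M \<and> (x, i) \<in> M \<and> (x, j) \<in> M)" for M
          using matching_unique[of S M "(x, i)" "(x, j)" x] by auto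
        then show "{M \<in> matchings S. (x, i) \<in> M} \<inter> {M \<in> matchings S. (x, j) \<in> M} = {}" by blast
      qed
    qed (fact fin)
    also have "real \<dots> = (\<Sum>y\<in>S'. matching_count (card (S' \<inter> {..<y})) * matching_count (card S' - 1 - card (S' \<inter> {..<y})))"
      unfolding of_nat_sum
    proof (rule sum.cong)
      fix y assume y: "y \<in> S'"
      have 1: "S \<inter> {x<..<y} = S' \<inter> {..<y}" 
      proof (rule set_eqI)
        fix z show "z \<in> S \<inter> {x<..<y} \<longleftrightarrow> z \<in> S' \<inter> {..<y}"
          using xmin[of z] by (auto simp: S'_def)
      qed
      have 2: "S - {x..y} = S' - insert y (S' \<inter> {..<y})" 
      proof (rule set_eqI)
        fix z show "z \<in> S - {x..y} \<longleftrightarrow> z \<in> S' - insert y (S' \<inter> {..<y})"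
          using xmin[of z] xmin[OF y] by (auto simp: S'_def)
      qed
      have 3: "card (S - {x..y}) = card S' - 1 - card (S' \<inter> {..<y})"
        unfolding 2 using y fin by (subst card_Diff_subset) auto
      have 4: "card (S' \<inter> {..<y}) < card S" "card (S - {x..y}) < card S"
        using cS fin card_mono[of S' "S' \<inter> {..<y}"] unfolding 3 by auto
      have "real (card {M \<in> matchings S. (x, y) \<in> M}) = real (card (matchings (S \<inter> {x<..<y}))) * real (card (matchings (S - {x..y})))"
        using y xmin[OF y] x by (subst card_matchings_with_arc) (auto simp: S'_def)
      also have "\<dots> = matching_count (card (S' \<inter> {..<y})) * matching_count (card (S - {x..y}))"
        using less.hyps[of "S \<inter> {x<..<y}"] less.hyps[of "S - {x..y}"] less.prems 4 1 by simp
      finally show "real (card {M \<in> matchings S. (x, y) \<in> M}) =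
        matching_count (card (S' \<inter> {..<y})) * matching_count (card S' - 1 - card (S' \<inter> {..<y}))"
        by (simp only: 3)
    qed simp
    also have "\<dots> = (\<Sum>j<card S'. matching_count j * matching_count (card S' - 1 - j))"
      by (rule sum_rank[OF fin, of "\<lambda>j. matching_count j * matching_count (card S' - 1 - j)"])
    also have "\<dots> = matching_count (card S)"
      using matching_count_convolution[of "card S' - 1"] cS
      by (cases "card S'") (auto simp: matching_count_def)
    finally show ?thesis .
  qed
qed

subsection \<open>Arc probabilities in a uniform matching\<close>

text \<open>The probability that two points at rank distance \<open>d\<close> are joined in a
  uniform matching of \<open>2 * k\<close> points. It is independent of their position, because only
  the numbers of points under and outside the arc matter.\<close>

definition arcq :: "nat \<Rightarrow> nat \<Rightarrow> real" where
  "arcq k d = (if odd d then catalan (d div 2) * catalan (k - 1 - d div 2) / catalan k else 0)"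

lemma arcq_nonneg [simp]: "arcq k d \<ge> 0"
  by (simp add: arcq_def less_imp_le)

lemma card_between:
  fixes S :: "nat set"
  assumes "finite S" "x \<in> S" "y \<in> S" "x < y"
  shows "card (S \<inter> {x<..<y}) + card (S - {x..y}) + 2 = card S"
proof -
  have "card S = card (insert x (insert y (S \<inter> {x<..<y} \<union> (S - {x..y}))))"
    by (rule arg_cong[of _ _ card]) (use assms in force)
  also have "\<dots> = card (S \<inter> {x<..<y} \<union> (S - {x..y})) + 2"
    using assms by (subst card_insert_disjoint; (subst card_insert_disjoint)?) auto
  also have "card (S \<inter> {x<..<y} \<union> (S - {x..y})) = card (S \<inter> {x<..<y}) + card (S - {x..y})"
    using assms by (intro card_Un_disjoint) auto
  finally show ?thesis by simp
qed

lemma card_matchings_arc: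
  assumes "finite S" "card S = 2 * k" "x \<in> S" "y \<in> S" "x < y"
  shows "real (card {M \<in> matchings S. (x, y) \<in> M}) =
    real (card (matchings S)) * arcq k (Suc (card (S \<inter> {x<..<y})))"
proof -
  define j where "j = card (S \<inter> {x<..<y})"
  have c: "card (S - {x..y}) = 2 * k - 2 - j" "j + 2 \<le> 2 * k"
    using card_between[OF assms(1,3,4,5)] assms(2) by (simp_all add: j_def)
  have "real (card {M \<in> matchings S. (x, y) \<in> M}) = matching_count j * matching_count (2 * k - 2 - j)"
    using assms c by (subst card_matchings_with_arc) (auto simp: card_matchings j_def)
  also have "\<dots> = catalan k * arcq k (Suc j)"
  proof (cases "even j")
    case True
    then obtain i where i: "j = 2 * i" by blast
    have "2 * k - 2 - j = 2 * (k - 1 - i)" using i by simp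
    then show ?thesis by (simp add: i matching_count_def arcq_def)
  qed (simp add: matching_count_def arcq_def)
  finally show ?thesis using assms by (simp add: card_matchings matching_count_def j_def)
qed

lemma catalan_le_power4: "catalan (j + m) \<le> 4 ^ m * catalan j"
proof (induction m)
  case (Suc m)
  have "catalan (Suc (j + m)) \<le> 4 * catalan (j + m)"
    using catalan_pos[of "j + m"] by (simp add: catalan_Suc divide_simps)
  with Suc show ?case by simp
qed simp

text \<open>A Catalan number is at most 4 times its predecessor, and 4 is the limiting ratio, so
  finiteness favours each single arc. This direction is the useful one for the upper bound: more
  inner arcs mean fewer arcs leaving a window.\<close>

lemma arcp_le_arcq:
  assumes "d < 2 * k" shows "arcp d \<le> arcq k d"
proof (cases "odd d")
  case True
  define i where "i = d div 2"
  have "i < k" using assms by (simp add: i_def)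
  then have "catalan k \<le> 4 ^ Suc i * catalan (k - 1 - i)"
    using catalan_le_power4[of "k - 1 - i" "Suc i"] by simp
  then have "catalan i * catalan k \<le> catalan i * (4 ^ Suc i * catalan (k - 1 - i))"
    by (intro mult_left_mono) (auto simp: less_imp_le)
  then show ?thesis using True catalan_pos[of k]
    by (simp add: arcp_def arcq_def i_def[symmetric] divide_simps mult_ac)
qed (simp add: arcp_def arcq_def)

text \<open>For a fixed right end \<open>y\<close> the candidates for the left end lie at rank
  distances 1, 2, ... up to the rank of \<open>y\<close> in the window, and \<open>sum_arcp\<close>
  evaluates their total.\<close>

lemma sum_arcp_pairs:
  fixes W :: "nat set"
  assumes "finite W"
  shows "2 * (\<Sum>y\<in>W. \<Sum>x\<in>W \<inter> {..<y}. arcp (Suc (card (W \<inter> {x<..<y})))) = real (card W) - leaving (card W)"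
proof -
  have "(\<Sum>x\<in>W \<inter> {..<y}. arcp (Suc (card (W \<inter> {x<..<y})))) = (\<Sum>d<card (W \<inter> {..<y}). arcp (Suc d))" for y
  proof -
    have "(\<Sum>x\<in>W \<inter> {..<y}. arcp (Suc (card (W \<inter> {x<..<y})))) =
        (\<Sum>x\<in>W \<inter> {..<y}. arcp (Suc (card ((W \<inter> {..<y}) \<inter> {x<..}))))"
      by (intro sum.cong refl arg_cong[of _ _ arcp] arg_cong[of _ _ Suc] arg_cong[of _ _ card]) auto
    then show ?thesis using sum_corank[of "W \<inter> {..<y}" "\<lambda>d. arcp (Suc d)"] assms by simp
  qed
  then have "2 * (\<Sum>y\<in>W. \<Sum>x\<in>W \<inter> {..<y}. arcp (Suc (card (W \<inter> {x<..<y})))) =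
      (\<Sum>y\<in>W. 1 - unmatched (card (W \<inter> {..<y})))"
    by (subst sum_distrib_left) (simp add: sum_arcp)
  also have "\<dots> = (\<Sum>j<card W. 1 - unmatched j)"
    by (rule sum_rank[OF assms, of "\<lambda>j. 1 - unmatched j"])
  finally show ?thesis by (simp add: sum_subtractf leaving_def)
qed

lemma sum_of_bool_card:
  "finite A \<Longrightarrow> (\<Sum>x\<in>A. of_bool (P x)) = (of_nat (card {x \<in> A. P x}) :: 'a :: semiring_1)"
  by (simp add: Int_def)

text \<open>A handshake count: each point of \<open>W\<close> lies on exactly one arc, a leaving arc
  is counted once and an inner arc twice.\<close>

lemma matching_degree_sum:
  assumes S: "finite S" and M: "catalan_matching S M" and W: "W \<subseteq> S"
  shows "card {A \<in> M. (fst A \<in> W) \<noteq> (snd A \<in> W)} + 2 * card {A \<in> M. fst A \<in> W \<and> snd A \<in> W} = card W"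
proof -
  have finM: "finite M" using finite_matching S M by blast
  have finW: "finite W" using S W finite_subset by blast
  have "card W = (\<Sum>z\<in>W. \<Sum>A\<in>M. of_bool (z = fst A \<or> z = snd A))"
  proof -
    have "(\<Sum>A\<in>M. of_bool (z = fst A \<or> z = snd A)) = (1 :: nat)" if "z \<in> W" for z
    proof -
      obtain A where A: "A \<in> M" "z = fst A \<or> z = snd A" using matching_covers M W \<open>z \<in> W\<close> by blast
      then have "{B \<in> M. z = fst B \<or> z = snd B} = {A}" using matching_unique[OF M] by blast
      then show ?thesis using finM by (subst sum_of_bool_card) simp_all
    qed
    then show ?thesis by simp
  qed
  also have "\<dots> = (\<Sum>A\<in>M. \<Sum>z\<in>W. of_bool (z = fst A \<or> z = snd A))"
    by (rule sum.swap)
  also have "\<dots> = (\<Sum>A\<in>M. of_bool ((fst A \<in> W) \<noteq> (snd A \<in> W)) + 2 * of_bool (fst A \<in> W \<and> snd A \<in> W))"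
  proof (rule sum.cong)
    fix A assume "A \<in> M"
    then have ne: "fst A \<noteq> snd A" using matching_arcD(1)[OF M, of A] by simp
    have "{z \<in> W. z = fst A \<or> z = snd A} = W \<inter> {fst A, snd A}" by blast
    then have "(\<Sum>z\<in>W. of_bool (z = fst A \<or> z = snd A)) = card (W \<inter> {fst A, snd A})"
      using finW by (simp only: sum_of_bool_card of_nat_id)
    also have "\<dots> = of_bool ((fst A \<in> W) \<noteq> (snd A \<in> W)) + 2 * of_bool (fst A \<in> W \<and> snd A \<in> W)"
      using ne by (cases "fst A \<in> W"; cases "snd A \<in> W") (auto simp: Int_insert_right)
    finally show "(\<Sum>z\<in>W. of_bool (z = fst A \<or> z = snd A)) =
       (of_bool ((fst A \<in> W) \<noteq> (snd A \<in> W)) + 2 * of_bool (fst A \<in> W \<and> snd A \<in> W) :: nat)" .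
  qed simp
  also have "\<dots> = card {A \<in> M. (fst A \<in> W) \<noteq> (snd A \<in> W)} + 2 * card {A \<in> M. fst A \<in> W \<and> snd A \<in> W}"
    unfolding sum.distrib sum_distrib_left[symmetric] sum_of_bool_card[OF finM] of_nat_id by (rule refl)
  finally show ?thesis by simp
qed

text \<open>A window of \<open>m\<close> points is left by \<open>m\<close> minus twice the number of inner arcs, and inner arcs
  are at least as likely as in the limiting model.\<close>
lemma sum_leaving_window:
  fixes l h :: nat
  assumes S: "finite S" "card S = 2 * k"
  defines "W \<equiv> S \<inter> {l<..<h}"
  shows "(\<Sum>M\<in>matchings S. real (card {A \<in> M. (fst A \<in> W) \<noteq> (snd A \<in> W)})) \<le>
    real (card (matchings S)) * leaving (card W)"
proof -
  let ?N = "real (card (matchings S))"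
  have finW: "finite W" using S by (simp add: W_def)
  have fin: "finite (matchings S)" using finite_matchings S by blast
  have inner: "?N * (\<Sum>y\<in>W. \<Sum>x\<in>W \<inter> {..<y}. arcp (Suc (card (W \<inter> {x<..<y})))) \<le>
      (\<Sum>M\<in>matchings S. real (card {A \<in> M. fst A \<in> W \<and> snd A \<in> W}))"
  proof -
    have "?N * (\<Sum>y\<in>W. \<Sum>x\<in>W \<inter> {..<y}. arcp (Suc (card (W \<inter> {x<..<y})))) \<le>
        (\<Sum>y\<in>W. \<Sum>x\<in>W \<inter> {..<y}. real (card {M \<in> matchings S. (x, y) \<in> M}))"
      unfolding sum_distrib_left
    proof (intro sum_mono)
      fix y x assume y: "y \<in> W" and x: "x \<in> W \<inter> {..<y}"
      then have xy: "x \<in> S" "y \<in> S" "x < y" and eq: "W \<inter> {x<..<y} = S \<inter> {x<..<y}"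
        by (auto simp: W_def)
      have "card (S \<inter> {x<..<y}) + 2 \<le> 2 * k" using card_between[OF S(1) xy] S(2) by simp
      then have "?N * arcp (Suc (card (S \<inter> {x<..<y}))) \<le> ?N * arcq k (Suc (card (S \<inter> {x<..<y})))"
        by (intro mult_left_mono arcp_le_arcq) auto
      then show "?N * arcp (Suc (card (W \<inter> {x<..<y}))) \<le> real (card {M \<in> matchings S. (x, y) \<in> M})"
        unfolding eq using card_matchings_arc[OF S xy] by simp
    qed
    also have "\<dots> = (\<Sum>y\<in>W. \<Sum>x\<in>W \<inter> {..<y}. \<Sum>M\<in>matchings S. of_bool ((x, y) \<in> M))"
      unfolding sum_of_bool_card[OF fin] by (rule refl)
    also have "\<dots> = (\<Sum>y\<in>W. \<Sum>M\<in>matchings S. \<Sum>x\<in>W \<inter> {..<y}. of_bool ((x, y) \<in> M))"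
      by (intro sum.cong refl sum.swap)
    also have "\<dots> = (\<Sum>M\<in>matchings S. \<Sum>y\<in>W. \<Sum>x\<in>W \<inter> {..<y}. of_bool ((x, y) \<in> M))"
      by (rule sum.swap)
    also have "\<dots> = (\<Sum>M\<in>matchings S. real (card {A \<in> M. fst A \<in> W \<and> snd A \<in> W}))"
    proof (rule sum.cong)
      fix M assume M: "M \<in> matchings S"
      have "(\<Sum>y\<in>W. \<Sum>x\<in>W \<inter> {..<y}. of_bool ((x, y) \<in> M) :: real) =
          (\<Sum>p\<in>Sigma W (\<lambda>y. W \<inter> {..<y}). of_bool ((snd p, fst p) \<in> M))"
        using finW by (subst sum.Sigma) (auto simp: case_prod_beta)
      also have "\<dots> = real (card {p \<in> Sigma W (\<lambda>y. W \<inter> {..<y}). (snd p, fst p) \<in> M})"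
        using finW by (intro sum_of_bool_card finite_SigmaI) auto
      also have "card {p \<in> Sigma W (\<lambda>y. W \<inter> {..<y}). (snd p, fst p) \<in> M} = card {A \<in> M. fst A \<in> W \<and> snd A \<in> W}"
      proof (rule bij_betw_same_card[of prod.swap], rule bij_betwI[where g = prod.swap])
        show "prod.swap \<in> {A \<in> M. fst A \<in> W \<and> snd A \<in> W} \<rightarrow> {p \<in> Sigma W (\<lambda>y. W \<inter> {..<y}). (snd p, fst p) \<in> M}"
          using matching_arcD[of S M] M by auto
      qed auto
      finally show "(\<Sum>y\<in>W. \<Sum>x\<in>W \<inter> {..<y}. of_bool ((x, y) \<in> M)) = real (card {A \<in> M. fst A \<in> W \<and> snd A \<in> W})" .
    qed simp
    finally show ?thesis .
  qed
  have "real (card {A \<in> M. (fst A \<in> W) \<noteq> (snd A \<in> W)}) = real (card W) - 2 * real (card {A \<in> M. fst A \<in> W \<and> snd A \<in> W})"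
    if "M \<in> matchings S" for M
    using matching_degree_sum[OF S(1), of M W] that by (simp add: W_def)
  then have "(\<Sum>M\<in>matchings S. real (card {A \<in> M. (fst A \<in> W) \<noteq> (snd A \<in> W)})) =
      ?N * real (card W) - 2 * (\<Sum>M\<in>matchings S. real (card {A \<in> M. fst A \<in> W \<and> snd A \<in> W}))"
    by (simp add: sum_subtractf flip: sum_distrib_left)
  also have "\<dots> \<le> ?N * real (card W) - 2 * (?N * (\<Sum>y\<in>W. \<Sum>x\<in>W \<inter> {..<y}. arcp (Suc (card (W \<inter> {x<..<y})))))"
    using inner by simp
  also have "\<dots> = ?N * (real (card W) - 2 * (\<Sum>y\<in>W. \<Sum>x\<in>W \<inter> {..<y}. arcp (Suc (card (W \<inter> {x<..<y})))))"
    by (simp add: algebra_simps)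
  also have "\<dots> = ?N * leaving (card W)"
    by (subst sum_arcp_pairs[OF finW]) simp
  finally show ?thesis .
qed

subsection \<open>The expected number of edges for a fixed colouring\<close>

definition pairs :: "nat set \<Rightarrow> (nat \<times> nat) set" where
  "pairs S = {p \<in> S \<times> S. fst p < snd p}"

definition gap :: "nat set \<Rightarrow> nat \<times> nat \<Rightarrow> nat" where
  "gap S p = Suc (card (S \<inter> {fst p<..<snd p}))"

lemma finite_pairs: "finite S \<Longrightarrow> finite (pairs S)"
  by (simp add: pairs_def)

lemma matching_subset_pairs: "catalan_matching S M \<Longrightarrow> M \<subseteq> pairs S"
  using matching_arcD[of S M] by (auto simp: pairs_def)

lemma rank_gap:
  assumes "finite S" "p \<in> pairs S"
  shows "card (S \<inter> {..<fst p}) + gap S p = card (S \<inter> {..<snd p})"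
proof -
  have p: "fst p \<in> S" "fst p < snd p" using assms(2) by (auto simp: pairs_def)
  have "S \<inter> {..<snd p} = insert (fst p) (S \<inter> {..<fst p} \<union> S \<inter> {fst p<..<snd p})"
    using p by auto
  also have "card \<dots> = Suc (card (S \<inter> {..<fst p} \<union> S \<inter> {fst p<..<snd p}))"
    using assms(1) by (intro card_insert_disjoint) auto
  also have "card (S \<inter> {..<fst p} \<union> S \<inter> {fst p<..<snd p}) = card (S \<inter> {..<fst p}) + card (S \<inter> {fst p<..<snd p})"
    using assms(1) by (intro card_Un_disjoint) auto
  finally show ?thesis by (simp add: gap_def)
qed

lemma inj_on_rank: "finite (S :: nat set) \<Longrightarrow> inj_on (\<lambda>z. card (S \<inter> {..<z})) S"
  using bij_betw_rank[of S] by (simp add: bij_betw_def)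

lemma matchings_nonempty:
  assumes "finite S" "card S = 2 * k"
  shows "real (card (matchings S)) > 0"
  using assms by (simp add: card_matchings matching_count_def)

text \<open>Linearity of expectation, multiplied by the number of matchings so that the upper bound
  for a fixed colouring is an inequality between finite sums.\<close>

lemma sum_matchings_arcs:
  assumes S: "finite S" "card S = 2 * k"
  shows "(\<Sum>M\<in>matchings S. \<Sum>A\<in>M. f A) =
    real (card (matchings S)) * (\<Sum>p\<in>pairs S. arcq k (gap S p) * f p)"
proof -
  have fin: "finite (matchings S)" "finite (pairs S)" using finite_matchings finite_pairs S by auto
  have "(\<Sum>M\<in>matchings S. \<Sum>A\<in>M. f A) = (\<Sum>M\<in>matchings S. \<Sum>p\<in>pairs S. of_bool (p \<in> M) * f p)"
  proof (rule sum.cong)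
    fix M assume "M \<in> matchings S"
    then have "M \<subseteq> pairs S" using matching_subset_pairs by blast
    then show "(\<Sum>A\<in>M. f A) = (\<Sum>p\<in>pairs S. of_bool (p \<in> M) * f p)"
      using fin(2) by (intro sum.mono_neutral_cong_left) auto
  qed simp
  also have "\<dots> = (\<Sum>p\<in>pairs S. (\<Sum>M\<in>matchings S. of_bool (p \<in> M)) * f p)"
    by (subst sum.swap) (simp add: sum_distrib_right)
  also have "\<dots> = (\<Sum>p\<in>pairs S. real (card (matchings S)) * (arcq k (gap S p) * f p))"
  proof (rule sum.cong)
    fix p assume "p \<in> pairs S"
    then have p: "fst p \<in> S" "snd p \<in> S" "fst p < snd p" by (auto simp: pairs_def)
    have "(\<Sum>M\<in>matchings S. of_bool (p \<in> M)) = real (card {M \<in> matchings S. p \<in> M})"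
      by (rule sum_of_bool_card[OF fin(1)])
    also have "\<dots> = real (card (matchings S)) * arcq k (gap S p)"
      using card_matchings_arc[OF S p] by (simp add: gap_def)
    finally show "(\<Sum>M\<in>matchings S. of_bool (p \<in> M)) * f p = real (card (matchings S)) * (arcq k (gap S p) * f p)"
      by simp
  qed simp
  finally show ?thesis by (simp add: sum_distrib_left)
qed

text \<open>The exact value is \<open>k\<close>, the number of arcs. Counting arcs by their left
  ends loses a factor 2, which only affects the O(n) term.\<close>

lemma sum_arcq_all:
  assumes S: "finite S" "card S = 2 * k"
  shows "(\<Sum>p\<in>pairs S. arcq k (gap S p)) \<le> 2 * real k"
proof -
  let ?N = "real (card (matchings S))"
  have "?N * (\<Sum>p\<in>pairs S. arcq k (gap S p)) = (\<Sum>M\<in>matchings S. \<Sum>A\<in>M. 1)"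
    using sum_matchings_arcs[OF S, of "\<lambda>_. 1"] by simp
  also have "\<dots> \<le> (\<Sum>M\<in>matchings S. 2 * real k)"
  proof (rule sum_mono)
    fix M assume M: "M \<in> matchings S"
    have "card M \<le> card S"
    proof (rule card_inj_on_le[of fst])
      show "inj_on fst M"
      proof (rule inj_onI)
        fix A A' assume "A \<in> M" "A' \<in> M" "fst A = fst A'"
        then show "A = A'" using matching_unique[of S M A A' "fst A"] M by simp
      qed
      show "fst ` M \<subseteq> S"
        using matching_arcD(2)[of S M] M by (intro image_subsetI) simp
    qed (fact S(1))
    then show "(\<Sum>A\<in>M. 1) \<le> 2 * real k" using S(2) by simp
  qed
  finally have "?N * (\<Sum>p\<in>pairs S. arcq k (gap S p)) \<le> ?N * (2 * real k)" by simp
  then show ?thesis using matchings_nonempty[OF S] by (simp only: mult_le_cancel_left_pos)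
qed

text \<open>Every arc spanning at least half of the points leaves the upper half.\<close>
lemma sum_arcq_long:
  assumes S: "finite S" "card S = 2 * k"
  shows "(\<Sum>p\<in>pairs S. arcq k (gap S p) * of_bool (k < gap S p)) \<le> leaving k"
proof (cases "k = 0")
  case True
  then have "S = {}" using S by simp
  then show ?thesis by (simp add: pairs_def leaving_def sum_nonneg True)
next
  case False
  let ?N = "real (card (matchings S))"
  let ?r = "\<lambda>z. card (S \<inter> {..<z})"
  \<comment> \<open>The point \<open>l\<close> of rank \<open>k - 1\<close> is the last one of the
    lower half, so exactly \<open>k\<close> points lie above it.\<close>
  have "k - 1 \<in> ?r ` S"
    using bij_betw_rank[OF S(1)] False S(2) by (auto simp: bij_betw_def)
  then obtain l where l: "l \<in> S" "?r l = k - 1" by auto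
  define h where "h = Suc (Max S)"
  define W where "W = S \<inter> {l<..<h}"
  have Sh: "z < h" if "z \<in> S" for z using that S(1) by (simp add: h_def less_Suc_eq_le)
  have Weq: "W = S - insert l (S \<inter> {..<l})"
    using Sh l by (auto simp: W_def)
  have "card W = card S - card (insert l (S \<inter> {..<l}))"
    unfolding Weq using S(1) l by (intro card_Diff_subset) auto
  also have "\<dots> = k" using S l False by (subst card_insert_disjoint) auto
  finally have cW: "card W = k" .
  have rSuc: "?r (Suc l) = k"
    using l False S(1) by (simp add: lessThan_Suc Int_insert_right)
  have mono: "?r x \<le> ?r y" if "x \<le> y" for x y
    using that S(1) by (intro card_mono) auto
  have "?N * (\<Sum>p\<in>pairs S. arcq k (gap S p) * of_bool (k < gap S p)) =
      (\<Sum>M\<in>matchings S. \<Sum>A\<in>M. of_bool (k < gap S A))"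
    by (rule sum_matchings_arcs[OF S, symmetric])
  also have "\<dots> \<le> (\<Sum>M\<in>matchings S. real (card {A \<in> M. (fst A \<in> W) \<noteq> (snd A \<in> W)}))"
  proof (rule sum_mono)
    fix M assume M: "M \<in> matchings S"
    have finM: "finite M" using finite_matching S(1) M by blast
    have "(\<Sum>A\<in>M. of_bool (k < gap S A)) = real (card {A \<in> M. k < gap S A})"
      by (rule sum_of_bool_card[OF finM])
    also have "\<dots> \<le> real (card {A \<in> M. (fst A \<in> W) \<noteq> (snd A \<in> W)})"
    proof (intro of_nat_mono card_mono subsetI)
      fix A assume A: "A \<in> {A \<in> M. k < gap S A}"
      then have p: "A \<in> pairs S" using M matching_subset_pairs by blast
      then have p': "fst A \<in> S" "snd A \<in> S" by (auto simp: pairs_def)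
      have "?r (snd A) < 2 * k"
        using p' S psubset_card_mono[of S "S \<inter> {..<snd A}"] by auto
      then have "?r (fst A) < k - 1 + 1" "?r (snd A) > k"
        using rank_gap[OF S(1) p] A False by auto
      then have "\<not> Suc l \<le> fst A" "\<not> snd A \<le> l"
        using mono[of "Suc l" "fst A"] mono[of "snd A" l] rSuc l False by auto
      then have "fst A \<le> l" "l < snd A" by auto
      then show "A \<in> {A \<in> M. (fst A \<in> W) \<noteq> (snd A \<in> W)}"
        using A p' Sh by (auto simp: W_def)
    qed (use finM in auto)
    finally show "(\<Sum>A\<in>M. of_bool (k < gap S A)) \<le> real (card {A \<in> M. (fst A \<in> W) \<noteq> (snd A \<in> W)})" .
  qed
  also have "\<dots> \<le> ?N * leaving k"
    using sum_leaving_window[OF S, of l h] cW unfolding W_def by simp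
  finally show ?thesis using matchings_nonempty[OF S] by (simp only: mult_le_cancel_left_pos)
qed

section \<open>Double counting over pairs of equal rank distance\<close>

lemma inj_on_fst_gap:
  assumes S: "finite S"
  shows "inj_on fst {p \<in> pairs S. gap S p = d}"
proof (rule inj_onI)
  fix p p' assume p: "p \<in> {p \<in> pairs S. gap S p = d}" "p' \<in> {p \<in> pairs S. gap S p = d}" "fst p = fst p'"
  then have "card (S \<inter> {..<snd p}) = card (S \<inter> {..<snd p'})"
    using rank_gap[OF S, of p] rank_gap[OF S, of p'] by simp
  moreover have "snd p \<in> S" "snd p' \<in> S" using p by (auto simp: pairs_def)
  ultimately have "snd p = snd p'" using inj_onD[OF inj_on_rank[OF S]] by blast
  then show "p = p'" using p(3) by (simp add: prod_eq_iff)
qed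

lemma card_pairs_gap: "finite S \<Longrightarrow> card {p \<in> pairs S. gap S p = d} \<le> card S"
  by (rule card_inj_on_le[OF inj_on_fst_gap]) (auto simp: pairs_def)

text \<open>A point \<open>b\<close> lies under at most \<open>d\<close> pairs of rank distance
  \<open>d\<close>: their left ends have distinct ranks, all among the last \<open>d\<close> ranks
  before \<open>b\<close>.\<close>

lemma sum_between_gap:
  assumes S: "finite S" and B: "finite B" "S \<inter> B = {}"
  shows "(\<Sum>p\<in>{p \<in> pairs S. gap S p = d}. card (B \<inter> {fst p<..<snd p})) \<le> card B * d"
proof -
  let ?P = "{p \<in> pairs S. gap S p = d}"
  let ?r = "\<lambda>z. card (S \<inter> {..<z})"
  have finP: "finite ?P" using finite_pairs[OF S] by simp
  have "(\<Sum>p\<in>?P. card (B \<inter> {fst p<..<snd p})) = (\<Sum>p\<in>?P. \<Sum>b\<in>B. of_bool (b \<in> {fst p<..<snd p}))"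
    by (intro sum.cong refl) (simp only: sum_of_bool_card[OF B(1)] of_nat_id Int_def Collect_mem_eq mem_Collect_eq)
  also have "\<dots> = (\<Sum>b\<in>B. \<Sum>p\<in>?P. of_bool (b \<in> {fst p<..<snd p}))"
    by (rule sum.swap)
  also have "\<dots> = (\<Sum>b\<in>B. card {p \<in> ?P. b \<in> {fst p<..<snd p}})"
    by (simp only: sum_of_bool_card[OF finP] of_nat_id)
  also have "\<dots> \<le> (\<Sum>b\<in>B. d)"
  proof (rule sum_mono)
    fix b assume "b \<in> B"
    have "card {p \<in> ?P. b \<in> {fst p<..<snd p}} \<le> card {?r b - d..<?r b}"
    proof (rule card_inj_on_le[of "\<lambda>p. ?r (fst p)"])
      have "inj_on fst ?P" by (rule inj_on_fst_gap[OF S])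
      moreover have "inj_on ?r (fst ` ?P)"
        by (rule inj_on_subset[OF inj_on_rank[OF S]]) (auto simp: pairs_def)
      ultimately have "inj_on (?r \<circ> fst) ?P" by (rule comp_inj_on)
      then have "inj_on (\<lambda>p. ?r (fst p)) ?P" by (simp only: comp_def)
      then show "inj_on (\<lambda>p. ?r (fst p)) {p \<in> ?P. b \<in> {fst p<..<snd p}}"
        by (rule inj_on_subset) auto
      show "(\<lambda>p. ?r (fst p)) ` {p \<in> ?P. b \<in> {fst p<..<snd p}} \<subseteq> {?r b - d..<?r b}"
      proof (intro image_subsetI)
        fix p assume p: "p \<in> {p \<in> ?P. b \<in> {fst p<..<snd p}}"
        then have "fst p \<in> S" "fst p < b" "b < snd p" "gap S p = d" by (auto simp: pairs_def)
        have "?r (fst p) < ?r b"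
          using S \<open>fst p \<in> S\<close> \<open>fst p < b\<close> by (intro psubset_card_mono) auto
        moreover have "?r b \<le> ?r (snd p)" using S \<open>b < snd p\<close> by (intro card_mono) auto
        ultimately show "?r (fst p) \<in> {?r b - d..<?r b}"
          using rank_gap[OF S, of p] p \<open>gap S p = d\<close> by auto
      qed
    qed simp
    then show "card {p \<in> ?P. b \<in> {fst p<..<snd p}} \<le> d" by simp
  qed
  finally show ?thesis by simp
qed

text \<open>Cauchy-Schwarz replaces the numbers of blue points under the individual pairs by their
  average, which the double count controls. The bound then depends on the colouring only through the
  sizes of its classes.\<close>

lemma sum_sqrt_between_gap:
  assumes "finite S" "finite B" "S \<inter> B = {}"
  shows "(\<Sum>p\<in>{p \<in> pairs S. gap S p = d}. sqrt (card (B \<inter> {fst p<..<snd p}))) \<le> sqrt (real (card S) * (real (card B) * real d))"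
proof (rule real_le_rsqrt)
  let ?P = "{p \<in> pairs S. gap S p = d}"
  have "(\<Sum>p\<in>?P. sqrt (card (B \<inter> {fst p<..<snd p})))\<^sup>2 \<le> (\<Sum>p\<in>?P. (sqrt (card (B \<inter> {fst p<..<snd p})))\<^sup>2) * card ?P"
    by (rule sum_squared_le_sum_of_squares)
  also have "\<dots> = real (\<Sum>p\<in>?P. card (B \<inter> {fst p<..<snd p})) * real (card ?P)" by simp
  also have "\<dots> \<le> real (card B * d) * real (card S)"
    using sum_between_gap[OF assms, of d] card_pairs_gap[OF assms(1), of d]
    by (intro mult_mono of_nat_mono) auto
  finally show "(\<Sum>p\<in>?P. sqrt (card (B \<inter> {fst p<..<snd p})))\<^sup>2 \<le> real (card S) * (real (card B) * real d)"
    by (simp add: mult_ac)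
qed

text \<open>From index x to x + 1 a Catalan number grows by 4 / (1 + 3 / (2 x + 1)). The correction
  is largest at x = r, and 1 + z \<le> exp z turns the product of corrections into one
  exponential.\<close>

lemma catalan_ratio_exp: "catalan r * 4 ^ j \<le> catalan (r + j) * exp (3 * real j / (2 * real r + 1))"
proof (induction j)
  case (Suc j)
  define x where "x = real (r + j)"
  have x: "x \<ge> real r" "x \<ge> 0" by (auto simp: x_def)
  have "4 * catalan (r + j) = catalan (r + Suc j) * (1 + 3 / (2 * x + 1))"
  proof -
    have "catalan (r + Suc j) = catalan (r + j) * (4 * x + 2) / (x + 2)"
      by (simp add: catalan_Suc x_def)
    then show ?thesis using x(2) by (simp add: divide_simps) (simp add: algebra_simps)
  qed
  also have "\<dots> \<le> catalan (r + Suc j) * exp (3 / (2 * real r + 1))"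
  proof (intro mult_left_mono)
    have "3 / (2 * x + 1) \<le> 3 / (2 * real r + 1)" using x by (intro divide_left_mono) auto
    then show "1 + 3 / (2 * x + 1) \<le> exp (3 / (2 * real r + 1))"
      using exp_ge_add_one_self[of "3 / (2 * real r + 1)"] by linarith
  qed (simp add: less_imp_le)
  finally have s: "4 * catalan (r + j) \<le> catalan (r + Suc j) * exp (3 / (2 * real r + 1))" .
  have "catalan r * 4 ^ Suc j = 4 * (catalan r * 4 ^ j)" by simp
  also have "\<dots> \<le> 4 * (catalan (r + j) * exp (3 * real j / (2 * real r + 1)))"
    using Suc by simp
  also have "\<dots> = (4 * catalan (r + j)) * exp (3 * real j / (2 * real r + 1))" by simp
  also have "\<dots> \<le> catalan (r + Suc j) * exp (3 / (2 * real r + 1)) * exp (3 * real j / (2 * real r + 1))"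
    by (intro mult_right_mono s) auto
  also have "\<dots> = catalan (r + Suc j) * exp (3 * real (Suc j) / (2 * real r + 1))"
    by (simp add: exp_add[symmetric] add_divide_distrib algebra_simps)
  finally show ?case .
qed simp

text \<open>For arcs up to half the points, \<open>k \<le> 2 * r + 1\<close>, so the exponent in
  \<open>catalan_ratio_exp\<close> is at most z = 3 (i + 1) / k, and z \<le> 3. There exp z \<le> 1
  + 27 z, with 27 = 3^3 above exp 3, and 81 = 3 * 27. The relative error is proportional to (i + 1)
  / k, so against the weight 1 / (i + 1) it adds only O(1) over all \<open>i\<close>.\<close>

lemma arcq_short:
  assumes "Suc (2 * i) \<le> k"
  shows "arcq k (Suc (2 * i)) \<le> cbin i / (4 * (real i + 1)) * (1 + 81 * (real i + 1) / real k)"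
proof -
  define r where "r = k - 1 - i"
  define z where "z = 3 * (real i + 1) / real k"
  have k: "k > 0" "k = r + Suc i" using assms by (auto simp: r_def)
  have z: "0 \<le> z" "z \<le> 3" using assms k(1) by (auto simp: z_def divide_simps)
  have kr: "real k \<le> 2 * real r + 1" using assms k by linarith
  have "exp (3 * real (Suc i) / (2 * real r + 1)) \<le> exp z"
    using kr k(1) unfolding exp_le_cancel_iff z_def by (intro frac_le) auto
  also have "exp z \<le> 1 + 27 * z"
  proof -
    have "(1 - z) * exp z \<le> exp (- z) * exp z"
      using exp_ge_add_one_self[of "- z"] by (intro mult_right_mono) auto
    then have "exp z \<le> 1 + z * exp z" by (simp add: algebra_simps flip: exp_add)
    also have "z * exp z \<le> z * 27"
    proof (intro mult_left_mono z(1))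
      have "exp z \<le> exp 3" using z by simp
      also have "exp 3 = exp (1 :: real) ^ 3" by (simp flip: exp_of_nat_mult)
      also have "\<dots> \<le> 3 ^ 3" by (intro power_mono exp_le) auto
      finally show "exp z \<le> 27" by simp
    qed
    finally show ?thesis by (simp add: mult.commute)
  qed
  finally have e: "exp (3 * real (Suc i) / (2 * real r + 1)) \<le> 1 + 81 * (real i + 1) / real k"
    by (simp add: z_def)
  have "catalan r * 4 ^ Suc i \<le> catalan k * exp (3 * real (Suc i) / (2 * real r + 1))"
    using catalan_ratio_exp[of r "Suc i"] by (simp only: k(2)[symmetric])
  also have "\<dots> \<le> catalan k * (1 + 81 * (real i + 1) / real k)"
    by (intro mult_left_mono e) (simp add: less_imp_le)
  finally have c: "catalan r / catalan k \<le> (1 + 81 * (real i + 1) / real k) / 4 ^ Suc i"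
    by (simp add: pos_divide_le_eq pos_le_divide_eq divide_simps mult_ac del: power_Suc)
  have "arcq k (Suc (2 * i)) = catalan i * (catalan r / catalan k)"
    by (simp add: arcq_def r_def)
  also have "\<dots> \<le> catalan i * ((1 + 81 * (real i + 1) / real k) / 4 ^ Suc i)"
    by (intro mult_left_mono c) (simp add: less_imp_le)
  also have "\<dots> = cbin i / (4 * (real i + 1)) * (1 + 81 * (real i + 1) / real k)"
    by (simp add: catalan_cbin add.commute)
  finally show ?thesis .
qed

section \<open>Summation over the rank distances\<close>

lemma harm_le_ln: "k > 0 \<Longrightarrow> (\<Sum>i<k. 1 / (real i + 1)) \<le> ln (real k) + 1"
proof (induction k rule: nat_induct_non_zero)
  case (Suc k)
  have "ln (real k / (real k + 1)) \<le> real k / (real k + 1) - 1"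
    using Suc by (intro ln_le_minus_one) auto
  also have "\<dots> = - (1 / (real k + 1))" by (simp add: field_simps)
  finally have "1 / (real k + 1) \<le> ln (real k + 1) - ln (real k)"
    using Suc by (simp add: ln_div)
  then show ?case using Suc by (simp add: add.commute)
qed simp

lemma sum_inverse_squares_le: "(\<Sum>i<k. 1 / (real i + 1)^2) \<le> 2"
proof (cases "k = 0")
  case False
  then have "k > 0" by simp
  then have "(\<Sum>i<k. 1 / (real i + 1)^2) \<le> 2 - 1 / real k"
  proof (induction k rule: nat_induct_non_zero)
    case (Suc k)
    have "1 / (real k + 1)^2 \<le> 1 / (real k * (real k + 1))"
      using Suc by (intro divide_left_mono) (auto simp: power2_eq_square)
    also have "\<dots> = 1 / real k - 1 / (real k + 1)"
      using Suc by (simp add: field_simps)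
    finally show ?case using Suc by (simp add: add.commute)
  qed simp
  also have "\<dots> \<le> 2" by simp
  finally show ?thesis .
qed simp

lemma sum_odd_index_le:
  fixes f g :: "nat \<Rightarrow> real"
  assumes even: "\<And>d. even d \<Longrightarrow> f d = 0"
    and le: "\<And>i. Suc (2 * i) \<le> k \<Longrightarrow> f (Suc (2 * i)) \<le> g i"
    and nonneg: "\<And>i. g i \<ge> 0"
  shows "(\<Sum>d\<le>k. f d) \<le> (\<Sum>i<k. g i)"
proof -
  have eq: "{d \<in> {..k}. odd d} = (\<lambda>i. Suc (2 * i)) ` {i. Suc (2 * i) \<le> k}"
    by (auto elim!: oddE)
  have sub: "{i. Suc (2 * i) \<le> k} \<subseteq> {..<k}" by auto
  have "(\<Sum>d\<le>k. f d) = (\<Sum>d\<in>{d \<in> {..k}. odd d}. f d)"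
    by (rule sum.mono_neutral_right) (auto simp: even)
  also have "\<dots> = (\<Sum>i\<in>{i. Suc (2 * i) \<le> k}. f (Suc (2 * i)))"
    unfolding eq by (subst sum.reindex) (auto intro: inj_onI)
  also have "\<dots> \<le> (\<Sum>i\<in>{i. Suc (2 * i) \<le> k}. g i)"
    by (rule sum_mono) (use le in auto)
  also have "\<dots> \<le> (\<Sum>i<k. g i)"
    by (rule sum_mono2) (use sub nonneg in auto)
  finally show ?thesis .
qed

text \<open>The factor sqrt d cancels the decay of \<open>cbin\<close>, leaving a harmonic sum. The
  constant 165 is 1 from that sum, 2 from the inverse squares and 162 from \<open>k\<close> terms of
  size 162 / k.\<close>

lemma sum_arcq_sqrt_le:
  assumes "k > 0"
  shows "(\<Sum>d\<le>k. arcq k d * sqrt (real d)) \<le> sqrt (2 / pi) / 4 * (ln (real k) + 165)"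
proof -
  define g where "g i = sqrt (2 / pi) / 4 * (1 / (real i + 1) + 1 / (real i + 1)^2 + 162 / real k)" for i :: nat
  have "(\<Sum>d\<le>k. arcq k d * sqrt (real d)) \<le> (\<Sum>i<k. g i)"
  proof (rule sum_odd_index_le)
    fix i assume i: "Suc (2 * i) \<le> k"
    have "arcq k (Suc (2 * i)) * sqrt (real (Suc (2 * i))) \<le>
        (cbin i / (4 * (real i + 1)) * (1 + 81 * (real i + 1) / real k)) * sqrt (2 * real i + 1)"
      unfolding of_nat_Suc of_nat_mult of_nat_numeral add.commute[of 1 "2 * real i"]
      by (intro mult_right_mono arcq_short[OF i]) auto
    also have "\<dots> = (cbin i * sqrt (2 * real i + 1)) * ((1 + 81 * (real i + 1) / real k) / (4 * (real i + 1)))"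
      by simp
    also have "\<dots> \<le> (sqrt (2 / pi) * (1 + 1 / (real i + 1))) * ((1 + 81 * (real i + 1) / real k) / (4 * (real i + 1)))"
      by (intro mult_right_mono cbin_sqrt_upper) auto
    also have "\<dots> = sqrt (2 / pi) / 4 * ((1 + 1 / (real i + 1)) * ((1 + 81 * (real i + 1) / real k) / (real i + 1)))"
      by simp
    also have "(1 + 1 / (real i + 1)) * ((1 + 81 * (real i + 1) / real k) / (real i + 1)) =
       1 / (real i + 1) + 1 / (real i + 1)^2 + 81 / real k * (1 + 1 / (real i + 1))"
      using assms by (simp add: divide_simps power2_eq_square) (simp add: algebra_simps)
    also have "81 / real k * (1 + 1 / (real i + 1)) \<le> 81 / real k * 2"
      by (intro mult_left_mono) auto
    finally show "arcq k (Suc (2 * i)) * sqrt (real (Suc (2 * i))) \<le> g i"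
      by (simp add: g_def mult_left_mono)
  qed (auto simp: arcq_def g_def)
  also have "\<dots> = sqrt (2 / pi) / 4 * ((\<Sum>i<k. 1 / (real i + 1)) + (\<Sum>i<k. 1 / (real i + 1)^2) + 162)"
    unfolding g_def sum_distrib_left[symmetric] sum.distrib using assms by simp
  also have "\<dots> \<le> sqrt (2 / pi) / 4 * (ln (real k) + 165)"
    using harm_le_ln[OF assms] sum_inverse_squares_le[of k] by (intro mult_left_mono) auto
  finally show ?thesis .
qed

text \<open>Arcs of rank distance at most \<open>k\<close> carry the main term. Beyond
  \<open>k\<close>, \<open>arcq\<close> is symmetric under d -> 2 k - d and rises again, so the
  bounds for short arcs fail. But on average there are only O(sqrt n) such arcs, and each window is
  left by O(sqrt n) blue arcs, which gives 9 n. The linear terms 2 n, 165 n / pi and 9 n fit into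
  100 n.\<close>

lemma sum_arcq_leaving:
  assumes S: "finite S" "card S = 2 * k" and B: "finite B" "card B = 2 * q" "S \<inter> B = {}"
    and n: "n = k + q" "n > 0"
  shows "(\<Sum>p\<in>pairs S. arcq k (gap S p) * leaving (card (B \<inter> {fst p<..<snd p}))) \<le>
    real n * ln (real n) / pi + 100 * real n"
proof (cases "k = 0")
  case True
  then have "S = {}" using S by simp
  moreover have "0 \<le> real n * ln (real n)" using n(2) by simp
  ultimately show ?thesis by (simp add: pairs_def)
next
  case False
  define s where "s = sqrt (8 / pi)"
  have s: "0 \<le> s" "s \<le> 2"
    using pi_gt3 by (auto simp: s_def divide_simps intro!: real_le_lsqrt)
  define m where "m p = real (card (B \<inter> {fst p<..<snd p}))" for p
  have finP: "finite (pairs S)" using finite_pairs S by blast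
  have m_le: "m p \<le> 2 * real q" for p
    unfolding m_def using card_mono[OF B(1), of "B \<inter> {fst p<..<snd p}"] B(2) by simp
  have "(\<Sum>p\<in>pairs S. arcq k (gap S p) * leaving (card (B \<inter> {fst p<..<snd p}))) \<le>
      (\<Sum>p\<in>pairs S. arcq k (gap S p) + s * (arcq k (gap S p) * of_bool (gap S p \<le> k) * sqrt (m p)) +
         s * sqrt (2 * real q) * (arcq k (gap S p) * of_bool (k < gap S p)))"
  proof (rule sum_mono)
    fix p
    have "arcq k (gap S p) * leaving (card (B \<inter> {fst p<..<snd p})) \<le> arcq k (gap S p) * (1 + s * sqrt (m p))"
      unfolding s_def m_def by (intro mult_left_mono leaving_upper) auto
    also have "\<dots> \<le> arcq k (gap S p) + s * (arcq k (gap S p) * of_bool (gap S p \<le> k) * sqrt (m p)) +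
         s * sqrt (2 * real q) * (arcq k (gap S p) * of_bool (k < gap S p))"
    proof (cases "gap S p \<le> k")
      case False
      have "s * arcq k (gap S p) * sqrt (m p) \<le> s * arcq k (gap S p) * sqrt (2 * real q)"
        using s m_le by (intro mult_left_mono real_sqrt_le_mono) auto
      then show ?thesis using False by (simp add: algebra_simps)
    qed (simp add: algebra_simps)
    finally show "arcq k (gap S p) * leaving (card (B \<inter> {fst p<..<snd p})) \<le> \<dots>" .
  qed
  also have "\<dots> = (\<Sum>p\<in>pairs S. arcq k (gap S p)) +
      s * (\<Sum>p\<in>pairs S. arcq k (gap S p) * of_bool (gap S p \<le> k) * sqrt (m p)) +
      s * sqrt (2 * real q) * (\<Sum>p\<in>pairs S. arcq k (gap S p) * of_bool (k < gap S p))"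
    by (simp only: sum.distrib sum_distrib_left)
  also have "\<dots> \<le> 2 * real n + real n / pi * (ln (real n) + 165) + 9 * real n"
  proof (intro add_mono)
    show "(\<Sum>p\<in>pairs S. arcq k (gap S p)) \<le> 2 * real n"
      using sum_arcq_all[OF S] n by simp
    have "(\<Sum>p\<in>pairs S. arcq k (gap S p) * of_bool (gap S p \<le> k) * sqrt (m p)) =
        (\<Sum>p\<in>{p \<in> pairs S. gap S p \<le> k}. arcq k (gap S p) * sqrt (m p))"
      using finP by (intro sum.mono_neutral_cong_right) auto
    also have "\<dots> = (\<Sum>d\<le>k. \<Sum>p\<in>{p \<in> {p \<in> pairs S. gap S p \<le> k}. gap S p = d}. arcq k (gap S p) * sqrt (m p))"
      using finP by (intro sum.group[symmetric]) auto
    also have "\<dots> = (\<Sum>d\<le>k. arcq k d * (\<Sum>p\<in>{p \<in> pairs S. gap S p = d}. sqrt (m p)))"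
      unfolding sum_distrib_left by (intro sum.cong refl) auto
    also have "\<dots> \<le> (\<Sum>d\<le>k. arcq k d * (2 * sqrt (real k * real q) * sqrt (real d)))"
    proof (intro sum_mono mult_left_mono)
      fix d
      have "(\<Sum>p\<in>{p \<in> pairs S. gap S p = d}. sqrt (m p)) \<le> sqrt (real (card S) * (real (card B) * real d))"
        unfolding m_def by (rule sum_sqrt_between_gap[OF S(1) B(1) B(3)])
      also have "\<dots> = sqrt (2 ^ 2 * (real k * real q) * real d)" by (simp add: S(2) B(2) mult_ac)
      also have "\<dots> = 2 * sqrt (real k * real q) * sqrt (real d)"
        by (simp add: real_sqrt_mult)
      finally show "(\<Sum>p\<in>{p \<in> pairs S. gap S p = d}. sqrt (m p)) \<le> 2 * sqrt (real k * real q) * sqrt (real d)" .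
    qed auto
    also have "\<dots> = 2 * sqrt (real k * real q) * (\<Sum>d\<le>k. arcq k d * sqrt (real d))"
      by (simp add: sum_distrib_left mult_ac)
    also have "\<dots> \<le> real n * (sqrt (2 / pi) / 4 * (ln (real n) + 165))"
    proof (intro mult_mono)
      have "real k * real q \<le> (real n / 2)^2"
        using zero_le_power2[of "real k - real q"] by (simp add: n power2_eq_square field_simps)
      then have "sqrt (real k * real q) \<le> real n / 2" by (intro real_le_lsqrt) auto
      then show "2 * sqrt (real k * real q) \<le> real n" by simp
      have "(\<Sum>d\<le>k. arcq k d * sqrt (real d)) \<le> sqrt (2 / pi) / 4 * (ln (real k) + 165)"
        using sum_arcq_sqrt_le False by simp
      also have "\<dots> \<le> sqrt (2 / pi) / 4 * (ln (real n) + 165)"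
        using False n by (intro mult_left_mono add_mono) auto
      finally show "(\<Sum>d\<le>k. arcq k d * sqrt (real d)) \<le> sqrt (2 / pi) / 4 * (ln (real n) + 165)" .
    qed (auto intro!: sum_nonneg)
    finally have "s * (\<Sum>p\<in>pairs S. arcq k (gap S p) * of_bool (gap S p \<le> k) * sqrt (m p)) \<le>
        s * (real n * (sqrt (2 / pi) / 4 * (ln (real n) + 165)))"
      using s by (intro mult_left_mono) auto
    \<comment> \<open>The leading constant: sqrt (8 / pi) from the windows times sqrt (2 / pi) from
      the arc probabilities is 4 / pi, and the factor 1 / 4 of \<open>arcp_odd\<close> leaves 1 /
      pi.\<close>
    also have "\<dots> = (s * sqrt (2 / pi)) * (real n / 4 * (ln (real n) + 165))" by simp
    also have "s * sqrt (2 / pi) = 4 / pi"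
      unfolding s_def real_sqrt_mult[symmetric] by (rule real_sqrt_unique) (auto simp: power2_eq_square)
    finally show "s * (\<Sum>p\<in>pairs S. arcq k (gap S p) * of_bool (gap S p \<le> k) * sqrt (m p)) \<le>
        real n / pi * (ln (real n) + 165)" by simp
    have n1: "1 \<le> sqrt (real n)" using n(2) by simp
    have "s * sqrt (2 * real q) * (\<Sum>p\<in>pairs S. arcq k (gap S p) * of_bool (k < gap S p)) \<le>
       (3 * sqrt (real n)) * (3 * sqrt (real n))"
    proof (rule mult_mono)
      have "s * sqrt (2 * real q) \<le> 2 * sqrt (2 * real n)"
        using s n by (intro mult_mono) auto
      also have "\<dots> = 2 * sqrt 2 * sqrt (real n)" by (simp add: real_sqrt_mult)
      also have "\<dots> \<le> 3 * sqrt (real n)"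
        using real_le_lsqrt[of "3 / 2" 2] by (intro mult_right_mono) (auto simp: power2_eq_square)
      finally show "s * sqrt (2 * real q) \<le> 3 * sqrt (real n)" .
      have "(\<Sum>p\<in>pairs S. arcq k (gap S p) * of_bool (k < gap S p)) \<le> 1 + s * sqrt (real k)"
        using sum_arcq_long[OF S] leaving_upper[of k] by (simp add: s_def)
      also have "\<dots> \<le> sqrt (real n) + 2 * sqrt (real n)"
        using n1 s n by (intro add_mono mult_mono) auto
      finally show "(\<Sum>p\<in>pairs S. arcq k (gap S p) * of_bool (k < gap S p)) \<le> 3 * sqrt (real n)" by simp
    qed (auto intro!: sum_nonneg)
    also have "\<dots> = 9 * real n" by simp
    finally show "s * sqrt (2 * real q) * (\<Sum>p\<in>pairs S. arcq k (gap S p) * of_bool (k < gap S p)) \<le> 9 * real n" .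
  qed
  also have "\<dots> \<le> real n * ln (real n) / pi + 100 * real n"
  proof -
    have "real n * 165 / pi \<le> real n * 165 / 3"
      using pi_gt3 by (intro divide_left_mono) auto
    then show ?thesis by (simp add: distrib_left)
  qed
  finally show ?thesis .
qed

text \<open>Arcs of one colour never cross, so each edge is a red-blue pair, and \<open>?h\<close>
  puts it into the order by left endpoint in which \<open>CP_edges\<close> counts it. A blue arc
  crosses a red one exactly when it leaves the window of blue points under it, which is the form
  that \<open>sum_leaving_window\<close> treats.\<close>

lemma CP_edges_union:
  assumes R: "finite R" "catalan_matching R M" and B: "finite B" "catalan_matching B N" and disj: "R \<inter> B = {}"
  shows "CP_edges (M \<union> N) = (\<Sum>A\<in>M. card {C \<in> N. (fst C \<in> B \<inter> {fst A<..<snd A}) \<noteq> (snd C \<in> B \<inter> {fst A<..<snd A})})"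
proof -
  have fin: "finite M" "finite N" using finite_matching R B by auto
  have cross: "arcs_alternate A C \<or> arcs_alternate C A \<longleftrightarrow>
      (fst C \<in> B \<inter> {fst A<..<snd A}) \<noteq> (snd C \<in> B \<inter> {fst A<..<snd A})" if "A \<in> M" "C \<in> N" for A C
  proof -
    have "fst A < snd A" "fst A \<in> R" "snd A \<in> R" "fst C < snd C" "fst C \<in> B" "snd C \<in> B"
      using matching_arcD R B that by auto
    moreover then have "fst A \<noteq> fst C" "fst A \<noteq> snd C" "snd A \<noteq> fst C" "snd A \<noteq> snd C"
      using disj by (metis disjoint_iff)+
    ultimately show ?thesis by (auto simp: arcs_alternate_def)
  qed
  have disjMN: "M \<inter> N = {}"
    using matching_arcD(2)[OF R(2)] matching_arcD(2)[OF B(2)] disj by blast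
  have same: "\<not> arcs_alternate A C" if "A \<in> M \<and> C \<in> M \<or> A \<in> N \<and> C \<in> N" for A C
    using that matching_noncrossing[OF R(2), of A C] matching_noncrossing[OF B(2), of A C]
    by (auto simp: arcs_alternate_def)
  let ?E = "Sigma M (\<lambda>A. {C \<in> N. arcs_alternate A C \<or> arcs_alternate C A})"
  let ?h = "\<lambda>(A, C). if arcs_alternate A C then (A, C) else (C, A)"
  have "bij_betw ?h ?E {(A, C). A \<in> M \<union> N \<and> C \<in> M \<union> N \<and> arcs_alternate A C}"
  proof (rule bij_betw_imageI)
    show "inj_on ?h ?E"
      using disjMN by (auto intro!: inj_onI split: if_splits)
    show "?h ` ?E = {(A, C). A \<in> M \<union> N \<and> C \<in> M \<union> N \<and> arcs_alternate A C}"
    proof (intro equalityI subsetI)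
      fix x assume "x \<in> ?h ` ?E"
      then show "x \<in> {(A, C). A \<in> M \<union> N \<and> C \<in> M \<union> N \<and> arcs_alternate A C}"
        by (auto split: if_splits)
    next
      fix x assume "x \<in> {(A, C). A \<in> M \<union> N \<and> C \<in> M \<union> N \<and> arcs_alternate A C}"
      then obtain A C where x: "x = (A, C)" "A \<in> M \<union> N" "C \<in> M \<union> N" "arcs_alternate A C" by blast
      have "\<not> arcs_alternate C A" using x(4) by (auto simp: arcs_alternate_def)
      from x same[of A C] consider "A \<in> M" "C \<in> N" | "A \<in> N" "C \<in> M" by blast
      then show "x \<in> ?h ` ?E"
      proof cases
        case 1
        have "x = ?h (A, C)" using x by simp
        moreover have "(A, C) \<in> ?E" using 1 x by blast
        ultimately show ?thesis by (rule image_eqI)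
      next
        case 2
        have "x = ?h (C, A)" using x \<open>\<not> arcs_alternate C A\<close> by simp
        moreover have "(C, A) \<in> ?E" using 2 x by blast
        ultimately show ?thesis by (rule image_eqI)
      qed
    qed
  qed
  then have "CP_edges (M \<union> N) = card ?E"
    unfolding CP_edges_def by (rule bij_betw_same_card[symmetric])
  also have "\<dots> = (\<Sum>A\<in>M. card {C \<in> N. arcs_alternate A C \<or> arcs_alternate C A})"
    using fin by (intro card_SigmaI) auto
  also have "\<dots> = (\<Sum>A\<in>M. card {C \<in> N. (fst C \<in> B \<inter> {fst A<..<snd A}) \<noteq> (snd C \<in> B \<inter> {fst A<..<snd A})})"
    by (intro sum.cong refl arg_cong[of _ _ card] Collect_cong conj_cong cross)
  finally show ?thesis .
qed

text \<open>The two matchings are independent: for a fixed red arc the blue matching is averaged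
  first, which leaves a function of the red arc alone.\<close>

lemma sum_edges_upper:
  assumes R: "finite R" "card R = 2 * k" and B: "finite B" "card B = 2 * q" "R \<inter> B = {}"
    and n: "n = k + q" "n > 0"
  shows "(\<Sum>M\<in>matchings R. \<Sum>N\<in>matchings B. real (CP_edges (M \<union> N))) \<le>
    real (card (matchings R)) * real (card (matchings B)) * (real n * ln (real n) / pi + 100 * real n)"
proof -
  let ?W = "\<lambda>A. B \<inter> {fst A<..<snd A}"
  let ?NB = "real (card (matchings B))" and ?NR = "real (card (matchings R))"
  have "(\<Sum>M\<in>matchings R. \<Sum>N\<in>matchings B. real (CP_edges (M \<union> N))) =
      (\<Sum>M\<in>matchings R. \<Sum>A\<in>M. \<Sum>N\<in>matchings B. real (card {C \<in> N. (fst C \<in> ?W A) \<noteq> (snd C \<in> ?W A)}))"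
  proof (rule sum.cong)
    fix M assume "M \<in> matchings R"
    then have "(\<Sum>N\<in>matchings B. real (CP_edges (M \<union> N))) =
        (\<Sum>N\<in>matchings B. \<Sum>A\<in>M. real (card {C \<in> N. (fst C \<in> ?W A) \<noteq> (snd C \<in> ?W A)}))"
      using CP_edges_union[OF R(1) _ B(1) _ B(3)] by (intro sum.cong refl) simp
    then show "(\<Sum>N\<in>matchings B. real (CP_edges (M \<union> N))) =
        (\<Sum>A\<in>M. \<Sum>N\<in>matchings B. real (card {C \<in> N. (fst C \<in> ?W A) \<noteq> (snd C \<in> ?W A)}))"
      by (simp only: sum.swap[of _ M])
  qed simp
  also have "\<dots> \<le> (\<Sum>M\<in>matchings R. \<Sum>A\<in>M. ?NB * leaving (card (?W A)))"
    by (intro sum_mono sum_leaving_window[OF B(1,2)])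
  also have "\<dots> = ?NR * (\<Sum>p\<in>pairs R. arcq k (gap R p) * (?NB * leaving (card (?W p))))"
    by (rule sum_matchings_arcs[OF R])
  also have "\<dots> = ?NR * ?NB * (\<Sum>p\<in>pairs R. arcq k (gap R p) * leaving (card (?W p)))"
    by (simp add: sum_distrib_left mult_ac)
  also have "\<dots> \<le> ?NR * ?NB * (real n * ln (real n) / pi + 100 * real n)"
    by (intro mult_left_mono sum_arcq_leaving[OF R B n]) auto
  finally show ?thesis .
qed

subsection \<open>Arcs read off from orientations\<close>

text \<open>A colour class \<open>S\<close> together with an orientation \<open>u\<close> (\<open>u z\<close>: the point \<open>z\<close> opens an arc) is a
  lattice path; \<open>climb S u x y\<close> is its increment over \<open>{x..<y}\<close>, and \<open>excursion S u a c\<close> says that the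
  step at \<open>c\<close> is the first return to the level before the up-step at \<open>a\<close>.\<close>
definition climb :: "nat set \<Rightarrow> (nat \<Rightarrow> bool) \<Rightarrow> nat \<Rightarrow> nat \<Rightarrow> int" where
  "climb S u x y = (\<Sum>z\<in>{x..<y}. if z \<in> S then if u z then 1 else - 1 else 0)"

definition excursion :: "nat set \<Rightarrow> (nat \<Rightarrow> bool) \<Rightarrow> nat \<Rightarrow> nat \<Rightarrow> bool" where
  "excursion S u a c \<longleftrightarrow>
     a < c \<and> (\<forall>x. a < x \<and> x \<le> c \<longrightarrow> climb S u a x \<ge> 1) \<and> climb S u a (Suc c) = 0"

lemma climb_split: "x \<le> y \<Longrightarrow> y \<le> z \<Longrightarrow> climb S u x z = climb S u x y + climb S u y z"
  unfolding climb_def by (simp add: sum.atLeastLessThan_concat)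

lemma climb_cong:
  assumes "\<And>z. x \<le> z \<Longrightarrow> z < y \<Longrightarrow> z \<in> S \<longleftrightarrow> z \<in> S'" "\<And>z. x \<le> z \<Longrightarrow> z < y \<Longrightarrow> z \<in> S \<Longrightarrow> u z = u' z"
  shows "climb S u x y = climb S' u' x y"
  unfolding climb_def by (rule sum.cong) (use assms in auto)

lemma excursion_cong:
  assumes "\<And>z. a \<le> z \<Longrightarrow> z \<le> c \<Longrightarrow> z \<in> S \<longleftrightarrow> z \<in> S'" "\<And>z. a \<le> z \<Longrightarrow> z \<le> c \<Longrightarrow> z \<in> S \<Longrightarrow> u z = u' z"
  shows "excursion S u a c \<longleftrightarrow> excursion S' u' a c"
proof -
  have "climb S u a x = climb S' u' a x" if "x \<le> Suc c" for x
    by (rule climb_cong) (use assms that in auto)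
  then show ?thesis unfolding excursion_def by auto
qed

lemma excursion_endpoints:
  assumes "excursion S u a c"
  shows "a \<in> S" "u a" "c \<in> S"
proof -
  have "climb S u a (Suc a) \<ge> 1" using assms by (simp add: excursion_def)
  then show "a \<in> S" "u a" by (auto simp: climb_def split: if_splits)
  have "climb S u a (Suc c) = climb S u a c + climb S u c (Suc c)" "climb S u a c \<ge> 1"
    using assms climb_split[of a c "Suc c" S u] by (auto simp: excursion_def)
  then show "c \<in> S" using assms by (auto simp: excursion_def climb_def split: if_splits)
qed

lemma excursion_unique:
  assumes "excursion S u a c" "excursion S u a c'"
  shows "c = c'"
proof (rule ccontr)
  have *: False if "excursion S u a c" "excursion S u a c'" "c < c'" for c c'
    using that unfolding excursion_def by (metis Suc_leI less_SucI not_one_le_zero)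
  assume "c \<noteq> c'"
  then consider "c < c'" | "c' < c" by linarith
  then show False using * assms by cases blast+
qed

lemma climb_matching:
  assumes S: "finite S" "catalan_matching S M" and u: "\<And>z. z \<in> S \<Longrightarrow> u z \<longleftrightarrow> z \<in> fst ` M"
  shows "climb S u x y = int (card {A \<in> M. fst A \<in> {x..<y}}) - int (card {A \<in> M. snd A \<in> {x..<y}})"
proof -
  have finM: "finite M" using finite_matching S by blast
  have step: "(if z \<in> S then if u z then 1 else - 1 else 0) =
      (\<Sum>A\<in>M. (of_bool (z = fst A) - of_bool (z = snd A) :: int))" for z
  proof -
    have *: "(\<Sum>A\<in>M. (of_bool (z = fst A) - of_bool (z = snd A) :: int)) =
        int (card {A \<in> M. z = fst A}) - int (card {A \<in> M. z = snd A})"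
      by (simp only: sum_subtractf sum_of_bool_card[OF finM])
    show ?thesis
    proof (cases "z \<in> S")
      case False
      then have "{A \<in> M. z = fst A} = {}" "{A \<in> M. z = snd A} = {}"
        using matching_arcD(2,3)[OF S(2)] by blast+
      then show ?thesis using False by (simp only: * card.empty) simp
    next
      case True
      then obtain A where A: "A \<in> M" "z = fst A \<or> z = snd A" using matching_covers[OF S(2)] by blast
      have uniq: "B = A" if "B \<in> M" "z = fst B \<or> z = snd B" for B
        using matching_unique[OF S(2) that(1) A(1) that(2) A(2)] .
      have lt: "fst A < snd A" using matching_arcD(1)[OF S(2) A(1)] .
      show ?thesis
      proof (cases "z = fst A")
        case zf: True
        have "{B \<in> M. z = fst B} = {A}" "{B \<in> M. z = snd B} = {}"
          using uniq A(1) zf lt by fastforce+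
        moreover have "u z" using u[OF True] A(1) zf by blast
        ultimately show ?thesis using True by (simp only: * card.empty) simp
      next
        case zf: False
        then have zs: "z = snd A" using A(2) by simp
        have e: "{B \<in> M. z = fst B} = {}" "{B \<in> M. z = snd B} = {A}"
          using uniq A(1) zf zs by fastforce+
        then have "z \<notin> fst ` M" by blast
        then have "\<not> u z" using u[OF True] by blast
        then show ?thesis using True by (simp only: * e card.empty) simp
      qed
    qed
  qed
  have "climb S u x y = (\<Sum>z\<in>{x..<y}. \<Sum>A\<in>M. (of_bool (z = fst A) - of_bool (z = snd A)))"
    unfolding climb_def by (intro sum.cong refl step)
  also have "\<dots> = (\<Sum>A\<in>M. \<Sum>z\<in>{x..<y}. (of_bool (z = fst A) - of_bool (z = snd A)))"
    by (rule sum.swap)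
  also have "\<dots> = (\<Sum>A\<in>M. of_bool (fst A \<in> {x..<y}) - of_bool (snd A \<in> {x..<y}))"
  proof (rule sum.cong)
    fix A
    have "(\<Sum>z\<in>{x..<y}. of_bool (z = w)) = (of_bool (w \<in> {x..<y}) :: int)" for w
      by (simp add: of_bool_def)
    then show "(\<Sum>z\<in>{x..<y}. (of_bool (z = fst A) - of_bool (z = snd A) :: int)) =
        of_bool (fst A \<in> {x..<y}) - of_bool (snd A \<in> {x..<y})"
      by (simp only: sum_subtractf)
  qed simp
  also have "\<dots> = int (card {A \<in> M. fst A \<in> {x..<y}}) - int (card {A \<in> M. snd A \<in> {x..<y}})"
    by (simp only: sum_subtractf sum_of_bool_card[OF finM])
  finally show ?thesis .
qed

text \<open>By nesting, every arc that closes in \<open>{a..<x}\<close> also opened there, while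
  \<open>(a, c)\<close> itself is still open: the climb is positive. Over the whole of
  \<open>{a..c}\<close> openings and closings cancel.\<close>

lemma matching_arc_excursion:
  assumes S: "finite S" "catalan_matching S M" and u: "\<And>z. z \<in> S \<Longrightarrow> u z \<longleftrightarrow> z \<in> fst ` M"
    and ac: "(a, c) \<in> M"
  shows "excursion S u a c"
proof -
  have finM: "finite M" using finite_matching S by blast
  have lt: "a < c" using matching_arcD(1)[OF S(2) ac] by simp
  have nest: "A = (a, c) \<or> (a < fst A \<and> snd A < c) \<or> (fst A \<notin> {a..c} \<and> snd A \<notin> {a..c})" if "A \<in> M" for A
    using matching_nested_or_outside[OF S(2) ac that] by blast
  have arc: "fst A < snd A" if "A \<in> M" for A using matching_arcD(1)[OF S(2) that] .
  have hm: "climb S u x y = int (card {A \<in> M. fst A \<in> {x..<y}}) - int (card {A \<in> M. snd A \<in> {x..<y}})" for x y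
    by (rule climb_matching[OF S]) (fact u)
  have "climb S u a x \<ge> 1" if x: "a < x" "x \<le> c" for x
  proof -
    have "{A \<in> M. snd A \<in> {a..<x}} \<subset> {A \<in> M. fst A \<in> {a..<x}}"
    proof (rule psubsetI)
      show "{A \<in> M. snd A \<in> {a..<x}} \<subseteq> {A \<in> M. fst A \<in> {a..<x}}"
      proof
        fix A assume A: "A \<in> {A \<in> M. snd A \<in> {a..<x}}"
        then show "A \<in> {A \<in> M. fst A \<in> {a..<x}}" using nest[of A] arc[of A] x by auto
      qed
      have "(a, c) \<in> {A \<in> M. fst A \<in> {a..<x}}" "(a, c) \<notin> {A \<in> M. snd A \<in> {a..<x}}"
        using ac x by auto
      then show "{A \<in> M. snd A \<in> {a..<x}} \<noteq> {A \<in> M. fst A \<in> {a..<x}}" by blast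
    qed
    then have "card {A \<in> M. snd A \<in> {a..<x}} < card {A \<in> M. fst A \<in> {a..<x}}"
      using finM by (intro psubset_card_mono) auto
    then show ?thesis unfolding hm by linarith
  qed
  moreover have "{A \<in> M. snd A \<in> {a..<Suc c}} = {A \<in> M. fst A \<in> {a..<Suc c}}"
  proof (rule Collect_cong)
    fix A show "(A \<in> M \<and> snd A \<in> {a..<Suc c}) = (A \<in> M \<and> fst A \<in> {a..<Suc c})"
      using nest[of A] arc[of A] lt by auto
  qed
  then have "climb S u a (Suc c) = 0" unfolding hm by (simp only: diff_self)
  ultimately show ?thesis using lt by (simp add: excursion_def)
qed

lemma excursion_matching_arc:
  assumes S: "finite S" "catalan_matching S M" and u: "\<And>z. z \<in> S \<Longrightarrow> u z \<longleftrightarrow> z \<in> fst ` M"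
    and e: "excursion S u a c"
  shows "(a, c) \<in> M"
proof -
  have "a \<in> fst ` M" using excursion_endpoints[OF e] u by blast
  then obtain c' where c': "(a, c') \<in> M" by auto
  then have "excursion S u a c'" by (rule matching_arc_excursion[OF S, rotated]) (fact u)
  then show ?thesis using excursion_unique[OF e] c' by blast
qed

text \<open>Injectivity of the Dyck path encoding: the arcs are the excursions of the path, and the
  path is determined by the openers. It turns counts of matchings into counts of
  orientations.\<close>

lemma matching_eq_of_openers:
  assumes S: "finite S" "catalan_matching S M" "catalan_matching S M'" and eq: "fst ` M = fst ` M'"
  shows "M = M'"
proof -
  have "A \<in> M \<longleftrightarrow> A \<in> M'" for A
  proof -
    have "A \<in> M \<longleftrightarrow> excursion S (\<lambda>z. z \<in> fst ` M) (fst A) (snd A)"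
      using matching_arc_excursion[OF S(1,2), of "\<lambda>z. z \<in> fst ` M" "fst A" "snd A"]
        excursion_matching_arc[OF S(1,2), of "\<lambda>z. z \<in> fst ` M" "fst A" "snd A"] by auto
    also have "\<dots> \<longleftrightarrow> A \<in> M'"
      using matching_arc_excursion[OF S(1,3), of "\<lambda>z. z \<in> fst ` M" "fst A" "snd A"]
        excursion_matching_arc[OF S(1,3), of "\<lambda>z. z \<in> fst ` M" "fst A" "snd A"] eq by auto
    finally show ?thesis .
  qed
  then show ?thesis by blast
qed

subsection \<open>Fair coins\<close>

text \<open>It serves both for the colours of \<open>2 * n - 1\<close> points and for the
  orientations of \<open>2 * n\<close> points. The uniform form is the one in \<open>CP_arcs\<close>
  and is convenient for counting; \<open>coins_Pi_pmf\<close> gives the product form, the source of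
  independence.\<close>

definition coins :: "nat set \<Rightarrow> (nat \<Rightarrow> bool) pmf" where
  "coins N = pmf_of_set (PiE N (\<lambda>_. UNIV))"

abbreviation (input) coin_prob :: "nat set \<Rightarrow> (nat \<Rightarrow> bool) set \<Rightarrow> real" where
  "coin_prob N \<equiv> measure_pmf.prob (coins N)"

abbreviation (input) coin_mean :: "nat set \<Rightarrow> ((nat \<Rightarrow> bool) \<Rightarrow> real) \<Rightarrow> real" where
  "coin_mean N \<equiv> measure_pmf.expectation (coins N)"

lemma coins_Pi_pmf: "finite N \<Longrightarrow> coins N = Pi_pmf N undefined (\<lambda>_. pmf_of_set UNIV)"
  unfolding coins_def by (subst Pi_pmf_of_set) (auto simp: PiE_dflt_def PiE_def extensional_def Pi_def intro!: arg_cong[of _ _ pmf_of_set])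

lemma map_coins_restrict:
  assumes "finite N" "J \<subseteq> N"
  shows "map_pmf (\<lambda>u. restrict u J) (coins N) = coins J"
proof -
  have "finite J" using assms finite_subset by blast
  show ?thesis
    unfolding coins_Pi_pmf[OF assms(1)] coins_Pi_pmf[OF \<open>finite J\<close>] restrict_def
    by (rule Pi_pmf_subset[OF assms, symmetric])
qed

lemma indep_vars_coins:
  fixes f :: "'i \<Rightarrow> (nat \<Rightarrow> bool) \<Rightarrow> real"
  assumes N: "finite N" and J: "\<And>i. i \<in> L \<Longrightarrow> J i \<subseteq> N" "disjoint_family_on J L"
  shows "prob_space.indep_vars (measure_pmf (coins N)) (\<lambda>_. borel) (\<lambda>i u. f i (restrict u (J i))) L"
proof -
  have "prob_space.indep_vars (measure_pmf (coins N)) (\<lambda>_. count_space UNIV) (\<lambda>x u. u x) N"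
    unfolding coins_Pi_pmf[OF N] by (rule indep_vars_Pi_pmf[OF N])
  then have "prob_space.indep_vars (measure_pmf (coins N)) (\<lambda>j. PiM (J j) (\<lambda>_. count_space UNIV))
      (\<lambda>j u. restrict (\<lambda>i. u i) (J j)) L"
    by (rule prob_space.indep_vars_restrict[OF measure_pmf.prob_space_axioms]) (use J in auto)
  then show ?thesis
  proof (rule prob_space.indep_vars_compose2[OF measure_pmf.prob_space_axioms])
    fix i assume "i \<in> L"
    then have "finite (J i)" using J N finite_subset by blast
    \<comment> \<open>A finite product of discrete spaces is discrete, so every function of the
      coins in \<open>J i\<close> is measurable.\<close>
    then have "PiM (J i) (\<lambda>_. count_space (UNIV :: bool set)) = count_space (PiE (J i) (\<lambda>_. UNIV))"
      by (intro count_space_PiM_finite) auto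
    then show "f i \<in> PiM (J i) (\<lambda>_. count_space UNIV) \<rightarrow>\<^sub>M borel" by simp
  qed
qed

lemma prob_coins_two:
  assumes N: "finite N" and J: "J \<subseteq> N" "J' \<subseteq> N" "J \<inter> J' = {}"
    and P: "\<And>u. P u \<longleftrightarrow> P (restrict u J)" and Q: "\<And>u. Q u \<longleftrightarrow> Q (restrict u J')"
  shows "coin_prob N {u. P u \<and> Q u} =
    coin_prob N {u. P u} * coin_prob N {u. Q u}"
proof -
  define f :: "bool \<Rightarrow> (nat \<Rightarrow> bool) \<Rightarrow> real" where "f b u = of_bool (if b then P u else Q u)" for b u
  define K where "K b = (if b then J else J')" for b
  have fK: "f b (restrict u (K b)) = f b u" for b u
    using P[of u] Q[of u] by (auto simp: f_def K_def)
  have fin: "finite (set_pmf (coins N))"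
    unfolding coins_def using N by (simp add: finite_PiE set_pmf_of_set PiE_eq_empty_iff)
  have exp: "coin_prob N {u. T u} = coin_mean N (\<lambda>u. of_bool (T u))" for T
    by (subst Bochner_Integration.integral_cong[OF refl, of _ _ "indicator {u. T u}"]) (auto simp: indicator_def)
  have "prob_space.indep_vars (measure_pmf (coins N)) (\<lambda>_. borel) (\<lambda>b u. f b (restrict u (K b))) UNIV"
    by (rule indep_vars_coins[OF N]) (use J in \<open>auto simp: K_def disjoint_family_on_def\<close>)
  then have ind: "prob_space.indep_vars (measure_pmf (coins N)) (\<lambda>_. borel) f UNIV" by (simp add: fK)
  have "coin_mean N (\<lambda>u. \<Prod>b\<in>UNIV. f b u) = (\<Prod>b\<in>UNIV. coin_mean N (f b))"
    by (rule prob_space.indep_vars_lebesgue_integral[OF measure_pmf.prob_space_axioms _ ind]) (auto intro: integrable_measure_pmf_finite fin)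
  moreover have "(\<Prod>b\<in>UNIV. f b u) = of_bool (P u \<and> Q u)" for u
    by (auto simp: UNIV_bool f_def)
  moreover have "f True = (\<lambda>u. of_bool (P u))" "f False = (\<lambda>u. of_bool (Q u))"
    by (auto simp: f_def)
  ultimately show ?thesis
    unfolding exp by (simp add: UNIV_bool mult.commute)
qed

text \<open>Only the \<open>j + 2\<close> coins of \<open>S\<close> between \<open>a\<close> and
  \<open>c\<close> inclusive matter. Each matching of these points that contains
  \<open>(a, c)\<close> gives, by its openers, a different orientation with the excursion, and there
  are \<open>matching_count j\<close> of them.\<close>

lemma prob_excursion_lower:
  assumes N: "finite N" "S \<subseteq> N" and ac: "a \<in> S" "c \<in> S" "a < c"
  shows "arcp (gap S (a, c)) \<le> coin_prob N {u. excursion S u a c}"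
proof -
  define J where "J = S \<inter> {a..c}"
  define j where "j = card (S \<inter> {a<..<c})"
  have J: "finite J" "J \<subseteq> N" "a \<in> J" "c \<in> J" using N ac by (auto simp: J_def intro: finite_subset)
  have ins: "J \<inter> {a<..<c} = S \<inter> {a<..<c}" "J - {a..c} = {}" by (auto simp: J_def)
  have cJ: "card J = j + 2"
    using card_between[OF J(1) J(3,4) ac(3)] by (simp add: ins j_def)
  have restr: "excursion S u a c \<longleftrightarrow> excursion J (restrict u J) a c" for u
    by (rule excursion_cong) (auto simp: J_def)
  have "coin_prob N {u. excursion S u a c} =
      measure_pmf.prob (map_pmf (\<lambda>u. restrict u J) (coins N)) {v. excursion J v a c}"
    by (simp add: restr)
  also have "\<dots> = coin_prob J {v. excursion J v a c}"
    by (simp only: map_coins_restrict[OF N(1) J(2)])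
  also have "\<dots> = real (card (PiE J (\<lambda>_. UNIV) \<inter> {v. excursion J v a c})) / 2 ^ (j + 2)"
    unfolding coins_def using J(1) by (subst measure_pmf_of_set) (auto simp: PiE_eq_empty_iff finite_PiE card_PiE cJ)
  finally have pr: "coin_prob N {u. excursion S u a c} =
      real (card (PiE J (\<lambda>_. UNIV) \<inter> {v. excursion J v a c})) / 2 ^ (j + 2)" .
  let ?f = "\<lambda>M. restrict (\<lambda>z. z \<in> fst ` M) J"
  have "card {M \<in> matchings J. (a, c) \<in> M} \<le> card (PiE J (\<lambda>_. UNIV) \<inter> {v. excursion J v a c})"
  proof (rule card_inj_on_le[of ?f])
    show "inj_on ?f {M \<in> matchings J. (a, c) \<in> M}"
    proof (rule inj_onI)
      fix M M' assume M: "M \<in> {M \<in> matchings J. (a, c) \<in> M}" "M' \<in> {M \<in> matchings J. (a, c) \<in> M}" "?f M = ?f M'"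
      have "z \<in> fst ` M \<longleftrightarrow> z \<in> fst ` M'" if "z \<in> J" for z
        using fun_cong[OF M(3), of z] that by simp
      moreover have "fst ` M \<subseteq> J" "fst ` M' \<subseteq> J" using M matching_arcD(2)[of J] by auto
      ultimately have "fst ` M = fst ` M'" by blast
      then show "M = M'" using matching_eq_of_openers[OF J(1)] M by blast
    qed
    show "?f ` {M \<in> matchings J. (a, c) \<in> M} \<subseteq> PiE J (\<lambda>_. UNIV) \<inter> {v. excursion J v a c}"
    proof (rule image_subsetI)
      fix M assume "M \<in> {M \<in> matchings J. (a, c) \<in> M}"
      then have "excursion J (?f M) a c"
        by (intro matching_arc_excursion[OF J(1), of M]) auto
      then show "?f M \<in> PiE J (\<lambda>_. UNIV) \<inter> {v. excursion J v a c}" by simp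
    qed
    show "finite (PiE J (\<lambda>_. UNIV :: bool set) \<inter> {v. excursion J v a c})" using J(1) by (simp add: finite_PiE)
  qed
  moreover have "real (card {M \<in> matchings J. (a, c) \<in> M}) = matching_count j"
    using ac J by (subst card_matchings_with_arc) (auto simp: ins card_matchings j_def matching_count_def)
  ultimately have "matching_count j / 2 ^ (j + 2) \<le> coin_prob N {u. excursion S u a c}"
    unfolding pr by (intro divide_right_mono) auto
  moreover have "arcp (gap S (a, c)) = matching_count j / 2 ^ (j + 2)"
    by (auto simp: arcp_def gap_def j_def[symmetric] matching_count_def power_mult elim!: evenE)
  ultimately show ?thesis by simp
qed


subsection \<open>Edges inside a block\<close>

definition crosses :: "nat \<times> nat \<Rightarrow> nat \<times> nat \<Rightarrow> bool" where
  "crosses p q \<longleftrightarrow> (fst q \<in> {fst p<..<snd p}) \<noteq> (snd q \<in> {fst p<..<snd p})"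

text \<open>Edges are defined through orientations instead of matchings because an excursion depends
  only on the coins between its ends. Counts over disjoint intervals therefore read disjoint sets of
  coins.\<close>

definition block_set :: "nat set \<Rightarrow> nat set \<Rightarrow> nat set \<Rightarrow> (nat \<Rightarrow> bool) \<Rightarrow> ((nat \<times> nat) \<times> (nat \<times> nat)) set" where
  "block_set R B I u = {(p, q). p \<in> pairs (R \<inter> I) \<and> q \<in> pairs (B \<inter> I) \<and> crosses p q \<and>
     excursion R u (fst p) (snd p) \<and> excursion B u (fst q) (snd q)}"

lemma finite_block_set: "finite I \<Longrightarrow> finite (block_set R B I u)"
  by (rule finite_subset[of _ "pairs (R \<inter> I) \<times> pairs (B \<inter> I)"]) (auto simp: block_set_def finite_pairs)

text \<open>When the orientation comes from matchings, its excursions are arcs, so the blocks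
  contain disjoint families of edges. Edges with an endpoint outside a common block are given
  away.\<close>

lemma sum_block_edges_le:
  assumes R: "finite R" "catalan_matching R M" and B: "finite B" "catalan_matching B N" and disj: "R \<inter> B = {}"
    and u: "\<And>z. z \<in> R \<Longrightarrow> u z \<longleftrightarrow> z \<in> fst ` M" "\<And>z. z \<in> B \<Longrightarrow> u z \<longleftrightarrow> z \<in> fst ` N"
    and I: "finite L" "\<And>i. i \<in> L \<Longrightarrow> finite (I i)" "disjoint_family_on I L"
  shows "(\<Sum>i\<in>L. card (block_set R B (I i) u)) \<le> CP_edges (M \<union> N)"
proof -
  have finMN: "finite M" "finite N" using finite_matching R B by auto
  have "(\<Sum>i\<in>L. card (block_set R B (I i) u)) = card (\<Union>i\<in>L. block_set R B (I i) u)"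
  proof (rule card_UN_disjoint[symmetric])
    show "\<forall>i\<in>L. \<forall>j\<in>L. i \<noteq> j \<longrightarrow> block_set R B (I i) u \<inter> block_set R B (I j) u = {}"
    proof (intro ballI impI)
      fix i j assume "i \<in> L" "j \<in> L" "i \<noteq> j"
      then have "I i \<inter> I j = {}" using I(3) by (simp add: disjoint_family_on_def)
      then show "block_set R B (I i) u \<inter> block_set R B (I j) u = {}"
        by (auto simp: block_set_def pairs_def)
    qed
  qed (use I finite_block_set in auto)
  also have "\<dots> \<le> card (Sigma M (\<lambda>A. {C \<in> N. (fst C \<in> B \<inter> {fst A<..<snd A}) \<noteq> (snd C \<in> B \<inter> {fst A<..<snd A})}))"
  proof (rule card_mono)
    show "finite (Sigma M (\<lambda>A. {C \<in> N. (fst C \<in> B \<inter> {fst A<..<snd A}) \<noteq> (snd C \<in> B \<inter> {fst A<..<snd A})}))"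
      using finMN by auto
    show "(\<Union>i\<in>L. block_set R B (I i) u) \<subseteq> Sigma M (\<lambda>A. {C \<in> N. (fst C \<in> B \<inter> {fst A<..<snd A}) \<noteq> (snd C \<in> B \<inter> {fst A<..<snd A})})"
    proof
      fix x assume "x \<in> (\<Union>i\<in>L. block_set R B (I i) u)"
      then obtain i p q where x: "x = (p, q)" and p: "p \<in> pairs (R \<inter> I i)" and q: "q \<in> pairs (B \<inter> I i)"
        and c: "crosses p q" and e: "excursion R u (fst p) (snd p)" "excursion B u (fst q) (snd q)"
        by (auto simp: block_set_def)
      have "(fst p, snd p) \<in> M" using e(1) by (rule excursion_matching_arc[OF R, rotated]) (fact u(1))
      moreover have "(fst q, snd q) \<in> N" using e(2) by (rule excursion_matching_arc[OF B, rotated]) (fact u(2))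
      moreover have "fst q \<in> B" "snd q \<in> B" using q by (auto simp: pairs_def)
      ultimately show "x \<in> Sigma M (\<lambda>A. {C \<in> N. (fst C \<in> B \<inter> {fst A<..<snd A}) \<noteq> (snd C \<in> B \<inter> {fst A<..<snd A})})"
        using c by (auto simp: x crosses_def)
    qed
  qed
  also have "\<dots> = CP_edges (M \<union> N)"
    unfolding CP_edges_union[OF R B disj] using finMN by (intro card_SigmaI) auto
  finally show ?thesis .
qed

section \<open>The mean number of edges inside a block\<close>

lemma expectation_coins_card:
  assumes "finite N" "finite X"
  shows "coin_mean N (\<lambda>u. real (card {x \<in> X. P u x})) =
    (\<Sum>x\<in>X. coin_prob N {u. P u x})"
proof -
  have fin: "finite (set_pmf (coins N))"
    unfolding coins_def using assms(1) by (simp add: finite_PiE set_pmf_of_set PiE_eq_empty_iff)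
  have "coin_mean N (\<lambda>u. real (card {x \<in> X. P u x})) =
      coin_mean N (\<lambda>u. \<Sum>x\<in>X. indicator {u. P u x} u)"
  proof (rule Bochner_Integration.integral_cong[OF refl])
    fix u
    have "real (card {x \<in> X. P u x}) = (\<Sum>x\<in>X. of_bool (P u x))"
      by (rule sum_of_bool_card[OF assms(2), symmetric])
    also have "\<dots> = (\<Sum>x\<in>X. indicator {u. P u x} u)"
      by (intro sum.cong refl) (simp add: indicator_def)
    finally show "real (card {x \<in> X. P u x}) = (\<Sum>x\<in>X. indicator {u. P u x} u)" .
  qed
  also have "\<dots> = (\<Sum>x\<in>X. coin_mean N (indicator {u. P u x}))"
    by (rule Bochner_Integration.integral_sum) (auto intro: integrable_measure_pmf_finite fin)
  finally show ?thesis by simp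
qed

lemma sum_arcp_shift: "2 * (\<Sum>j<g. arcp (Suc (w + j))) = unmatched w - unmatched (w + g)"
proof (induction g)
  case (Suc g)
  have "2 * arcp (Suc (w + g)) = unmatched (w + g) - unmatched (w + Suc g)"
    using sum_arcp[of "Suc (w + g)"] sum_arcp[of "w + g"] by simp
  then show ?case using Suc by simp
qed simp

lemma sum_unmatched_ge:
  assumes "g \<le> g'"
  shows "leaving m - real m * unmatched g \<le> (\<Sum>w<m. unmatched w - unmatched (w + g'))"
proof -
  have "(\<Sum>w<m. unmatched (w + g')) \<le> (\<Sum>w<m. unmatched g)"
    by (intro sum_mono unmatched_antimono) (use assms in auto)
  then show ?thesis by (simp add: sum_subtractf leaving_def)
qed

text \<open>A crossing blue arc joins a point of the window under \<open>(a, c)\<close> to a point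
  of \<open>I\<close> on its left or right. From a window point with \<open>w\<close> window points
  on the way, the \<open>g'\<close> points outside carry mass
  \<open>(unmatched w - unmatched (w + g')) / 2\<close>. The two sides together give
  \<open>leaving m\<close>, up to the mass that would go beyond \<open>I\<close>.\<close>

lemma sum_arcp_crossing:
  assumes I: "I = {o'..<e}" and ac: "a \<in> I" "c \<in> I" "a < c" "a \<notin> B" "c \<notin> B"
    and g: "g \<le> card (B \<inter> {o'..<a})" "g \<le> card (B \<inter> {c<..<e})"
  defines "m \<equiv> card (B \<inter> {a<..<c})"
  shows "leaving m - real m * unmatched g \<le> (\<Sum>q\<in>{q \<in> pairs (B \<inter> I). crosses (a, c) q}. arcp (gap B q))"
proof -
  define W where "W = B \<inter> {a<..<c}"
  define Rt where "Rt = B \<inter> {c<..<e}"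
  define Lt where "Lt = B \<inter> {o'..<a}"
  have fin: "finite W" "finite Rt" "finite Lt" by (auto simp: W_def Rt_def Lt_def)
  have right: "2 * (\<Sum>x\<in>W. \<Sum>y\<in>Rt. arcp (gap B (x, y))) = (\<Sum>w<m. unmatched w - unmatched (w + card Rt))"
  proof -
    have "(\<Sum>y\<in>Rt. arcp (gap B (x, y))) = (\<Sum>j<card Rt. arcp (Suc (card (W \<inter> {x<..}) + j)))" if x: "x \<in> W" for x
    proof -
      have "gap B (x, y) = Suc (card (W \<inter> {x<..}) + card (Rt \<inter> {..<y}))" if "y \<in> Rt" for y
      proof -
        have "B \<inter> {x<..<y} = (W \<inter> {x<..}) \<union> (Rt \<inter> {..<y})"
          using x that ac by (auto simp: W_def Rt_def) (metis linorder_less_linear)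
        moreover have "card ((W \<inter> {x<..}) \<union> (Rt \<inter> {..<y})) = card (W \<inter> {x<..}) + card (Rt \<inter> {..<y})"
          using fin by (intro card_Un_disjoint) (auto simp: W_def Rt_def)
        ultimately show ?thesis by (simp add: gap_def)
      qed
      then have "(\<Sum>y\<in>Rt. arcp (gap B (x, y))) = (\<Sum>y\<in>Rt. arcp (Suc (card (W \<inter> {x<..}) + card (Rt \<inter> {..<y}))))"
        by (intro sum.cong refl) simp
      also have "\<dots> = (\<Sum>j<card Rt. arcp (Suc (card (W \<inter> {x<..}) + j)))"
        by (rule sum_rank[OF fin(2)])
      finally show ?thesis .
    qed
    then have "2 * (\<Sum>x\<in>W. \<Sum>y\<in>Rt. arcp (gap B (x, y))) =
        (\<Sum>x\<in>W. unmatched (card (W \<inter> {x<..})) - unmatched (card (W \<inter> {x<..}) + card Rt))"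
      by (simp add: sum_distrib_left[of _ _ W] sum_arcp_shift)
    also have "\<dots> = (\<Sum>w<card W. unmatched w - unmatched (w + card Rt))"
      by (rule sum_corank[OF fin(1), of "\<lambda>w. unmatched w - unmatched (w + card Rt)"])
    finally show ?thesis by (simp add: m_def W_def)
  qed
  have left: "2 * (\<Sum>x\<in>W. \<Sum>y\<in>Lt. arcp (gap B (y, x))) = (\<Sum>w<m. unmatched w - unmatched (w + card Lt))"
  proof -
    have "(\<Sum>y\<in>Lt. arcp (gap B (y, x))) = (\<Sum>j<card Lt. arcp (Suc (card (W \<inter> {..<x}) + j)))" if x: "x \<in> W" for x
    proof -
      have "gap B (y, x) = Suc (card (W \<inter> {..<x}) + card (Lt \<inter> {y<..}))" if "y \<in> Lt" for y
      proof -
        have "B \<inter> {y<..<x} = (W \<inter> {..<x}) \<union> (Lt \<inter> {y<..})"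
          using x that ac by (auto simp: W_def Lt_def) (metis linorder_less_linear)
        moreover have "card ((W \<inter> {..<x}) \<union> (Lt \<inter> {y<..})) = card (W \<inter> {..<x}) + card (Lt \<inter> {y<..})"
          using fin by (intro card_Un_disjoint) (auto simp: W_def Lt_def)
        ultimately show ?thesis by (simp add: gap_def)
      qed
      then have "(\<Sum>y\<in>Lt. arcp (gap B (y, x))) = (\<Sum>y\<in>Lt. arcp (Suc (card (W \<inter> {..<x}) + card (Lt \<inter> {y<..}))))"
        by (intro sum.cong refl) simp
      also have "\<dots> = (\<Sum>j<card Lt. arcp (Suc (card (W \<inter> {..<x}) + j)))"
        by (rule sum_corank[OF fin(3)])
      finally show ?thesis .
    qed
    then have "2 * (\<Sum>x\<in>W. \<Sum>y\<in>Lt. arcp (gap B (y, x))) =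
        (\<Sum>x\<in>W. unmatched (card (W \<inter> {..<x})) - unmatched (card (W \<inter> {..<x}) + card Lt))"
      by (simp add: sum_distrib_left[of _ _ W] sum_arcp_shift)
    also have "\<dots> = (\<Sum>w<card W. unmatched w - unmatched (w + card Lt))"
      by (rule sum_rank[OF fin(1), of "\<lambda>w. unmatched w - unmatched (w + card Lt)"])
    finally show ?thesis by (simp add: m_def W_def)
  qed
  have "leaving m - real m * unmatched g \<le> (\<Sum>x\<in>W. \<Sum>y\<in>Rt. arcp (gap B (x, y))) + (\<Sum>x\<in>W. \<Sum>y\<in>Lt. arcp (gap B (y, x)))"
    using right left sum_unmatched_ge[of g "card Rt" m] sum_unmatched_ge[of g "card Lt" m] g
    by (simp add: Rt_def Lt_def)
  also have "(\<Sum>x\<in>W. \<Sum>y\<in>Rt. arcp (gap B (x, y))) = (\<Sum>q\<in>W \<times> Rt. arcp (gap B q))"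
    using fin by (simp add: sum.cartesian_product)
  also have "(\<Sum>x\<in>W. \<Sum>y\<in>Lt. arcp (gap B (y, x))) = (\<Sum>q\<in>Lt \<times> W. arcp (gap B q))"
    using fin by (subst sum.swap) (simp add: sum.cartesian_product)
  also have "(\<Sum>q\<in>W \<times> Rt. arcp (gap B q)) + (\<Sum>q\<in>Lt \<times> W. arcp (gap B q)) = (\<Sum>q\<in>W \<times> Rt \<union> Lt \<times> W. arcp (gap B q))"
    using fin by (intro sum.union_disjoint[symmetric]) (auto simp: W_def Lt_def)
  also have "\<dots> \<le> (\<Sum>q\<in>{q \<in> pairs (B \<inter> I). crosses (a, c) q}. arcp (gap B q))"
  proof (rule sum_mono2)
    show "finite {q \<in> pairs (B \<inter> I). crosses (a, c) q}" by (simp add: finite_pairs I)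
    show "W \<times> Rt \<union> Lt \<times> W \<subseteq> {q \<in> pairs (B \<inter> I). crosses (a, c) q}"
      using ac(1-3) by (auto simp: W_def Rt_def Lt_def pairs_def crosses_def I)
  qed simp
  finally show ?thesis .
qed

text \<open>A red and a blue excursion read coins of different colour classes, so they are
  independent even when the intervals overlap.\<close>

lemma expectation_block_lower:
  assumes N: "finite N" "R \<subseteq> N" "B \<subseteq> N" "R \<inter> B = {}" and I: "finite I"
  shows "(\<Sum>p\<in>pairs (R \<inter> I). arcp (gap R p) * (\<Sum>q\<in>{q \<in> pairs (B \<inter> I). crosses p q}. arcp (gap B q))) \<le>
    coin_mean N (\<lambda>u. real (card (block_set R B I u)))"
proof -
  let ?X = "Sigma (pairs (R \<inter> I)) (\<lambda>p. {q \<in> pairs (B \<inter> I). crosses p q})"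
  let ?P = "\<lambda>u x. excursion R u (fst (fst x)) (snd (fst x)) \<and> excursion B u (fst (snd x)) (snd (snd x))"
  have finX: "finite ?X" using I by (intro finite_SigmaI) (auto simp: finite_pairs)
  have "(\<Sum>p\<in>pairs (R \<inter> I). arcp (gap R p) * (\<Sum>q\<in>{q \<in> pairs (B \<inter> I). crosses p q}. arcp (gap B q))) =
      (\<Sum>x\<in>?X. arcp (gap R (fst x)) * arcp (gap B (snd x)))"
    unfolding sum_distrib_left using I by (subst sum.Sigma) (auto simp: finite_pairs case_prod_beta)
  also have "\<dots> \<le> (\<Sum>x\<in>?X. coin_prob N {u. ?P u x})"
  proof (rule sum_mono)
    fix x assume "x \<in> ?X"
    then obtain a c b d where x: "x = ((a, c), (b, d))" and m: "a \<in> R" "c \<in> R" "a < c" "b \<in> B" "d \<in> B" "b < d"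
      by (cases x) (auto simp: pairs_def)
    have "coin_prob N {u. excursion R u a c \<and> excursion B u b d} =
        coin_prob N {u. excursion R u a c} * coin_prob N {u. excursion B u b d}"
    proof (rule prob_coins_two[OF N(1) N(2,3,4)])
      show "excursion R u a c \<longleftrightarrow> excursion R (restrict u R) a c" for u by (rule excursion_cong) auto
      show "excursion B u b d \<longleftrightarrow> excursion B (restrict u B) b d" for u by (rule excursion_cong) auto
    qed
    moreover have "arcp (gap R (a, c)) * arcp (gap B (b, d)) \<le>
        coin_prob N {u. excursion R u a c} * coin_prob N {u. excursion B u b d}"
      using prob_excursion_lower[OF N(1,2) m(1-3)] prob_excursion_lower[OF N(1,3) m(4-6)]
      by (intro mult_mono) auto
    ultimately show "arcp (gap R (fst x)) * arcp (gap B (snd x)) \<le> coin_prob N {u. ?P u x}"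
      by (simp add: x)
  qed
  also have "\<dots> = coin_mean N (\<lambda>u. real (card {x \<in> ?X. ?P u x}))"
    by (rule expectation_coins_card[OF N(1) finX, symmetric])
  also have "(\<lambda>u. real (card {x \<in> ?X. ?P u x})) = (\<lambda>u. real (card (block_set R B I u)))"
    by (intro ext arg_cong[of _ _ real] arg_cong[of _ _ card]) (auto simp: block_set_def)
  finally show ?thesis .
qed

subsection \<open>A deterministic bound on the edges inside a block\<close>

lemma excursion_climb_ge1: "excursion S u a c \<Longrightarrow> a < t \<Longrightarrow> t \<le> c \<Longrightarrow> climb S u a t \<ge> 1"
  by (simp add: excursion_def)

lemma excursion_climb_rest:
  assumes "excursion S u a c" "a < t" "t \<le> c"
  shows "climb S u a t = - climb S u t (Suc c)"
  using assms climb_split[of a t "Suc c" S u] by (simp add: excursion_def)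

lemma abs_climb_le: "x \<le> y \<Longrightarrow> \<bar>climb S u x y\<bar> \<le> int (y - x)"
proof -
  assume "x \<le> y"
  have "\<bar>climb S u x y\<bar> \<le> (\<Sum>z\<in>{x..<y}. 1)"
    unfolding climb_def by (rule order_trans[OF sum_abs]) (rule sum_mono, auto)
  then show ?thesis by simp
qed

text \<open>Of two excursions of the same path over \<open>t\<close>, the one that starts earlier is
  already above its start when the other begins, so it has climbed strictly more at
  \<open>t\<close>. Thus nested excursions are told apart by height.\<close>

lemma inj_on_climb_covering:
  "inj_on (\<lambda>q. climb S u (fst q) t) {q. excursion S u (fst q) (snd q) \<and> fst q < t \<and> t \<le> snd q}"
proof (rule inj_onI)
  have *: "\<not> fst q < fst q'"
    if "q \<in> {q. excursion S u (fst q) (snd q) \<and> fst q < t \<and> t \<le> snd q}"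
      "q' \<in> {q. excursion S u (fst q) (snd q) \<and> fst q < t \<and> t \<le> snd q}"
      "climb S u (fst q) t = climb S u (fst q') t" for q q'
  proof
    assume lt: "fst q < fst q'"
    then have "climb S u (fst q) t = climb S u (fst q) (fst q') + climb S u (fst q') t"
      using that by (intro climb_split) auto
    moreover have "climb S u (fst q) (fst q') \<ge> 1"
      using that lt by (intro excursion_climb_ge1[of _ _ _ "snd q"]) auto
    ultimately show False using that by simp
  qed
  fix q q' assume q: "q \<in> {q. excursion S u (fst q) (snd q) \<and> fst q < t \<and> t \<le> snd q}"
      "q' \<in> {q. excursion S u (fst q) (snd q) \<and> fst q < t \<and> t \<le> snd q}"
      "climb S u (fst q) t = climb S u (fst q') t"
  have "fst q = fst q'" using *[OF q] *[OF q(2,1) q(3)[symmetric]] by simp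
  moreover from this have "snd q = snd q'" using q excursion_unique[of S u "fst q"] by auto
  ultimately show "q = q'" by (simp add: prod_eq_iff)
qed

lemma card_covering_le:
  assumes Q: "Q \<subseteq> {q. excursion S u (fst q) (snd q) \<and> fst q < t \<and> t \<le> snd q}"
    and le: "\<And>q. q \<in> Q \<Longrightarrow> real_of_int (climb S u (fst q) t) \<le> \<Lambda>" and "0 \<le> \<Lambda>"
  shows "finite Q" "real (card Q) \<le> \<Lambda>"
proof -
  have inj: "inj_on (\<lambda>q. climb S u (fst q) t) Q"
    using inj_on_climb_covering Q by (rule inj_on_subset)
  have sub: "(\<lambda>q. climb S u (fst q) t) ` Q \<subseteq> {1..\<lfloor>\<Lambda>\<rfloor>}"
  proof (rule image_subsetI)
    fix q assume q: "q \<in> Q"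
    then have "climb S u (fst q) t \<ge> 1" using Q by (intro excursion_climb_ge1[of _ _ _ "snd q"]) auto
    then show "climb S u (fst q) t \<in> {1..\<lfloor>\<Lambda>\<rfloor>}" using le[OF q] by (simp add: le_floor_iff)
  qed
  show "finite Q" by (rule inj_on_finite[OF inj sub]) simp
  have "card Q \<le> card {1..\<lfloor>\<Lambda>\<rfloor>}" by (rule card_inj_on_le[OF inj sub]) simp
  then show "real (card Q) \<le> \<Lambda>" using assms(3) by simp linarith
qed

text \<open>The path fluctuates like a random walk on all subintervals at once, up to the factor
  \<rho>. With \<rho> = ln n the exceptional probability is smaller than every power of n.\<close>

definition tame :: "real \<Rightarrow> nat set \<Rightarrow> nat \<Rightarrow> nat \<Rightarrow> (nat \<Rightarrow> bool) \<Rightarrow> bool" where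
  "tame \<rho> S s e u \<longleftrightarrow> (\<forall>x y. s \<le> x \<and> x < y \<and> y \<le> e \<longrightarrow>
     \<bar>real_of_int (climb S u x y)\<bar> \<le> \<rho> * sqrt (real (y - x)))"

text \<open>A crossing excursion covers one end of \<open>p\<close> and has its own other end inside
  \<open>p\<close>. The excursions over one end have distinct heights there, bounded by the
  fluctuation of the path inside \<open>p\<close>; the two ends give the factor 2.\<close>

lemma card_crossing_le:
  assumes B: "tame \<rho> B s e u" "0 \<le> \<rho>" and p: "fst p \<in> {s..<e} - B" "snd p \<in> {s..<e} - B" "fst p < snd p"
  shows "real (card {q \<in> pairs (B \<inter> {s..<e}). crosses p q \<and> excursion B u (fst q) (snd q)}) \<le>
    2 * \<rho> * sqrt (real (snd p - fst p))"
proof -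
  define a c where "a = fst p" and "c = snd p"
  let ?\<Lambda> = "\<rho> * sqrt (real (c - a))"
  let ?Q = "{q \<in> pairs (B \<inter> {s..<e}). crosses p q \<and> excursion B u (fst q) (snd q)}"
  define Q1 where "Q1 = {q \<in> ?Q. a < fst q \<and> fst q < c \<and> c < snd q}"
  define Q2 where "Q2 = {q \<in> ?Q. fst q < a \<and> a < snd q \<and> snd q < c}"
  have \<Lambda>: "0 \<le> ?\<Lambda>" using B(2) by simp
  have mono: "\<rho> * sqrt (real k) \<le> ?\<Lambda>" if "k \<le> c - a" for k
    using that B(2) by (intro mult_left_mono real_sqrt_le_mono) auto
  have Q1_le: "real_of_int (climb B u (fst q) c) \<le> ?\<Lambda>" if "q \<in> Q1" for q
  proof -
    have q: "s \<le> fst q" "fst q < c" "c \<le> e" "a < fst q" using that p by (auto simp: Q1_def pairs_def c_def)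
    have "\<bar>real_of_int (climb B u (fst q) c)\<bar> \<le> \<rho> * sqrt (real (c - fst q))"
      using B(1)[unfolded tame_def, rule_format, of "fst q" c] q by blast
    then have "real_of_int (climb B u (fst q) c) \<le> \<rho> * sqrt (real (c - fst q))" by linarith
    also have "\<dots> \<le> ?\<Lambda>" using q by (intro mono) auto
    finally show ?thesis .
  qed
  have "Q1 \<subseteq> {q. excursion B u (fst q) (snd q) \<and> fst q < c \<and> c \<le> snd q}" by (auto simp: Q1_def)
  note Q1 = card_covering_le[OF this Q1_le \<Lambda>]
  \<comment> \<open>These excursions may open far to the left of \<open>a\<close>, so their height
    at \<open>a\<close> is read off from the descent to their closing point, which takes place
    inside \<open>p\<close>.\<close>
  have Q2_le: "real_of_int (climb B u (fst q) a) \<le> ?\<Lambda>" if "q \<in> Q2" for q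
  proof -
    have q: "s \<le> a" "a < Suc (snd q)" "Suc (snd q) \<le> e" "fst q < a" "a \<le> snd q" "snd q < c"
      "excursion B u (fst q) (snd q)"
      using that p by (auto simp: Q2_def pairs_def a_def)
    have "\<bar>real_of_int (climb B u a (Suc (snd q)))\<bar> \<le> \<rho> * sqrt (real (Suc (snd q) - a))"
      using B(1)[unfolded tame_def, rule_format, of a "Suc (snd q)"] q by blast
    then have "real_of_int (climb B u (fst q) a) \<le> \<rho> * sqrt (real (Suc (snd q) - a))"
      unfolding excursion_climb_rest[OF q(7) q(4) q(5)] of_int_minus by linarith
    also have "\<dots> \<le> ?\<Lambda>" using q by (intro mono) auto
    finally show ?thesis .
  qed
  have "Q2 \<subseteq> {q. excursion B u (fst q) (snd q) \<and> fst q < a \<and> a \<le> snd q}" by (auto simp: Q2_def)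
  note Q2 = card_covering_le[OF this Q2_le \<Lambda>]
  have "?Q \<subseteq> Q1 \<union> Q2"
  proof
    fix q assume q: "q \<in> ?Q"
    then have "fst q < snd q" "fst q \<noteq> a" "fst q \<noteq> c" "snd q \<noteq> a" "snd q \<noteq> c"
      using p by (auto simp: pairs_def a_def c_def)
    moreover have "(fst q \<in> {a<..<c}) \<noteq> (snd q \<in> {a<..<c})" using q by (auto simp: crosses_def a_def c_def)
    ultimately have "(a < fst q \<and> fst q < c \<and> c < snd q) \<or> (fst q < a \<and> a < snd q \<and> snd q < c)" by auto
    then show "q \<in> Q1 \<union> Q2" using q by (auto simp: Q1_def Q2_def)
  qed
  then have "card ?Q \<le> card (Q1 \<union> Q2)" using Q1 Q2 by (intro card_mono) auto
  also have "\<dots> \<le> card Q1 + card Q2" by (rule card_Un_le)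
  finally have "real (card ?Q) \<le> real (card Q1) + real (card Q2)" by linarith
  then show ?thesis using Q1(2) Q2(2) unfolding a_def c_def by linarith
qed

text \<open>Spread sqrt (length) evenly over the positions \<open>t\<close> under the excursion and
  sum over excursions first. Those over a given \<open>t\<close> have distinct heights, and by
  tameness 1 / sqrt (length) is at most \<rho> / height. Hence each \<open>t\<close> receives at
  most \<rho> times a harmonic sum.\<close>

lemma sum_excursion_sqrt_le:
  assumes R: "tame \<rho> R s e u" "0 \<le> \<rho>" "s < e"
  defines "P \<equiv> {p \<in> pairs (R \<inter> {s..<e}). excursion R u (fst p) (snd p)}"
  shows "(\<Sum>p\<in>P. sqrt (real (snd p - fst p))) \<le> \<rho> * real (e - s) * (ln (real (e - s)) + 1)"
proof -
  have finP: "finite P" by (simp add: P_def finite_pairs)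
  have pos: "fst p < snd p" "s \<le> fst p" "snd p < e" "excursion R u (fst p) (snd p)" if "p \<in> P" for p
    using that by (auto simp: P_def pairs_def)
  have "(\<Sum>p\<in>P. sqrt (real (snd p - fst p))) = (\<Sum>p\<in>P. \<Sum>t\<in>{s..<e}. of_bool (fst p < t \<and> t \<le> snd p) / sqrt (real (snd p - fst p)))"
  proof (rule sum.cong)
    fix p assume p: "p \<in> P"
    have "{t \<in> {s..<e}. fst p < t \<and> t \<le> snd p} = {fst p<..snd p}" using pos[OF p] by auto
    then have "(\<Sum>t\<in>{s..<e}. of_bool (fst p < t \<and> t \<le> snd p)) = real (snd p - fst p)"
      by (simp only: sum_of_bool_card finite_atLeastLessThan card_greaterThanAtMost)
    then have "(\<Sum>t\<in>{s..<e}. of_bool (fst p < t \<and> t \<le> snd p) / sqrt (real (snd p - fst p))) =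
        real (snd p - fst p) / sqrt (real (snd p - fst p))"
      by (simp only: sum_divide_distrib[symmetric])
    then show "sqrt (real (snd p - fst p)) = (\<Sum>t\<in>{s..<e}. of_bool (fst p < t \<and> t \<le> snd p) / sqrt (real (snd p - fst p)))"
      by (simp only: real_div_sqrt of_nat_0_le_iff)
  qed simp
  also have "\<dots> = (\<Sum>t\<in>{s..<e}. \<Sum>p\<in>P. of_bool (fst p < t \<and> t \<le> snd p) / sqrt (real (snd p - fst p)))"
    by (rule sum.swap)
  also have "\<dots> \<le> (\<Sum>t\<in>{s..<e}. \<rho> * (ln (real (e - s)) + 1))"
  proof (rule sum_mono)
    fix t assume t: "t \<in> {s..<e}"
    define C where "C = {p \<in> P. fst p < t \<and> t \<le> snd p}"
    define j where "j p = nat (climb R u (fst p) t) - 1" for p :: "nat \<times> nat"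
    have finC: "finite C" using finP by (simp add: C_def)
    have cl: "climb R u (fst p) t \<ge> 1" if "p \<in> C" for p
      using that pos by (intro excursion_climb_ge1[of _ _ _ "snd p"]) (auto simp: C_def)
    have jr: "real (j p) + 1 = real_of_int (climb R u (fst p) t)" if "p \<in> C" for p
      using cl[OF that] by (simp add: j_def)
    have "(\<Sum>p\<in>P. of_bool (fst p < t \<and> t \<le> snd p) / sqrt (real (snd p - fst p))) =
        (\<Sum>p\<in>C. 1 / sqrt (real (snd p - fst p)))"
      unfolding C_def using finP by (intro sum.mono_neutral_cong_right) auto
    also have "\<dots> \<le> (\<Sum>p\<in>C. \<rho> * (1 / (real (j p) + 1)))"
    proof (rule sum_mono)
      fix p assume p: "p \<in> C"
      then have p': "p \<in> P" "fst p < t" "t \<le> snd p" by (auto simp: C_def)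
      have "\<bar>real_of_int (climb R u (fst p) t)\<bar> \<le> \<rho> * sqrt (real (t - fst p))"
        using R(1)[unfolded tame_def, rule_format, of "fst p" t] pos[OF p'(1)] p' t by auto
      then have "real (j p) + 1 \<le> \<rho> * sqrt (real (t - fst p))"
        unfolding jr[OF p] by linarith
      also have "\<dots> \<le> \<rho> * sqrt (real (snd p - fst p))"
        using p' R(2) by (intro mult_left_mono real_sqrt_le_mono) auto
      finally have "real (j p) + 1 \<le> \<rho> * sqrt (real (snd p - fst p))" .
      moreover have "sqrt (real (snd p - fst p)) > 0" using pos[OF p'(1)] by simp
      ultimately show "1 / sqrt (real (snd p - fst p)) \<le> \<rho> * (1 / (real (j p) + 1))"
        by (simp add: divide_simps mult.commute)
    qed
    also have "\<dots> = \<rho> * (\<Sum>p\<in>C. 1 / (real (j p) + 1))" by (simp add: sum_distrib_left)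
    also have "(\<Sum>p\<in>C. 1 / (real (j p) + 1)) = (\<Sum>i\<in>j ` C. 1 / (real i + 1))"
    proof (rule sum.reindex_cong[symmetric, of j])
      show "inj_on j C"
      proof (rule inj_onI)
        fix p p' assume pp: "p \<in> C" "p' \<in> C" "j p = j p'"
        then have "climb R u (fst p) t = climb R u (fst p') t"
          using cl[OF pp(1)] cl[OF pp(2)] by (simp add: j_def)
        moreover have "p \<in> {q. excursion R u (fst q) (snd q) \<and> fst q < t \<and> t \<le> snd q}"
          "p' \<in> {q. excursion R u (fst q) (snd q) \<and> fst q < t \<and> t \<le> snd q}"
          using pp pos by (auto simp: C_def)
        ultimately show "p = p'" using inj_onD[OF inj_on_climb_covering[of R u t]] by blast
      qed
    qed auto
    also have "(\<Sum>i\<in>j ` C. 1 / (real i + 1)) \<le> (\<Sum>i<e - s. 1 / (real i + 1))"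
    proof (rule sum_mono2)
      show "j ` C \<subseteq> {..<e - s}"
      proof (rule image_subsetI)
        fix p assume p: "p \<in> C"
        then have p': "p \<in> P" "fst p < t" by (auto simp: C_def)
        have "climb R u (fst p) t \<le> int (t - fst p)" using abs_climb_le[of "fst p" t R u] p' by simp
        also have "t - fst p \<le> e - s" using t pos[OF p'(1)] by auto
        finally have "climb R u (fst p) t \<le> int (e - s)" by simp
        then show "j p \<in> {..<e - s}" using cl[OF p] by (simp add: j_def)
      qed
    qed auto
    also have "\<dots> \<le> ln (real (e - s)) + 1" by (rule harm_le_ln) (use R(3) in simp)
    finally show "(\<Sum>p\<in>P. of_bool (fst p < t \<and> t \<le> snd p) / sqrt (real (snd p - fst p))) \<le> \<rho> * (ln (real (e - s)) + 1)"
      using R(2) by (simp add: mult_left_mono)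
  qed
  finally show ?thesis using R(3) by (simp add: mult_ac)
qed

text \<open>Up to the factor \<rho>^2 and a constant this is of the order of the mean in a balanced
  block, so the range in Hoeffding's inequality exceeds the mean only by a power of the
  logarithm.\<close>

lemma card_block_le:
  assumes tame: "tame \<rho> R s e u" "tame \<rho> B s e u" and \<rho>: "0 \<le> \<rho>" and "s < e" and disj: "R \<inter> B = {}"
  shows "real (card (block_set R B {s..<e} u)) \<le> 2 * \<rho>\<^sup>2 * real (e - s) * (ln (real (e - s)) + 1)"
proof -
  define P where "P = {p \<in> pairs (R \<inter> {s..<e}). excursion R u (fst p) (snd p)}"
  let ?Q = "\<lambda>p. {q \<in> pairs (B \<inter> {s..<e}). crosses p q \<and> excursion B u (fst q) (snd q)}"
  have fin: "finite P" "\<And>p. finite (?Q p)" by (auto simp: P_def finite_pairs)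
  have "block_set R B {s..<e} u = Sigma P ?Q" by (auto simp: block_set_def P_def)
  then have "real (card (block_set R B {s..<e} u)) = (\<Sum>p\<in>P. real (card (?Q p)))"
    using fin by (simp add: card_SigmaI)
  also have "\<dots> \<le> (\<Sum>p\<in>P. 2 * \<rho> * sqrt (real (snd p - fst p)))"
  proof (rule sum_mono)
    fix p assume "p \<in> P"
    then have "fst p \<in> {s..<e} - B" "snd p \<in> {s..<e} - B" "fst p < snd p"
      using disj by (auto simp: P_def pairs_def)
    then show "real (card (?Q p)) \<le> 2 * \<rho> * sqrt (real (snd p - fst p))"
      by (rule card_crossing_le[OF tame(2) \<rho>])
  qed
  also have "\<dots> = 2 * \<rho> * (\<Sum>p\<in>P. sqrt (real (snd p - fst p)))" by (simp add: sum_distrib_left)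
  also have "\<dots> \<le> 2 * \<rho> * (\<rho> * real (e - s) * (ln (real (e - s)) + 1))"
    unfolding P_def by (intro mult_left_mono sum_excursion_sqrt_le tame \<rho> \<open>s < e\<close>) (use \<rho> in auto)
  finally show ?thesis by (simp only: power2_eq_square mult_ac)
qed

subsection \<open>Concentration over independent blocks\<close>

lemma finite_set_coins: "finite N \<Longrightarrow> finite (set_pmf (coins N))"
  unfolding coins_def by (simp add: finite_PiE set_pmf_of_set PiE_eq_empty_iff)

lemma map_coins_component:
  assumes "finite N" "z \<in> N"
  shows "map_pmf (\<lambda>u. u z) (coins N) = pmf_of_set UNIV"
  using assms by (simp add: coins_Pi_pmf Pi_pmf_component)

lemma coins_Hoeffding:
  assumes N: "finite N" "T \<subseteq> N" "T \<noteq> {}" and "t \<ge> 0"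
  shows "coin_prob N {u. \<bar>\<Sum>z\<in>T. if u z then 1 else - 1\<bar> \<ge> t} \<le> 2 * exp (- t\<^sup>2 / (2 * real (card T)))"
proof -
  let ?X = "\<lambda>z u. if u z then 1 else - 1 :: real"
  have finT: "finite T" using N finite_subset by blast
  have "prob_space.indep_vars (measure_pmf (coins N)) (\<lambda>_. borel) (\<lambda>z u. ?X z (restrict u {z})) T"
    by (rule indep_vars_coins[OF N(1)]) (use N in \<open>auto simp: disjoint_family_on_def\<close>)
  then have ind: "prob_space.indep_vars (measure_pmf (coins N)) (\<lambda>_. borel) ?X T" by simp
  have E: "coin_mean N (?X z) = 0" if "z \<in> T" for z
  proof -
    have "coin_mean N (?X z) =
        measure_pmf.expectation (map_pmf (\<lambda>u. u z) (coins N)) (\<lambda>b. if b then 1 else - 1)"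
      by simp
    also have "\<dots> = measure_pmf.expectation (pmf_of_set UNIV) (\<lambda>b. if b then 1 else - 1)"
      using that N by (subst map_coins_component) auto
    also have "\<dots> = 0" by (subst integral_pmf_of_set) (auto simp: UNIV_bool)
    finally show ?thesis .
  qed
  interpret Hoeffding_ineq "measure_pmf (coins N)" T ?X "\<lambda>_. - 1" "\<lambda>_. 1" "\<Sum>z\<in>T. coin_mean N (?X z)"
  proof unfold_locales
    show "AE u in measure_pmf (coins N). ?X z u \<in> {- 1..1}" for z by (rule AE_I2) simp
  qed (fact finT, fact ind)
  have "coin_prob N {u \<in> space (measure_pmf (coins N)). \<bar>(\<Sum>z\<in>T. ?X z u) - (\<Sum>z\<in>T. coin_mean N (?X z))\<bar> \<ge> t} \<le>
      2 * exp (- 2 * t\<^sup>2 / (\<Sum>z\<in>T. (1 - - 1)\<^sup>2))"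
    by (rule Hoeffding_ineq_abs_ge[OF assms(4)]) (use finT N(3) in \<open>auto simp: card_gt_0_iff\<close>)
  then show ?thesis by (simp add: E)
qed

lemma prob_climb_ge:
  assumes N: "finite N" "S \<subseteq> N" and xy: "x < y" and \<rho>: "\<rho> > 0"
  shows "coin_prob N {u. \<not> \<bar>real_of_int (climb S u x y)\<bar> \<le> \<rho> * sqrt (real (y - x))} \<le> 2 * exp (- \<rho>\<^sup>2 / 2)"
proof -
  define T where "T = S \<inter> {x..<y}"
  have cl: "real_of_int (climb S u x y) = (\<Sum>z\<in>T. if u z then 1 else - 1)" for u
    unfolding climb_def T_def of_int_sum by (rule sum.mono_neutral_cong_right) auto
  have t: "\<rho> * sqrt (real (y - x)) \<ge> 0" using \<rho> by simp
  show ?thesis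
  proof (cases "T = {}")
    case True
    then show ?thesis using t by (simp add: cl)
  next
    case False
    have "coin_prob N {u. \<not> \<bar>real_of_int (climb S u x y)\<bar> \<le> \<rho> * sqrt (real (y - x))} \<le>
      coin_prob N {u. \<bar>\<Sum>z\<in>T. if u z then 1 else - 1\<bar> \<ge> \<rho> * sqrt (real (y - x))}"
      by (intro measure_pmf.finite_measure_mono) (auto simp: cl)
    also have "\<dots> \<le> 2 * exp (- (\<rho> * sqrt (real (y - x)))\<^sup>2 / (2 * real (card T)))"
      by (rule coins_Hoeffding) (use N False t in \<open>auto simp: T_def\<close>)
    also have "\<dots> \<le> 2 * exp (- \<rho>\<^sup>2 / 2)"
    proof -
      have "card T > 0" using False by (simp add: card_gt_0_iff T_def)
      moreover have "card T \<le> y - x"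
        using card_mono[of "{x..<y}" T] by (simp add: T_def)
      ultimately have "\<rho>\<^sup>2 * real (card T) \<le> \<rho>\<^sup>2 * real (y - x)" "card T > 0"
        by (auto intro!: mult_left_mono)
      then have "\<rho>\<^sup>2 / 2 \<le> (\<rho> * sqrt (real (y - x)))\<^sup>2 / (2 * real (card T))"
        by (simp add: power_mult_distrib divide_simps)
      then show ?thesis by simp
    qed
    finally show ?thesis .
  qed
qed

lemma prob_not_tame:
  assumes N: "finite N" "S \<subseteq> N" and \<rho>: "\<rho> > 0" and se: "s < e"
  shows "coin_prob N {u. \<not> tame \<rho> S s e u} \<le> 2 * real (e - s + 1)^2 * exp (- \<rho>\<^sup>2 / 2)"
proof -
  let ?K = "{(x, y) \<in> {s..e} \<times> {s..e}. x < y}"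
  let ?E = "\<lambda>k. {u. \<not> \<bar>real_of_int (climb S u (fst k) (snd k))\<bar> \<le> \<rho> * sqrt (real (snd k - fst k))}"
  have fin: "finite ?K" by (rule finite_subset[of _ "{s..e} \<times> {s..e}"]) auto
  have "card ?K \<le> card ({s..e} \<times> {s..e})" by (rule card_mono) auto
  also have "\<dots> = (e - s + 1)^2" using se by (simp add: card_cartesian_product power2_eq_square Suc_diff_le)
  finally have cK: "real (card ?K) \<le> real (e - s + 1)^2" unfolding of_nat_power[symmetric] by (rule of_nat_mono)
  have "coin_prob N {u. \<not> tame \<rho> S s e u} \<le> coin_prob N (\<Union>k\<in>?K. ?E k)"
  proof (intro measure_pmf.finite_measure_mono subsetI)
    fix u assume "u \<in> {u. \<not> tame \<rho> S s e u}"
    then obtain x y where "s \<le> x" "x < y" "y \<le> e" "u \<in> ?E (x, y)"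
      unfolding tame_def by auto
    then show "u \<in> (\<Union>k\<in>?K. ?E k)" by (intro UN_I[of "(x, y)"]) auto
  qed auto
  also have "\<dots> \<le> (\<Sum>k\<in>?K. coin_prob N (?E k))"
    by (rule measure_pmf.finite_measure_subadditive_finite) (use fin in auto)
  also have "\<dots> \<le> (\<Sum>k\<in>?K. 2 * exp (- \<rho>\<^sup>2 / 2))"
    by (intro sum_mono prob_climb_ge[OF N _ \<rho>]) auto
  also have "\<dots> = real (card ?K) * (2 * exp (- \<rho>\<^sup>2 / 2))" by simp
  also have "\<dots> \<le> real (e - s + 1)^2 * (2 * exp (- \<rho>\<^sup>2 / 2))"
    by (intro mult_right_mono cK) auto
  finally show ?thesis by simp
qed

lemma card_block_trivial: "real (card (block_set R B {s..<e} u)) \<le> real (e - s) ^ 4"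
proof -
  have "card (block_set R B {s..<e} u) \<le> card (({s..<e} \<times> {s..<e}) \<times> ({s..<e} \<times> {s..<e}))"
    by (rule card_mono) (auto simp: block_set_def pairs_def)
  also have "\<dots> = (e - s) ^ 4" by (simp add: card_cartesian_product power4_eq_xxxx)
  finally show ?thesis unfolding of_nat_power[symmetric] by (rule of_nat_mono)
qed

text \<open>Hoeffding's inequality needs bounded variables, so the count is cut off at
  \<open>D\<close>. Only untame orientations are affected, and on them the trivial bound by the
  fourth power of the block length suffices; the union bound over subintervals for both colours
  supplies the other two powers and the 4.\<close>

lemma expectation_truncated_block:
  assumes N: "finite N" "R \<subseteq> N" "B \<subseteq> N" "R \<inter> B = {}" and \<rho>: "\<rho> > 0" and se: "s < e"
    and D: "2 * \<rho>\<^sup>2 * real (e - s) * (ln (real (e - s)) + 1) \<le> D"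
  shows "coin_mean N (\<lambda>u. real (card (block_set R B {s..<e} u)))
      - 4 * real (e - s + 1) ^ 6 * exp (- \<rho>\<^sup>2 / 2) \<le>
    coin_mean N (\<lambda>u. min (real (card (block_set R B {s..<e} u))) D)"
proof -
  let ?X = "\<lambda>u. real (card (block_set R B {s..<e} u))"
  let ?bad = "{u. \<not> tame \<rho> R s e u} \<union> {u. \<not> tame \<rho> B s e u}"
  note int = integrable_measure_pmf_finite[OF finite_set_coins[OF N(1)]]
  have "coin_mean N ?X \<le>
      coin_mean N (\<lambda>u. min (?X u) D + real (e - s) ^ 4 * indicator ?bad u)"
  proof (rule integral_mono[OF int int])
    fix u
    show "?X u \<le> min (?X u) D + real (e - s) ^ 4 * indicator ?bad u"
    proof (cases "u \<in> ?bad")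
      case True
      have D0: "0 \<le> D"
      proof -
        have "0 \<le> ln (real (e - s))" using se by simp
        then have "0 \<le> 2 * \<rho>\<^sup>2 * real (e - s) * (ln (real (e - s)) + 1)" by simp
        then show ?thesis using D by linarith
      qed
      have "?X u \<le> real (e - s) ^ 4" by (rule card_block_trivial)
      then have "?X u \<le> min (?X u) D + real (e - s) ^ 4"
        using D0 by linarith
      then show ?thesis using True by simp
    next
      case False
      then have "?X u \<le> 2 * \<rho>\<^sup>2 * real (e - s) * (ln (real (e - s)) + 1)"
        using \<rho> se N(4) by (intro card_block_le) auto
      then show ?thesis using D False by simp
    qed
  qed
  also have "\<dots> = coin_mean N (\<lambda>u. min (?X u) D) + real (e - s) ^ 4 * coin_prob N ?bad"
    by (subst Bochner_Integration.integral_add[OF int int]) simp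
  also have "real (e - s) ^ 4 * coin_prob N ?bad \<le>
     real (e - s + 1) ^ 4 * (4 * real (e - s + 1)^2 * exp (- \<rho>\<^sup>2 / 2))"
  proof (intro mult_mono power_mono)
    have "coin_prob N ?bad \<le> coin_prob N {u. \<not> tame \<rho> R s e u} + coin_prob N {u. \<not> tame \<rho> B s e u}"
      by (rule measure_Un_le) auto
    then show "coin_prob N ?bad \<le> 4 * real (e - s + 1)^2 * exp (- \<rho>\<^sup>2 / 2)"
      using prob_not_tame[OF N(1,2) \<rho> se] prob_not_tame[OF N(1,3) \<rho> se] by linarith
  qed auto
  also have "real (e - s + 1) ^ 4 * (4 * real (e - s + 1)^2 * exp (- \<rho>\<^sup>2 / 2)) = 4 * real (e - s + 1) ^ 6 * exp (- \<rho>\<^sup>2 / 2)"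
    by (simp add: power_add[symmetric] mult.assoc[symmetric])
  finally show ?thesis by simp
qed

text \<open>Truncation only lowers the counts, so a lower tail for the truncated sum is enough. Its
  summands are independent because each reads only the coins of its own block.\<close>

lemma blocks_lower_tail:
  assumes N: "finite N" and L: "finite L" "L \<noteq> {}" and I: "\<And>i. i \<in> L \<Longrightarrow> {s i..<e i} \<subseteq> N" "disjoint_family_on (\<lambda>i. {s i..<e i}) L"
    and D: "D > 0" and t: "t \<ge> 0"
    and E: "\<And>i. i \<in> L \<Longrightarrow> \<mu> \<le> coin_mean N (\<lambda>u. min (real (card (block_set R B {s i..<e i} u))) D)"
  shows "coin_prob N {u. (\<Sum>i\<in>L. real (card (block_set R B {s i..<e i} u))) \<le> real (card L) * \<mu> - t} \<le>
    exp (- 2 * t\<^sup>2 / (real (card L) * D\<^sup>2))"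
proof -
  let ?X = "\<lambda>i u. min (real (card (block_set R B {s i..<e i} u))) D"
  let ?\<mu> = "\<Sum>i\<in>L. coin_mean N (?X i)"
  have restr: "block_set R B {s i..<e i} (restrict u {s i..<e i}) = block_set R B {s i..<e i} u" for i u
  proof -
    have "excursion S (restrict u {s i..<e i}) (fst p) (snd p) = excursion S u (fst p) (snd p)"
      if "p \<in> pairs (S \<inter> {s i..<e i})" for S p
      by (rule excursion_cong) (use that in \<open>auto simp: pairs_def\<close>)
    then show ?thesis unfolding block_set_def by (intro Collect_cong) auto
  qed
  have "prob_space.indep_vars (measure_pmf (coins N)) (\<lambda>_. borel) (\<lambda>i u. ?X i (restrict u {s i..<e i})) L"
    by (rule indep_vars_coins[OF N]) (use I in auto)
  then have ind: "prob_space.indep_vars (measure_pmf (coins N)) (\<lambda>_. borel) ?X L" by (simp add: restr)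
  interpret Hoeffding_ineq "measure_pmf (coins N)" L ?X "\<lambda>_. 0" "\<lambda>_. D" ?\<mu>
  proof unfold_locales
    show "AE u in measure_pmf (coins N). ?X i u \<in> {0..D}" for i by (rule AE_I2) (use D in simp)
  qed (fact L(1), fact ind)
  have "real (card L) * \<mu> \<le> ?\<mu>"
    using sum_mono[of L "\<lambda>_. \<mu>", OF E] by simp
  then have "coin_prob N {u. (\<Sum>i\<in>L. real (card (block_set R B {s i..<e i} u))) \<le> real (card L) * \<mu> - t} \<le>
      coin_prob N {u \<in> space (measure_pmf (coins N)). (\<Sum>i\<in>L. ?X i u) \<le> ?\<mu> - t}"
  proof (intro measure_pmf.finite_measure_mono subsetI)
    fix u assume *: "real (card L) * \<mu> \<le> ?\<mu>"
      and u: "u \<in> {u. (\<Sum>i\<in>L. real (card (block_set R B {s i..<e i} u))) \<le> real (card L) * \<mu> - t}"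
    have "(\<Sum>i\<in>L. ?X i u) \<le> (\<Sum>i\<in>L. real (card (block_set R B {s i..<e i} u)))"
      by (intro sum_mono) auto
    then show "u \<in> {u \<in> space (measure_pmf (coins N)). (\<Sum>i\<in>L. ?X i u) \<le> ?\<mu> - t}" using * u by simp
  qed auto
  also have "\<dots> \<le> exp (- 2 * t\<^sup>2 / (\<Sum>i\<in>L. (D - 0)\<^sup>2))"
    by (rule Hoeffding_ineq_le[OF t]) (use D L in \<open>auto simp: card_gt_0_iff\<close>)
  finally show ?thesis by simp
qed

subsection \<open>Blocks of a balanced colouring\<close>

text \<open>With \<open>y \<le> 2 * n\<close> the interval \<open>{x..<y}\<close> never contains the
  point \<open>2 * n\<close>, whose colour is forced by parity. Only independent colours are
  concerned.\<close>

definition balanced :: "real \<Rightarrow> nat \<Rightarrow> nat \<Rightarrow> nat set \<Rightarrow> bool" where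
  "balanced \<eta> K n R \<longleftrightarrow> (\<forall>x y. 1 \<le> x \<and> x + K \<le> y \<and> y \<le> 2 * n \<longrightarrow>
     \<bar>real (card (R \<inter> {x..<y})) - real (y - x) / 2\<bar> \<le> \<eta> * real (y - x))"

lemma card_complement_interval:
  assumes "1 \<le> x" "x \<le> y" "y \<le> 2 * n" "B = {1..2 * n} - R"
  shows "real (card (B \<inter> {x..<y})) = real (y - x) - real (card (R \<inter> {x..<y}))"
proof -
  have "B \<inter> {x..<y} = {x..<y} - R \<inter> {x..<y}" using assms by auto
  then have "card (B \<inter> {x..<y}) = card {x..<y} - card (R \<inter> {x..<y})"
    by (simp only:) (rule card_Diff_subset, auto)
  moreover have "card (R \<inter> {x..<y}) \<le> card {x..<y}" by (rule card_mono) auto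
  ultimately show ?thesis by (simp add: of_nat_diff)
qed

lemma balanced_red:
  assumes "balanced \<eta> K n R" "1 \<le> x" "x + K \<le> y" "y \<le> 2 * n"
  shows "(1 / 2 - \<eta>) * real (y - x) \<le> real (card (R \<inter> {x..<y}))"
    "real (card (R \<inter> {x..<y})) \<le> (1 / 2 + \<eta>) * real (y - x)"
proof -
  have "\<bar>real (card (R \<inter> {x..<y})) - real (y - x) / 2\<bar> \<le> \<eta> * real (y - x)"
    using assms unfolding balanced_def by blast
  then show "(1 / 2 - \<eta>) * real (y - x) \<le> real (card (R \<inter> {x..<y}))"
    "real (card (R \<inter> {x..<y})) \<le> (1 / 2 + \<eta>) * real (y - x)"
    unfolding left_diff_distrib distrib_right by linarith+
qed

lemma balanced_blue:
  assumes "balanced \<eta> K n R" "1 \<le> x" "x + K \<le> y" "y \<le> 2 * n" "B = {1..2 * n} - R"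
  shows "(1 / 2 - \<eta>) * real (y - x) \<le> real (card (B \<inter> {x..<y}))"
proof -
  have "real (card (B \<inter> {x..<y})) = real (y - x) - real (card (R \<inter> {x..<y}))"
    by (rule card_complement_interval) (use assms in auto)
  then show ?thesis using balanced_red(2)[OF assms(1-4)] unfolding left_diff_distrib distrib_right by linarith
qed

text \<open>Here \<theta> bounds from below the ratio of blue to red points around the arc, and
  \<zeta> is the relative loss from having only \<open>g\<close> outside points on each side:
  \<open>m * unmatched g\<close> is at most the fraction \<zeta> of the main term of
  \<open>leaving m\<close>. The subtracted \<open>3 * arcp\<close> is the constant of
  \<open>leaving_lower\<close>; its sum over \<open>i\<close> stays bounded.\<close>

lemma arcp_leaving_lower:
  assumes m: "\<theta> * real (2 * i + 1) \<le> real m" and \<theta>: "0 \<le> \<theta>" and \<zeta>: "0 \<le> \<zeta>" "\<zeta> \<le> 1"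
    and g: "g > 0" "real m \<le> 4 * \<zeta>\<^sup>2 * real g"
  shows "sqrt \<theta> * (1 - \<zeta>) / pi * (1 / (real i + 1)) - 3 * arcp (Suc (2 * i)) \<le>
    arcp (Suc (2 * i)) * (leaving m - real m * unmatched g)"
proof -
  define s where "s = sqrt (8 / pi)"
  have s0: "0 \<le> s" by (simp add: s_def)
  have e: "s = 2 * sqrt (2 / pi)"
    unfolding s_def by (rule real_sqrt_unique) (auto simp: power_mult_distrib)
  have "sqrt (real m) \<le> sqrt (4 * \<zeta>\<^sup>2 * real g)" using g by simp
  also have "\<dots> = 2 * \<zeta> * sqrt (real g)" using \<zeta> by (simp add: real_sqrt_mult)
  finally have sm: "sqrt (real m) \<le> 2 * \<zeta> * sqrt (real g)" .
  have "real m * unmatched g \<le> real m * (sqrt (2 / pi) / sqrt (real g))"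
    by (intro mult_left_mono unmatched_upper g) auto
  also have "\<dots> = (sqrt (real m) * sqrt (2 / pi)) * (sqrt (real m) / sqrt (real g))" by simp
  also have "\<dots> \<le> (sqrt (real m) * sqrt (2 / pi)) * (2 * \<zeta>)"
    using sm g by (intro mult_left_mono) (auto simp: divide_simps)
  also have "\<dots> = s * sqrt (real m) * \<zeta>" by (simp add: e)
  finally have "s * sqrt (real m) * (1 - \<zeta>) - 3 \<le> leaving m - real m * unmatched g"
    using leaving_lower[of m] unfolding s_def[symmetric] right_diff_distrib by linarith
  moreover have "s * (sqrt \<theta> * sqrt (2 * real i + 1)) * (1 - \<zeta>) \<le> s * sqrt (real m) * (1 - \<zeta>)"
  proof (intro mult_right_mono mult_left_mono)
    have "sqrt (\<theta> * (2 * real i + 1)) \<le> sqrt (real m)" using m by (simp add: add.commute)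
    then show "sqrt \<theta> * sqrt (2 * real i + 1) \<le> sqrt (real m)" by (simp add: real_sqrt_mult)
  qed (use s0 \<zeta> in auto)
  ultimately have "s * (sqrt \<theta> * sqrt (2 * real i + 1)) * (1 - \<zeta>) - 3 \<le> leaving m - real m * unmatched g"
    by linarith
  then have "arcp (Suc (2 * i)) * (s * (sqrt \<theta> * sqrt (2 * real i + 1)) * (1 - \<zeta>) - 3) \<le>
      arcp (Suc (2 * i)) * (leaving m - real m * unmatched g)"
    by (intro mult_left_mono) auto
  moreover have "sqrt \<theta> * (1 - \<zeta>) / pi * (1 / (real i + 1)) \<le>
      arcp (Suc (2 * i)) * (s * (sqrt \<theta> * sqrt (2 * real i + 1)) * (1 - \<zeta>))"
  proof -
    have "sqrt (2 / pi) \<le> cbin i * sqrt (2 * real i + 1)"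
      using cbin_lower[of i] by (simp add: divide_simps)
    then have "sqrt (2 / pi) * s \<le> cbin i * sqrt (2 * real i + 1) * s"
      by (intro mult_right_mono s0)
    moreover have "sqrt (2 / pi) * s = 4 / pi"
    proof -
      have "sqrt (2 / pi) * s = 2 * (sqrt (2 / pi) * sqrt (2 / pi))" unfolding e by (rule mult.left_commute)
      also have "\<dots> = 2 * (2 / pi)" by (subst real_sqrt_mult_self) simp
      finally show ?thesis by simp
    qed
    ultimately have "4 / pi \<le> cbin i * sqrt (2 * real i + 1) * s" by simp
    then have "(4 / pi) * (sqrt \<theta> * (1 - \<zeta>) / (4 * (real i + 1))) \<le>
        (cbin i * sqrt (2 * real i + 1) * s) * (sqrt \<theta> * (1 - \<zeta>) / (4 * (real i + 1)))"
      using \<zeta> \<theta> by (intro mult_right_mono) auto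
    also have "(4 / pi) * (sqrt \<theta> * (1 - \<zeta>) / (4 * (real i + 1))) = sqrt \<theta> * (1 - \<zeta>) / pi * (1 / (real i + 1))"
      by (simp add: divide_simps)
    also have "(cbin i * sqrt (2 * real i + 1) * s) * (sqrt \<theta> * (1 - \<zeta>) / (4 * (real i + 1))) =
        arcp (Suc (2 * i)) * (s * (sqrt \<theta> * sqrt (2 * real i + 1)) * (1 - \<zeta>))"
      by (simp add: arcp_odd)
    finally show ?thesis .
  qed
  ultimately show ?thesis unfolding right_diff_distrib by linarith
qed

lemma ln_le_sum_inverse: "K \<le> Suc M \<Longrightarrow> ln (real M + 2) - ln (real K + 1) \<le> (\<Sum>i=K..M. 1 / (real i + 1))"
proof (induction M rule: nat_induct)
  case 0
  then consider "K = 0" | "K = 1" by linarith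
  then show ?case by cases (use ln_le_minus_one[of 2] in auto)
next
  case (Suc M)
  show ?case
  proof (cases "K \<le> Suc M")
    case True
    have "ln ((real M + 3) / (real M + 2)) \<le> (real M + 3) / (real M + 2) - 1"
      by (intro ln_le_minus_one) auto
    also have "\<dots> = 1 / (real M + 2)" by (simp add: field_simps)
    finally have "ln (real M + 3) - ln (real M + 2) \<le> 1 / (real M + 2)" by (simp add: ln_div)
    then show ?thesis using Suc True by (simp add: add.commute)
  next
    case False
    then have "K = Suc (Suc M)" using Suc.prems by simp
    then show ?thesis by simp
  qed
qed

lemma sum_arcp_odd_le: "(\<Sum>i=K..M. arcp (Suc (2 * i))) \<le> 1 / 2"
proof -
  have "(\<Sum>i=K..M. arcp (Suc (2 * i))) = (\<Sum>d\<in>(\<lambda>i. 2 * i) ` {K..M}. arcp (Suc d))"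
    by (subst sum.reindex) (auto intro: inj_onI)
  also have "\<dots> \<le> (\<Sum>d<2 * M + 1. arcp (Suc d))"
    by (rule sum_mono2) auto
  also have "\<dots> \<le> 1 / 2"
    using sum_arcp[of "2 * M + 1"] unmatched_nonneg[of "2 * M + 1"] by linarith
  finally show ?thesis .
qed

text \<open>\<open>v\<close> is the contribution of one starting point \<open>a\<close>: for each
  \<open>i\<close> from \<open>K\<close> to \<open>M\<close> there is one red partner
  \<open>C a i\<close> with \<open>2 * i\<close> red points in between. The cut-off \<open>K\<close>
  makes each such arc long enough for balance to apply under it, and 3 / 2 is 3 times the bound in
  \<open>sum_arcp_odd_le\<close>.\<close>

lemma expectation_block_balanced:
  assumes R: "R \<subseteq> {1..2 * n}" "B = {1..2 * n} - R" "balanced \<eta> K n R"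
    and \<eta>: "0 < \<eta>" "\<eta> \<le> 1 / 4" and \<zeta>: "0 \<le> \<zeta>" "\<zeta> \<le> 1"
    and I: "1 \<le> s" "s + L \<le> 2 * n"
    and L: "K + 3 * L1 \<le> L" "K + 1 \<le> L1" "8 * M + 5 \<le> L1" "1 \<le> K" "1 \<le> M" "K \<le> M"
      "L1 \<ge> 4" "3 * real M \<le> \<zeta>\<^sup>2 * real (L1 div 4)"
  defines "\<theta> \<equiv> (1 / 2 - \<eta>) / (1 / 2 + \<eta>)"
  defines "v \<equiv> sqrt \<theta> * (1 - \<zeta>) / pi * (ln (real M + 2) - ln (real K + 1)) - 3 / 2"
  assumes v: "0 \<le> v"
  shows "(1 / 2 - \<eta>) * (real L - 3 * real L1) * v \<le>
    coin_mean {1..2 * n} (\<lambda>u. real (card (block_set R B {s..<s + L} u)))"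
proof -
  let ?I = "{s..<s + L}"
  \<comment> \<open>One margin \<open>L1\<close> on the left provides blue partners. On the right
    two are kept: the arc closes within the first, and the second provides blue partners beyond
    it.\<close>
  define A where "A = R \<inter> {s + L1..<s + L - 2 * L1}"
  \<comment> \<open>By \<eta> \<le> 1 / 4 each colour has at least a quarter of any long enough
    interval, so each margin contains at least \<open>g\<close> blue points.\<close>
  define g where "g = L1 div 4"
  have \<theta>0: "0 \<le> \<theta>" using \<eta> by (simp add: \<theta>_def)
  have disj: "R \<inter> B = {}" using R(2) by auto
  have quarter: "real y / 4 \<le> (1 / 2 - \<eta>) * real y" for y
    using mult_right_mono[of "1 / 4" "1 / 2 - \<eta>" "real y"] \<eta>(2) by simp
  have gge: "g > 0" "real g \<le> real L1 / 4" using L(7) by (auto simp: g_def)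
  have exc: "\<exists>c. c \<in> R \<and> a < c \<and> c < a + L1 \<and> card (R \<inter> {a<..<c}) = 2 * i"
    if a: "a \<in> A" and i: "i \<in> {K..M}" for a i
  proof -
    define R' where "R' = R \<inter> {a + 1..<a + L1}"
    have fin: "finite R'" by (simp add: R'_def)
    have "(1 / 2 - \<eta>) * real (a + L1 - (a + 1)) \<le> real (card R')"
      unfolding R'_def by (rule balanced_red[OF R(3)]) (use a L I in \<open>auto simp: A_def\<close>)
    moreover have "a + L1 - (a + 1) = L1 - 1" by simp
    ultimately have "real (L1 - 1) / 4 \<le> real (card R')" by (metis order_trans[OF quarter])
    then have "2 * M + 1 \<le> card R'" using L(3) by linarith
    then have "2 * i < card R'" using i by simp
    then have "2 * i \<in> (\<lambda>z. card (R' \<inter> {..<z})) ` R'"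
      using bij_betw_rank[OF fin] by (auto simp: bij_betw_def)
    then obtain c where c: "c \<in> R'" "card (R' \<inter> {..<c}) = 2 * i" by auto
    moreover have "R' \<inter> {..<c} = R \<inter> {a<..<c}" using c(1) by (auto simp: R'_def)
    ultimately show ?thesis by (auto simp: R'_def)
  qed
  then obtain C where C: "\<And>a i. a \<in> A \<Longrightarrow> i \<in> {K..M} \<Longrightarrow>
      C a i \<in> R \<and> a < C a i \<and> C a i < a + L1 \<and> card (R \<inter> {a<..<C a i}) = 2 * i"
    by metis
  let ?T = "\<lambda>p. arcp (gap R p) * (\<Sum>q\<in>{q \<in> pairs (B \<inter> ?I). crosses p q}. arcp (gap B q))"
  have arc_term: "sqrt \<theta> * (1 - \<zeta>) / pi * (1 / (real i + 1)) - 3 * arcp (Suc (2 * i)) \<le> ?T (a, C a i)"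
    if a: "a \<in> A" and i: "i \<in> {K..M}" for a i
  proof -
    define c where "c = C a i"
    have c: "c \<in> R" "a < c" "c < a + L1" "card (R \<inter> {a<..<c}) = 2 * i"
      using C[OF a i] by (auto simp: c_def)
    have a': "a \<in> R" "s + L1 \<le> a" "a < s + L - 2 * L1" using a by (auto simp: A_def)
    have ai: "1 \<le> a" "c < s + L - L1" "c + 1 \<le> 2 * n" using a' c I L by auto
    define m where "m = card (B \<inter> {a<..<c})"
    have gp: "gap R (a, c) = Suc (2 * i)" using c by (simp add: gap_def)
    \<comment> \<open>Dropping \<open>a\<close> and keeping \<open>c\<close> gives exactly
      \<open>2 * i + 1\<close> red points and the same blue points as under the arc.\<close>
    have "R \<inter> {a + 1..<c + 1} = insert c (R \<inter> {a<..<c})" using c by auto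
    then have cR: "card (R \<inter> {a + 1..<c + 1}) = 2 * i + 1" using c(4) by simp
    have "B \<inter> {a + 1..<c + 1} = B \<inter> {a<..<c}"
      using c(1) disj by (auto simp: order_less_le)
    then have mB: "m = card (B \<inter> {a + 1..<c + 1})" by (simp add: m_def)
    have "card (R \<inter> {a + 1..<c + 1}) \<le> card {a + 1..<c + 1}" by (rule card_mono) auto
    then have len: "2 * i + 1 \<le> c - a" unfolding cR by simp
    have ok: "1 \<le> a + 1" "a + 1 + K \<le> c + 1" "c + 1 \<le> 2 * n" using len i ai by auto
    have cd: "c + 1 - (a + 1) = c - a" by simp
    have up: "real (2 * i + 1) \<le> (1 / 2 + \<eta>) * real (c - a)"
      using balanced_red(2)[OF R(3) ok] unfolding cR cd .
    have lo: "(1 / 2 - \<eta>) * real (c - a) \<le> real (2 * i + 1)"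
      using balanced_red(1)[OF R(3) ok] unfolding cR cd .
    have lom: "(1 / 2 - \<eta>) * real (c - a) \<le> real m"
      using balanced_blue[OF R(3) ok R(2)] unfolding mB cd .
    have "\<theta> * real (2 * i + 1) \<le> \<theta> * ((1 / 2 + \<eta>) * real (c - a))"
      by (intro mult_left_mono up \<theta>0)
    also have "\<dots> = (1 / 2 - \<eta>) * real (c - a)" using \<eta> by (simp add: \<theta>_def)
    finally have m_ge: "\<theta> * real (2 * i + 1) \<le> real m" using lom by (rule order_trans)
    have "real (card (B \<inter> {a + 1..<c + 1})) = real (c + 1 - (a + 1)) - real (card (R \<inter> {a + 1..<c + 1}))"
      by (rule card_complement_interval[OF _ _ _ R(2)]) (use ok in auto)
    then have "real m \<le> real (c - a)" unfolding mB cd by linarith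
    also have "real (c - a) \<le> 4 * real (2 * i + 1)" using order_trans[OF quarter lo]
      by (simp only: pos_divide_le_eq mult.commute zero_less_numeral)
    also have "\<dots> \<le> 12 * real M" using i L(5) by simp
    also have "\<dots> \<le> 4 * \<zeta>\<^sup>2 * real g" using L(8) by (simp add: g_def)
    finally have m_le: "real m \<le> 4 * \<zeta>\<^sup>2 * real g" .
    have gq: "real g \<le> (1 / 2 - \<eta>) * real L1" by (rule order_trans[OF gge(2) quarter])
    have gL: "g \<le> card (B \<inter> {s..<a})"
    proof -
      have "(1 / 2 - \<eta>) * real (s + L1 - s) \<le> real (card (B \<inter> {s..<s + L1}))"
        by (rule balanced_blue[OF R(3) _ _ _ R(2)]) (use I L in auto)
      then have "real g \<le> real (card (B \<inter> {s..<s + L1}))"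
        unfolding diff_add_inverse by (rule order_trans[OF gq])
      also have "card (B \<inter> {s..<s + L1}) \<le> card (B \<inter> {s..<a})" using a' by (intro card_mono) auto
      finally show ?thesis by simp
    qed
    have gR: "g \<le> card (B \<inter> {c<..<s + L})"
    proof -
      have "(1 / 2 - \<eta>) * real (s + L - (s + L - L1)) \<le> real (card (B \<inter> {s + L - L1..<s + L}))"
        by (rule balanced_blue[OF R(3) _ _ _ R(2)]) (use I L in auto)
      moreover have "s + L - (s + L - L1) = L1" using L(1) by linarith
      ultimately have "real g \<le> real (card (B \<inter> {s + L - L1..<s + L}))"
        by (metis order_trans[OF gq])
      also have "card (B \<inter> {s + L - L1..<s + L}) \<le> card (B \<inter> {c<..<s + L})" using ai by (intro card_mono) auto
      finally show ?thesis by simp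
    qed
    have "leaving m - real m * unmatched g \<le> (\<Sum>q\<in>{q \<in> pairs (B \<inter> ?I). crosses (a, c) q}. arcp (gap B q))"
      unfolding m_def by (rule sum_arcp_crossing[OF refl]) (use a' c ai L disj gL gR in auto)
    then have "arcp (Suc (2 * i)) * (leaving m - real m * unmatched g) \<le> ?T (a, c)"
      unfolding gp by (intro mult_left_mono) auto
    moreover have "sqrt \<theta> * (1 - \<zeta>) / pi * (1 / (real i + 1)) - 3 * arcp (Suc (2 * i)) \<le>
        arcp (Suc (2 * i)) * (leaving m - real m * unmatched g)"
      by (rule arcp_leaving_lower[OF m_ge \<theta>0 \<zeta> gge(1) m_le])
    ultimately show ?thesis unfolding c_def by linarith
  qed
  have "v \<le> (\<Sum>i=K..M. sqrt \<theta> * (1 - \<zeta>) / pi * (1 / (real i + 1)) - 3 * arcp (Suc (2 * i)))"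
  proof -
    have "sqrt \<theta> * (1 - \<zeta>) / pi * (ln (real M + 2) - ln (real K + 1)) \<le>
        sqrt \<theta> * (1 - \<zeta>) / pi * (\<Sum>i=K..M. 1 / (real i + 1))"
      by (intro mult_left_mono ln_le_sum_inverse) (use L \<theta>0 \<zeta> in auto)
    then show ?thesis
      using sum_arcp_odd_le[of K M] unfolding sum_subtractf sum_distrib_left[symmetric] v_def by linarith
  qed
  note v_le = this
  have "real (card A) \<ge> (1 / 2 - \<eta>) * real (s + L - 2 * L1 - (s + L1))"
    unfolding A_def by (rule balanced_red[OF R(3)]) (use I L in auto)
  moreover have "real (s + L - 2 * L1 - (s + L1)) = real L - 3 * real L1" using L(1) by simp
  ultimately have "(1 / 2 - \<eta>) * (real L - 3 * real L1) * v \<le> real (card A) * v"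
    using v by (intro mult_right_mono) auto
  also have "\<dots> = (\<Sum>a\<in>A. v)" by simp
  also have "\<dots> \<le> (\<Sum>a\<in>A. \<Sum>i=K..M. ?T (a, C a i))"
    by (intro sum_mono order_trans[OF v_le] arc_term)
  also have "\<dots> = (\<Sum>x\<in>A \<times> {K..M}. ?T (fst x, C (fst x) (snd x)))"
    by (simp add: sum.cartesian_product case_prod_beta)
  also have "\<dots> = (\<Sum>p\<in>(\<lambda>x. (fst x, C (fst x) (snd x))) ` (A \<times> {K..M}). ?T p)"
  proof (rule sum.reindex_cong[symmetric, of "\<lambda>x. (fst x, C (fst x) (snd x))"])
    show "inj_on (\<lambda>x. (fst x, C (fst x) (snd x))) (A \<times> {K..M})"
    proof (rule inj_onI)
      fix x y assume xy: "x \<in> A \<times> {K..M}" "y \<in> A \<times> {K..M}"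
        "(fst x, C (fst x) (snd x)) = (fst y, C (fst y) (snd y))"
      have "fst x \<in> A" "snd x \<in> {K..M}" "fst y \<in> A" "snd y \<in> {K..M}"
        using xy(1,2) by (simp_all only: mem_Times_iff)
      then have "card (R \<inter> {fst x<..<C (fst x) (snd x)}) = 2 * snd x" "card (R \<inter> {fst y<..<C (fst y) (snd y)}) = 2 * snd y"
        using C by blast+
      moreover have "fst x = fst y" "C (fst x) (snd x) = C (fst y) (snd y)" using xy(3) by blast+
      ultimately have "2 * snd x = 2 * snd y" by metis
      then show "x = y" using xy(3) by (simp add: prod_eq_iff)
    qed
  qed auto
  also have "\<dots> \<le> (\<Sum>p\<in>pairs (R \<inter> ?I). ?T p)"
  proof (rule sum_mono2)
    show "finite (pairs (R \<inter> ?I))" by (simp add: finite_pairs)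
    show "(\<lambda>x. (fst x, C (fst x) (snd x))) ` (A \<times> {K..M}) \<subseteq> pairs (R \<inter> ?I)"
    proof (rule image_subsetI)
      fix x assume "x \<in> A \<times> {K..M}"
      then have x: "fst x \<in> A" "snd x \<in> {K..M}" by (simp_all only: mem_Times_iff)
      then have "fst x \<in> R" "s + L1 \<le> fst x" "fst x < s + L - 2 * L1" by (auto simp: A_def)
      then show "(fst x, C (fst x) (snd x)) \<in> pairs (R \<inter> ?I)"
        using C[OF x] L(1) by (simp add: pairs_def) linarith
    qed
    show "0 \<le> ?T p" for p by (intro mult_nonneg_nonneg sum_nonneg) auto
  qed
  also have "\<dots> \<le> coin_mean {1..2 * n} (\<lambda>u. real (card (block_set R B ?I u)))"
    by (rule expectation_block_lower) (use R disj in auto)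
  finally show ?thesis .
qed

subsection \<open>The random Catalan-pair graph\<close>

abbreviation (input) CP_prob :: "nat \<Rightarrow> (nat \<times> nat) set set \<Rightarrow> real" where
  "CP_prob n \<equiv> measure_pmf.prob (CP_arcs n)"

abbreviation (input) mean_edges :: "nat \<Rightarrow> real" where
  "mean_edges n \<equiv> measure_pmf.expectation (CP_arcs n) (\<lambda>M. real (CP_edges M))"

definition red :: "nat \<Rightarrow> (nat \<Rightarrow> bool) \<Rightarrow> nat set" where
  "red n c = {i \<in> {1..2 * n}. full_coloring n c i}"

definition blue :: "nat \<Rightarrow> (nat \<Rightarrow> bool) \<Rightarrow> nat set" where
  "blue n c = {i \<in> {1..2 * n}. \<not> full_coloring n c i}"

definition arcs_given :: "nat set \<Rightarrow> nat set \<Rightarrow> (nat \<times> nat) set pmf" where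
  "arcs_given R B = pmf_of_set (matchings R) \<bind> (\<lambda>M. pmf_of_set (matchings B) \<bind> (\<lambda>N. return_pmf (M \<union> N)))"

lemma CP_arcs_coins: "CP_arcs n = coins {1..2 * n - 1} \<bind> (\<lambda>c. arcs_given (red n c) (blue n c))"
  by (simp add: CP_arcs_def coins_def arcs_given_def red_def blue_def Let_def)

lemma blue_eq: "blue n c = {1..2 * n} - red n c"
  by (auto simp: red_def blue_def)

lemma card_red_even:
  assumes "n > 0"
  shows "even (card (red n c))"
proof -
  define S where "S = {j \<in> {1..2 * n - 1}. c j}"
  have "red n c = (if odd (card S) then insert (2 * n) S else S)"
  proof (rule set_eqI)
    fix i
    consider "i = 2 * n" | "i < 2 * n" | "i > 2 * n" by linarith
    then show "i \<in> red n c \<longleftrightarrow> i \<in> (if odd (card S) then insert (2 * n) S else S)"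
      by cases (use assms in \<open>auto simp: red_def S_def full_coloring_def\<close>)
  qed
  moreover have "2 * n \<notin> S" "finite S" using assms by (auto simp: S_def)
  ultimately show ?thesis by simp
qed

lemma red_blue_cards:
  assumes "n > 0"
  obtains k q where "card (red n c) = 2 * k" "card (blue n c) = 2 * q" "n = k + q"
proof -
  obtain k where k: "card (red n c) = 2 * k" using card_red_even[OF assms] by blast
  have "red n c \<subseteq> {1..2 * n}" by (auto simp: red_def)
  then have "card (red n c) \<le> 2 * n" "card (blue n c) = 2 * n - card (red n c)"
    using card_mono[of "{1..2 * n}" "red n c"] by (auto simp: blue_eq card_Diff_subset finite_subset)
  then have "card (blue n c) = 2 * (n - k)" "n = k + (n - k)" using k by auto
  then show ?thesis using that k by blast
qed

lemma finite_red_blue [simp]: "finite (red n c)" "finite (blue n c)"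
  by (auto simp: red_def blue_def)

lemma matchings_finite_nonempty:
  assumes "finite S" "card S = 2 * k"
  shows "finite (matchings S)" "matchings S \<noteq> {}"
proof -
  show "finite (matchings S)" by (rule finite_matchings[OF assms(1)])
  show "matchings S \<noteq> {}"
  proof
    assume "matchings S = {}"
    then have "card (matchings S) = 0" by (simp only: card.empty)
    then show False using matchings_nonempty[OF assms] by linarith
  qed
qed

section \<open>Expectations under \<open>CP_arcs\<close> as averages over colourings and
  matchings\<close>

lemma expectation_bind_uniform:
  fixes h :: "'b \<Rightarrow> real"
  assumes "A \<noteq> {}" "finite A" "\<And>x. x \<in> A \<Longrightarrow> finite (set_pmf (f x))"
  shows "measure_pmf.expectation (pmf_of_set A \<bind> f) h = (\<Sum>a\<in>A. measure_pmf.expectation (f a) h) / real (card A)"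
  by (subst pmf_expectation_bind_pmf_of_set) (use assms in \<open>auto simp: sum_distrib_left divide_inverse mult.commute\<close>)

lemma finite_set_arcs_given:
  assumes "finite R" "card R = 2 * k" "finite B" "card B = 2 * q"
  shows "finite (set_pmf (arcs_given R B))"
  using matchings_finite_nonempty[OF assms(1,2)] matchings_finite_nonempty[OF assms(3,4)]
  by (simp add: arcs_given_def)

lemma expectation_arcs_given:
  fixes h :: "(nat \<times> nat) set \<Rightarrow> real"
  assumes "finite R" "card R = 2 * k" "finite B" "card B = 2 * q"
  shows "measure_pmf.expectation (arcs_given R B) h =
    (\<Sum>M\<in>matchings R. \<Sum>N\<in>matchings B. h (M \<union> N)) / (real (card (matchings R)) * real (card (matchings B)))"
proof -
  note R = matchings_finite_nonempty[OF assms(1,2)] and B = matchings_finite_nonempty[OF assms(3,4)]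
  have inner: "measure_pmf.expectation (pmf_of_set (matchings B) \<bind> (\<lambda>N. return_pmf (M \<union> N))) h =
      (\<Sum>N\<in>matchings B. h (M \<union> N)) / real (card (matchings B))" for M
    by (subst expectation_bind_uniform[OF B(2,1)]) simp_all
  have "measure_pmf.expectation (arcs_given R B) h =
      (\<Sum>M\<in>matchings R. (\<Sum>N\<in>matchings B. h (M \<union> N)) / real (card (matchings B))) / real (card (matchings R))"
    unfolding arcs_given_def using R B by (subst expectation_bind_uniform) (simp_all add: inner)
  then show ?thesis by (simp add: sum_divide_distrib[symmetric] mult.commute)
qed

lemma finite_set_arcs_given_red_blue:
  assumes "n > 0"
  shows "finite (set_pmf (arcs_given (red n c) (blue n c)))"
proof -
  obtain k q where "card (red n c) = 2 * k" "card (blue n c) = 2 * q"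
    using red_blue_cards[OF assms] .
  then show ?thesis by (intro finite_set_arcs_given) auto
qed

lemma expectation_CP_arcs:
  fixes h :: "(nat \<times> nat) set \<Rightarrow> real"
  assumes "n > 0"
  shows "measure_pmf.expectation (CP_arcs n) h =
    coin_mean {1..2 * n - 1} (\<lambda>c. measure_pmf.expectation (arcs_given (red n c) (blue n c)) h)"
proof -
  have A: "PiE {1..2 * n - 1} (\<lambda>_. UNIV :: bool set) \<noteq> {}" "finite (PiE {1..2 * n - 1} (\<lambda>_. UNIV :: bool set))"
    by (auto simp: PiE_eq_empty_iff finite_PiE)
  show ?thesis
    unfolding CP_arcs_coins coins_def
    by (subst expectation_bind_uniform[OF A finite_set_arcs_given_red_blue[OF assms]])
      (rule integral_pmf_of_set[OF A, symmetric])
qed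

lemma finite_set_CP_arcs: "n > 0 \<Longrightarrow> finite (set_pmf (CP_arcs n))"
  unfolding CP_arcs_coins using finite_set_arcs_given_red_blue finite_set_coins by simp

lemma expectation_edges_upper:
  assumes "n > 0"
  shows "mean_edges n \<le> real n * ln (real n) / pi + 100 * real n"
proof -
  let ?b = "real n * ln (real n) / pi + 100 * real n"
  have "measure_pmf.expectation (arcs_given (red n c) (blue n c)) (\<lambda>M. real (CP_edges M)) \<le> ?b" for c
  proof -
    obtain k q where kq: "card (red n c) = 2 * k" "card (blue n c) = 2 * q" "n = k + q"
      using red_blue_cards[OF assms] .
    have disj: "red n c \<inter> blue n c = {}" by (auto simp: blue_eq)
    let ?N = "real (card (matchings (red n c))) * real (card (matchings (blue n c)))"
    have "(\<Sum>M\<in>matchings (red n c). \<Sum>N\<in>matchings (blue n c). real (CP_edges (M \<union> N))) \<le> ?N * ?b"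
      by (rule sum_edges_upper) (use kq disj assms in auto)
    moreover have "?N > 0"
      using matchings_nonempty[OF finite_red_blue(1) kq(1)] matchings_nonempty[OF finite_red_blue(2) kq(2)]
      by (intro mult_pos_pos)
    ultimately show ?thesis
      by (subst expectation_arcs_given[OF finite_red_blue(1) kq(1) finite_red_blue(2) kq(2)])
        (simp only: pos_divide_le_eq mult.commute)
  qed
  then have "mean_edges n \<le> coin_mean {1..2 * n - 1} (\<lambda>_. ?b)"
    unfolding expectation_CP_arcs[OF assms]
    by (intro integral_mono integrable_measure_pmf_finite finite_set_coins) auto
  then show ?thesis by simp
qed

text \<open>A crude bound is enough: any fixed power of n is later beaten by the tail for fair
  coins.\<close>

lemma catalan_lower: "k \<le> n \<Longrightarrow> 4 ^ k \<le> catalan k * (2 * (real n + 1)^2)"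
proof -
  assume "k \<le> n"
  have "1 / 2 \<le> sqrt (2 / pi)"
    by (rule real_le_rsqrt) (use pi_less_4 in \<open>simp add: power2_eq_square divide_simps\<close>)
  have "sqrt (2 * real k + 1) \<le> real k + 1"
    by (rule real_le_lsqrt) (auto simp: power2_eq_square algebra_simps)
  then have "1 / 2 / (real k + 1) \<le> sqrt (2 / pi) / sqrt (2 * real k + 1)"
    using \<open>1 / 2 \<le> sqrt (2 / pi)\<close> by (intro frac_le) auto
  also have "\<dots> \<le> cbin k" by (rule cbin_lower)
  finally have "1 \<le> cbin k / (real k + 1) * (2 * (real k + 1)^2)"
    by (simp add: divide_simps power2_eq_square mult_ac)
  also have "\<dots> \<le> cbin k / (real k + 1) * (2 * (real n + 1)^2)"
    using \<open>k \<le> n\<close> by (intro mult_left_mono power_mono) (auto simp: less_imp_le)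
  finally have "4 ^ k * 1 \<le> 4 ^ k * (cbin k / (real k + 1) * (2 * (real n + 1)^2))"
    by (intro mult_left_mono) auto
  then show ?thesis by (simp add: catalan_cbin add.commute)
qed

text \<open>Orientations coming from a pair of matchings are a polynomial fraction of all orientations.\<close>
lemma prob_arcs_given_le_coins:
  assumes R: "R \<subseteq> {1..2 * n}" "B = {1..2 * n} - R" "card R = 2 * k" "card B = 2 * q" "n = k + q"
    and P: "\<And>M N u. catalan_matching R M \<Longrightarrow> catalan_matching B N \<Longrightarrow> M \<union> N \<in> Ev \<Longrightarrow>
      (\<And>z. z \<in> R \<Longrightarrow> u z \<longleftrightarrow> z \<in> fst ` M) \<Longrightarrow> (\<And>z. z \<in> B \<Longrightarrow> u z \<longleftrightarrow> z \<in> fst ` N) \<Longrightarrow> u \<in> F"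
  shows "measure_pmf.prob (arcs_given R B) Ev \<le> 4 * (real n + 1)^4 * coin_prob {1..2 * n} F"
proof -
  have fin: "finite R" "finite B" using R by (auto intro: finite_subset)
  have disj: "R \<inter> B = {}" "R \<union> B = {1..2 * n}" using R by auto
  let ?X = "{(M, N) \<in> matchings R \<times> matchings B. M \<union> N \<in> Ev}"
  let ?U = "PiE {1..2 * n} (\<lambda>_. UNIV :: bool set)"
  have finX: "finite (matchings R \<times> matchings B)" using finite_matchings fin by auto
  have "(\<Sum>M\<in>matchings R. \<Sum>N\<in>matchings B. indicator Ev (M \<union> N)) = (\<Sum>x\<in>matchings R \<times> matchings B. of_bool (fst x \<union> snd x \<in> Ev))"
    by (simp add: sum.cartesian_product case_prod_beta indicator_def of_bool_def)
  also have "\<dots> = real (card {x \<in> matchings R \<times> matchings B. fst x \<union> snd x \<in> Ev})"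
    by (rule sum_of_bool_card[OF finX])
  also have "{x \<in> matchings R \<times> matchings B. fst x \<union> snd x \<in> Ev} = ?X" by auto
  finally have sumX: "(\<Sum>M\<in>matchings R. \<Sum>N\<in>matchings B. indicator Ev (M \<union> N)) = real (card ?X)" .
  \<comment> \<open>One orientation of all points records both matchings, since the openers of each
    lie in its own colour class.\<close>
  let ?f = "\<lambda>(M, N). restrict (\<lambda>z. z \<in> fst ` M \<union> fst ` N) {1..2 * n}"
  have op: "z \<in> fst ` M \<union> fst ` N \<longleftrightarrow> z \<in> fst ` M" if "catalan_matching R M" "catalan_matching B N" "z \<in> R" for M N z
    using matching_arcD(2)[OF that(2)] that(3) disj by blast
  have op': "z \<in> fst ` M \<union> fst ` N \<longleftrightarrow> z \<in> fst ` N" if "catalan_matching R M" "catalan_matching B N" "z \<in> B" for M N z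
    using matching_arcD(2)[OF that(1)] that(3) disj by blast
  have "card ?X \<le> card (?U \<inter> F)"
  proof (rule card_inj_on_le[of ?f])
    show "inj_on ?f ?X"
    proof (rule inj_onI)
      fix x y assume x: "x \<in> ?X" and y: "y \<in> ?X" and eq: "?f x = ?f y"
      obtain M N M' N' where xy: "x = (M, N)" "y = (M', N')" by (cases x, cases y)
      have m: "catalan_matching R M" "catalan_matching B N" "catalan_matching R M'" "catalan_matching B N'"
        using x y xy by auto
      have e: "z \<in> fst ` M \<union> fst ` N \<longleftrightarrow> z \<in> fst ` M' \<union> fst ` N'" if "z \<in> {1..2 * n}" for z
        using fun_cong[OF eq, of z] that unfolding xy by simp
      have "z \<in> fst ` M \<longleftrightarrow> z \<in> fst ` M'" if "z \<in> R" for z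
        using e[of z] op[OF m(1,2) that] op[OF m(3,4) that] that R(1) by blast
      moreover have "fst ` M \<subseteq> R" "fst ` M' \<subseteq> R" using matching_arcD(2)[OF m(1)] matching_arcD(2)[OF m(3)] by blast+
      ultimately have "fst ` M = fst ` M'" by blast
      moreover have "z \<in> fst ` N \<longleftrightarrow> z \<in> fst ` N'" if "z \<in> B" for z
        using e[of z] op'[OF m(1,2) that] op'[OF m(3,4) that] that R(2) by blast
      moreover have "fst ` N \<subseteq> B" "fst ` N' \<subseteq> B" using matching_arcD(2)[OF m(2)] matching_arcD(2)[OF m(4)] by blast+
      ultimately have "fst ` M = fst ` M'" "fst ` N = fst ` N'" by blast+
      then show "x = y"
        using matching_eq_of_openers[OF fin(1) m(1,3)] matching_eq_of_openers[OF fin(2) m(2,4)] xy by simp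
    qed
    show "?f ` ?X \<subseteq> ?U \<inter> F"
    proof (rule image_subsetI)
      fix x assume x: "x \<in> ?X"
      obtain M N where xy: "x = (M, N)" by (cases x)
      have m: "catalan_matching R M" "catalan_matching B N" "M \<union> N \<in> Ev" using x xy by auto
      have "?f x \<in> F" unfolding xy prod.case
      proof (rule P[OF m])
        show "restrict (\<lambda>z. z \<in> fst ` M \<union> fst ` N) {1..2 * n} z \<longleftrightarrow> z \<in> fst ` M" if "z \<in> R" for z
          using op[OF m(1,2) that] that R(1) by (metis restrict_apply' subsetD)
        show "restrict (\<lambda>z. z \<in> fst ` M \<union> fst ` N) {1..2 * n} z \<longleftrightarrow> z \<in> fst ` N" if "z \<in> B" for z
          using op'[OF m(1,2) that] that R(2) by (metis restrict_apply' Diff_iff)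
      qed
      then show "?f x \<in> ?U \<inter> F" unfolding xy by simp
    qed
    show "finite (?U \<inter> F)" by (simp add: finite_PiE)
  qed
  moreover have "coin_prob {1..2 * n} F = real (card (?U \<inter> F)) / 4 ^ n"
    unfolding coins_def by (subst measure_pmf_of_set) (auto simp: PiE_eq_empty_iff finite_PiE card_PiE power_mult)
  ultimately have cX: "real (card ?X) \<le> 4 ^ n * coin_prob {1..2 * n} F" by simp
  let ?N = "real (card (matchings R)) * real (card (matchings B))"
  have N: "?N = catalan k * catalan q" using R fin by (simp add: card_matchings matching_count_def)
  have "(4 :: real) ^ n = 4 ^ k * 4 ^ q" using R(5) by (simp add: power_add)
  also have "\<dots> \<le> (catalan k * (2 * (real n + 1)^2)) * (catalan q * (2 * (real n + 1)^2))"
    using R(5) by (intro mult_mono catalan_lower) (auto simp: less_imp_le)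
  also have "\<dots> = ?N * (4 * (real n + 1)^4)" unfolding N by (simp add: power2_eq_square power4_eq_xxxx mult_ac)
  finally have four: "(4 :: real) ^ n \<le> ?N * (4 * (real n + 1)^4)" .
  have "measure_pmf.prob (arcs_given R B) Ev = measure_pmf.expectation (arcs_given R B) (indicator Ev)" by simp
  also have "\<dots> = real (card ?X) / ?N"
    unfolding expectation_arcs_given[OF fin(1) R(3) fin(2) R(4)] sumX ..
  also have "\<dots> \<le> (?N * (4 * (real n + 1)^4)) * coin_prob {1..2 * n} F / ?N"
    using cX mult_right_mono[OF four, of "coin_prob {1..2 * n} F"]
    by (intro divide_right_mono) auto
  also have "\<dots> = 4 * (real n + 1)^4 * coin_prob {1..2 * n} F"
    unfolding N by simp
  finally show ?thesis .
qed

text \<open>A union bound over at most 4 n^2 intervals. In terms of signs, the sum over an interval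
  is twice the number of red points minus the length, so the deviation doubles and Hoeffding gives
  the exponent 2 \<eta>^2 times the length.\<close>

lemma prob_not_balanced:
  assumes n: "n > 0" and \<eta>: "\<eta> > 0" and K: "K > 0"
  shows "coin_prob {1..2 * n - 1} {c. \<not> balanced \<eta> K n (red n c)} \<le> 8 * real n ^ 2 * exp (- 2 * \<eta>\<^sup>2 * real K)"
proof -
  let ?Q = "{(x, y) \<in> {1..2 * n} \<times> {1..2 * n}. x + K \<le> y}"
  let ?E = "\<lambda>p. {c :: nat \<Rightarrow> bool. \<bar>\<Sum>z\<in>{fst p..<snd p}. if c z then 1 else - 1 :: real\<bar> \<ge> 2 * \<eta> * real (snd p - fst p)}"
  have fin: "finite ?Q" by (rule finite_subset[of _ "{1..2 * n} \<times> {1..2 * n}"]) auto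
  have "card ?Q \<le> card ({1..2 * n} \<times> {1..2 * n})" by (rule card_mono) auto
  also have "\<dots> = 4 * n ^ 2" by (simp add: card_cartesian_product power2_eq_square)
  finally have "real (card ?Q) \<le> real (4 * n ^ 2)" by (rule of_nat_mono)
  then have cQ: "real (card ?Q) \<le> 4 * real n ^ 2" by simp
  have sub: "{c. \<not> balanced \<eta> K n (red n c)} \<subseteq> (\<Union>p\<in>?Q. ?E p)"
  proof
    fix c assume "c \<in> {c. \<not> balanced \<eta> K n (red n c)}"
    then obtain x y where xy: "1 \<le> x" "x + K \<le> y" "y \<le> 2 * n"
      and nb: "\<not> \<bar>real (card (red n c \<inter> {x..<y})) - real (y - x) / 2\<bar> \<le> \<eta> * real (y - x)"
      unfolding balanced_def by blast
    have eq: "red n c \<inter> {x..<y} = {z \<in> {x..<y}. c z}"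
      using xy by (auto simp: red_def full_coloring_def)
    have "(\<Sum>z\<in>{x..<y}. if c z then 1 else - 1 :: real) = (\<Sum>z\<in>{x..<y}. 2 * of_bool (c z) - 1)"
      by (intro sum.cong refl) auto
    also have "\<dots> = 2 * (\<Sum>z\<in>{x..<y}. of_bool (c z)) - real (y - x)"
      by (simp only: sum_subtractf sum_distrib_left[symmetric]) simp
    also have "(\<Sum>z\<in>{x..<y}. of_bool (c z)) = real (card (red n c \<inter> {x..<y}))"
      unfolding eq by (rule sum_of_bool_card) simp
    finally have "\<bar>\<Sum>z\<in>{x..<y}. if c z then 1 else - 1 :: real\<bar> \<ge> 2 * (\<eta> * real (y - x))"
      using nb by linarith
    then have "c \<in> ?E (x, y)" by (simp only: fst_conv snd_conv mem_Collect_eq mult.assoc)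
    then show "c \<in> (\<Union>p\<in>?Q. ?E p)" using xy by (intro UN_I[of "(x, y)"]) auto
  qed
  have "coin_prob {1..2 * n - 1} {c. \<not> balanced \<eta> K n (red n c)} \<le> coin_prob {1..2 * n - 1} (\<Union>p\<in>?Q. ?E p)"
    by (rule measure_pmf.finite_measure_mono[OF sub]) simp
  also have "\<dots> \<le> (\<Sum>p\<in>?Q. coin_prob {1..2 * n - 1} (?E p))"
    by (rule measure_pmf.finite_measure_subadditive_finite) (use fin in auto)
  also have "\<dots> \<le> (\<Sum>p\<in>?Q. 2 * exp (- 2 * \<eta>\<^sup>2 * real K))"
  proof (rule sum_mono)
    fix p assume "p \<in> ?Q"
    then have p: "1 \<le> fst p" "fst p + K \<le> snd p" "snd p \<le> 2 * n" by auto
    have "coin_prob {1..2 * n - 1} (?E p) \<le>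
        2 * exp (- (2 * \<eta> * real (snd p - fst p))\<^sup>2 / (2 * real (card {fst p..<snd p})))"
      by (rule coins_Hoeffding) (use p K \<eta> in auto)
    also have "(2 * \<eta> * real (snd p - fst p))\<^sup>2 / (2 * real (card {fst p..<snd p})) = 2 * \<eta>\<^sup>2 * real (snd p - fst p)"
      by (simp add: power2_eq_square)
    then have "- (2 * \<eta> * real (snd p - fst p))\<^sup>2 / (2 * real (card {fst p..<snd p})) = - (2 * \<eta>\<^sup>2 * real (snd p - fst p))"
      by simp
    also have "2 * exp (- (2 * \<eta>\<^sup>2 * real (snd p - fst p))) \<le> 2 * exp (- 2 * \<eta>\<^sup>2 * real K)"
    proof -
      have "2 * \<eta>\<^sup>2 * real K \<le> 2 * \<eta>\<^sup>2 * real (snd p - fst p)"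
        using p by (intro mult_left_mono of_nat_mono) auto
      then show ?thesis by simp
    qed
    finally show "coin_prob {1..2 * n - 1} (?E p) \<le> 2 * exp (- 2 * \<eta>\<^sup>2 * real K)" .
  qed
  also have "\<dots> = real (card ?Q) * (2 * exp (- 2 * \<eta>\<^sup>2 * real K))" by simp
  also have "\<dots> \<le> 4 * real n ^ 2 * (2 * exp (- 2 * \<eta>\<^sup>2 * real K))"
    by (intro mult_right_mono cQ) auto
  finally show ?thesis by simp
qed

subsection \<open>The lower tail\<close>

text \<open>The block length, the margin kept at both ends of a block, and the largest and smallest number
  of pairs inside the red arcs that are counted in a block. Each is \<open>n\<close> up to a power of the logarithm,
  or such a power, so that nothing is lost in \<open>ln n\<close>, while the number of blocks is large enough for
  Hoeffding's inequality to beat the polynomial factor of \<open>prob_arcs_given_le_coins\<close>.\<close>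
definition "block_length n = nat \<lfloor>real n / ln (real n) ^ 8\<rfloor>"
definition "block_margin n = nat \<lfloor>real n / ln (real n) ^ 9\<rfloor>"
definition "span_max n = nat \<lfloor>real n / ln (real n) ^ 11\<rfloor>"
definition "span_min n = nat \<lceil>ln (real n) ^ 2\<rceil>"
definition "block_count n = (2 * n - 1) div block_length n"

lemma nat_floor_bounds: "x \<ge> 0 \<Longrightarrow> x - 1 < real (nat \<lfloor>x\<rfloor>) \<and> real (nat \<lfloor>x\<rfloor>) \<le> x" for x :: real
  by (simp add: floor_less_iff)

lemma nat_ceiling_bounds: "x \<ge> 0 \<Longrightarrow> x \<le> real (nat \<lceil>x\<rceil>) \<and> real (nat \<lceil>x\<rceil>) < x + 1" for x :: real
  by (simp add: ceiling_less_iff) linarith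

lemma eventually_ln_ge: "eventually (\<lambda>n. ln (real n) \<ge> 1 \<and> n > 0) sequentially"
proof -
  have "eventually (\<lambda>n. ln (real n) \<ge> 1) sequentially" by real_asymp
  then show ?thesis using eventually_gt_at_top[of 0] by eventually_elim simp
qed

context
  fixes h :: real
  assumes h: "0 < h" "h \<le> 1 / 4"
begin

text \<open>One parameter \<open>h\<close> serves as the tolerance \<eta> of balance and as the
  truncation loss \<zeta>; \<open>loss\<close> is the resulting factor in
  \<open>expectation_block_balanced\<close>, and it tends to 1 as \<open>h\<close> tends to
  0.\<close>

definition "loss = sqrt ((1 / 2 - h) / (1 / 2 + h)) * (1 - h)"

lemma loss_pos: "loss > 0"
  using h by (simp add: loss_def)

definition "span_weight n = loss / pi * (ln (real (span_max n) + 2) - ln (real (span_min n) + 1)) - 3 / 2"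
text \<open>A lower bound for \<open>span_weight\<close> free of rounding, so that its asymptotics
  can be computed directly.\<close>

definition "span_weight_low n = loss / pi * (ln (real n / ln (real n) ^ 11) - ln (ln (real n) ^ 2 + 2)) - 3 / 2"
definition "block_mean n = (1 / 2 - h) * (real (block_length n) - 3 * real (block_margin n)) * span_weight n - 4 * real (block_length n + 1) ^ 6 * exp (- (ln (real n))\<^sup>2 / 2)"

text \<open>These are the size conditions of \<open>expectation_block_balanced\<close>. In the last
  one the ratio of margin to span is of order (ln n)^2, which eventually exceeds any multiple of 1 /
  h^2.\<close>

lemma eventually_block_parameters:
  "eventually (\<lambda>n. span_min n + 3 * block_margin n \<le> block_length n \<and> span_min n + 1 \<le> block_margin n \<and> 8 * span_max n + 5 \<le> block_margin n \<and> 1 \<le> span_min n \<and>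
     1 \<le> span_max n \<and> span_min n \<le> span_max n \<and> 4 \<le> block_margin n \<and> 3 * real (span_max n) \<le> h\<^sup>2 * real (block_margin n div 4)) sequentially"
proof -
  have e1: "eventually (\<lambda>n. ln (real n) ^ 2 + 1 + 3 * (real n / ln (real n) ^ 9) \<le> real n / ln (real n) ^ 8 - 1) sequentially"
    by real_asymp
  have e2: "eventually (\<lambda>n. ln (real n) ^ 2 + 2 \<le> real n / ln (real n) ^ 9 - 1) sequentially" by real_asymp
  have e3: "eventually (\<lambda>n. 8 * (real n / ln (real n) ^ 11) + 5 \<le> real n / ln (real n) ^ 9 - 1) sequentially" by real_asymp
  have e4: "eventually (\<lambda>n. ln (real n) ^ 2 + 1 \<le> real n / ln (real n) ^ 11 - 1) sequentially" by real_asymp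
  have "filterlim (\<lambda>n. ((real n / ln (real n) ^ 9 - 1) / 4 - 1) / (3 * (real n / ln (real n) ^ 11))) at_top sequentially"
    by real_asymp
  then have e5: "eventually (\<lambda>n. 1 / h\<^sup>2 \<le> ((real n / ln (real n) ^ 9 - 1) / 4 - 1) / (3 * (real n / ln (real n) ^ 11))) sequentially"
    by (simp add: filterlim_at_top)
  show ?thesis
    using e1 e2 e3 e4 e5 eventually_ln_ge
  proof eventually_elim
    case (elim n)
    have x: "ln (real n) \<ge> 1" "real n > 0" using elim(6) by auto
    have L: "real n / ln (real n) ^ 8 - 1 < real (block_length n)" "real (block_length n) \<le> real n / ln (real n) ^ 8"
      and M: "real n / ln (real n) ^ 9 - 1 < real (block_margin n)" "real (block_margin n) \<le> real n / ln (real n) ^ 9"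
      and S: "real n / ln (real n) ^ 11 - 1 < real (span_max n)" "real (span_max n) \<le> real n / ln (real n) ^ 11"
      and K: "ln (real n) ^ 2 \<le> real (span_min n)" "real (span_min n) < ln (real n) ^ 2 + 1"
      using nat_floor_bounds[of "real n / ln (real n) ^ 8"] nat_floor_bounds[of "real n / ln (real n) ^ 9"]
        nat_floor_bounds[of "real n / ln (real n) ^ 11"] nat_ceiling_bounds[of "ln (real n) ^ 2"] x
      by (auto simp: block_length_def block_margin_def span_max_def span_min_def)
    have x2: "1 \<le> ln (real n) ^ 2" using x(1) by simp
    have "real (span_min n + 3 * block_margin n) \<le> real (block_length n)" using L M K elim(1) by simp
    moreover have "real (span_min n + 1) \<le> real (block_margin n)" using M K elim(2) by simp
    moreover have "real (8 * span_max n + 5) \<le> real (block_margin n)" using M S elim(3) by simp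
    moreover have "real 1 \<le> real (span_min n)" using K x2 by simp
    moreover have "real (span_min n) \<le> real (span_max n)" using S K elim(4) by simp
    ultimately have nats: "span_min n + 3 * block_margin n \<le> block_length n" "span_min n + 1 \<le> block_margin n" "8 * span_max n + 5 \<le> block_margin n" "1 \<le> span_min n" "span_min n \<le> span_max n"
      by (simp_all only: of_nat_le_iff)
    have "3 * real (span_max n) \<le> 3 * (real n / ln (real n) ^ 11)" using S by simp
    also have "\<dots> \<le> h\<^sup>2 * ((real n / ln (real n) ^ 9 - 1) / 4 - 1)"
    proof -
      have p: "0 < 3 * (real n / ln (real n) ^ 11)"
        using divide_pos_pos[OF x(2) zero_less_power[of "ln (real n)" 11]] x(1) by linarith
      have "1 / h\<^sup>2 * (3 * (real n / ln (real n) ^ 11)) \<le> (real n / ln (real n) ^ 9 - 1) / 4 - 1"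
        using elim(5) unfolding pos_le_divide_eq[OF p] .
      then have "h\<^sup>2 * (1 / h\<^sup>2 * (3 * (real n / ln (real n) ^ 11))) \<le> h\<^sup>2 * ((real n / ln (real n) ^ 9 - 1) / 4 - 1)"
        by (intro mult_left_mono) auto
      then show ?thesis using h by simp
    qed
    also have "\<dots> \<le> h\<^sup>2 * real (block_margin n div 4)"
    proof (intro mult_left_mono)
      have "block_margin n < 4 * (block_margin n div 4) + 4" by simp
      then have "real (block_margin n) < real (4 * (block_margin n div 4) + 4)" by (simp only: of_nat_less_iff)
      moreover have "(z - 1) / 4 - 1 \<le> b" if "a < 4 * b + 4" "z - 1 < a" for a b z :: real
        using that by (simp add: field_simps)
      ultimately show "(real n / ln (real n) ^ 9 - 1) / 4 - 1 \<le> real (block_margin n div 4)" using M(1) by simp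
    qed simp
    finally show ?case using nats by simp
  qed
qed

lemma eventually_span_weight: "eventually (\<lambda>n. 0 \<le> span_weight_low n \<and> span_weight_low n \<le> span_weight n) sequentially"
proof -
  have "filterlim (\<lambda>n. ln (real n / ln (real n) ^ 11) - ln (ln (real n) ^ 2 + 2)) at_top sequentially"
    by real_asymp
  then have e1: "eventually (\<lambda>n. 3 / 2 * (pi / loss) \<le> ln (real n / ln (real n) ^ 11) - ln (ln (real n) ^ 2 + 2)) sequentially"
    by (simp add: filterlim_at_top)
  show ?thesis using e1 eventually_ln_ge
  proof eventually_elim
    case (elim n)
    have x: "ln (real n) \<ge> 1" "real n > 0" using elim(2) by auto
    have tp: "0 < loss / pi" using loss_pos by simp
    have "3 / 2 = loss / pi * (3 / 2 * (pi / loss))" using loss_pos by simp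
    also have "\<dots> \<le> loss / pi * (ln (real n / ln (real n) ^ 11) - ln (ln (real n) ^ 2 + 2))"
      using elim(1) tp by (intro mult_left_mono) auto
    finally have "0 \<le> span_weight_low n" by (simp add: span_weight_low_def)
    moreover have "span_weight_low n \<le> span_weight n"
      unfolding span_weight_low_def span_weight_def
    proof (intro diff_right_mono mult_left_mono diff_mono)
      have "real n / ln (real n) ^ 11 - 1 < real (span_max n)"
        using nat_floor_bounds[of "real n / ln (real n) ^ 11"] x by (simp add: span_max_def)
      then show "ln (real n / ln (real n) ^ 11) \<le> ln (real (span_max n) + 2)"
        using divide_pos_pos[OF x(2) zero_less_power[of "ln (real n)" 11]] x(1) by (intro ln_mono) linarith+
      have "real (span_min n) < ln (real n) ^ 2 + 1"
        using nat_ceiling_bounds[of "ln (real n) ^ 2"] by (simp add: span_min_def)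
      then show "ln (real (span_min n) + 1) \<le> ln (ln (real n) ^ 2 + 2)"
        by (intro ln_mono) auto
    qed (use tp in simp)
    ultimately show ?case by simp
  qed
qed

text \<open>The usable length of all blocks is about 2 n, a fraction of at least 1 / 2 - h of it is
  red, and each red point contributes about loss / pi times ln n. The extra \<open>- h\<close>
  absorbs all lower-order errors, including the superpolynomially small cost of truncation.\<close>

lemma eventually_total_mean:
  "eventually (\<lambda>n. ((1 - 2 * h) * loss / pi - h) * (real n * ln (real n)) \<le> real (block_count n) * block_mean n) sequentially"
proof -
  define W where "W n = (2 * real n - 1 - real n / ln (real n) ^ 8) *
      (1 - 3 * (real n / ln (real n) ^ 9) / (real n / ln (real n) ^ 8 - 1))" for n :: nat
  define err where "err n = 2 * real n * (4 * (real n + 1) ^ 6 * exp (- (ln (real n))\<^sup>2 / 2))" for n :: nat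
  have lW: "(\<lambda>n. W n / real n) \<longlonglongrightarrow> 2" unfolding W_def by real_asymp
  define y where "y n = ln (real n / ln (real n) ^ 11) - ln (ln (real n) ^ 2 + 2)" for n :: nat
  have "(\<lambda>n. y n / ln (real n)) \<longlonglongrightarrow> 1" unfolding y_def by real_asymp
  moreover have "(\<lambda>n. 3 / 2 / ln (real n)) \<longlonglongrightarrow> 0" by real_asymp
  ultimately have "(\<lambda>n. loss / pi * (y n / ln (real n)) - 3 / 2 / ln (real n)) \<longlonglongrightarrow> loss / pi * 1 - 0"
    by (intro tendsto_intros)
  moreover have "span_weight_low n = loss / pi * y n - 3 / 2" for n by (simp add: span_weight_low_def y_def)
  ultimately have lv: "(\<lambda>n. span_weight_low n / ln (real n)) \<longlonglongrightarrow> loss / pi"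
    by (simp add: diff_divide_distrib)
  have lerr: "(\<lambda>n. err n / (real n * ln (real n))) \<longlonglongrightarrow> 0" unfolding err_def by real_asymp
  have "(\<lambda>n. (1 / 2 - h) * (W n / real n) * (span_weight_low n / ln (real n)) - err n / (real n * ln (real n)))
      \<longlonglongrightarrow> (1 / 2 - h) * 2 * (loss / pi) - 0"
    by (intro tendsto_intros lW lv lerr)
  then have "eventually (\<lambda>n. (1 - 2 * h) * loss / pi - h <
      (1 / 2 - h) * (W n / real n) * (span_weight_low n / ln (real n)) - err n / (real n * ln (real n))) sequentially"
  proof (rule order_tendstoD(1))
    have eq: "(1 / 2 - h) * 2 = 1 - 2 * h" by simp
    show "(1 - 2 * h) * loss / pi - h < (1 / 2 - h) * 2 * (loss / pi) - 0"
      unfolding eq times_divide_eq_right diff_zero using h(1) by linarith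
  qed
  moreover have "eventually (\<lambda>n. real n / ln (real n) ^ 8 \<ge> 2) sequentially" by real_asymp
  moreover have "eventually (\<lambda>n. 3 * (real n / ln (real n) ^ 9) / (real n / ln (real n) ^ 8 - 1) \<le> 1) sequentially" by real_asymp
  moreover have "eventually (\<lambda>n. real n / ln (real n) ^ 8 \<le> 2 * real n - 1) sequentially" by real_asymp
  ultimately show ?thesis using eventually_span_weight eventually_ln_ge eventually_block_parameters
  proof eventually_elim
    case (elim n)
    have x: "ln (real n) \<ge> 1" "real n > 0" "n > 0" using elim(6) by auto
    have L: "real n / ln (real n) ^ 8 - 1 < real (block_length n)" "real (block_length n) \<le> real n / ln (real n) ^ 8"
      and M: "real (block_margin n) \<le> real n / ln (real n) ^ 9"
      using nat_floor_bounds[of "real n / ln (real n) ^ 8"] nat_floor_bounds[of "real n / ln (real n) ^ 9"] x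
      by (auto simp: block_length_def block_margin_def)
    have L1: "real (block_length n) > 1" using L(1) elim(2) by linarith
    then have Lpos: "block_length n > 0" by simp
    have "2 * n - 1 < block_length n * block_count n + block_length n"
      using Lpos unfolding block_count_def by (metis add.commute dividend_less_times_div mult.commute)
    then have nbL: "2 * real n - 1 - real (block_length n) \<le> real (block_count n) * real (block_length n)"
    proof -
      assume "2 * n - 1 < block_length n * block_count n + block_length n"
      then have "real (2 * n - 1) < real (block_length n * block_count n + block_length n)" by (simp only: of_nat_less_iff)
      then show ?thesis using x(3) by (simp add: of_nat_diff mult.commute)
    qed
    have LM: "0 \<le> 1 - 3 * real (block_margin n) / real (block_length n)"
      using elim(7) L1 by (simp add: divide_simps)
    have "W n \<le> (2 * real n - 1 - real (block_length n)) * (1 - 3 * real (block_margin n) / real (block_length n))"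
      unfolding W_def
    proof (intro mult_mono diff_left_mono)
      show "3 * real (block_margin n) / real (block_length n) \<le> 3 * (real n / ln (real n) ^ 9) / (real n / ln (real n) ^ 8 - 1)"
        using L M L1 elim(2) by (intro frac_le) auto
    qed (use L(2) elim(3,4) in auto)
    also have "\<dots> \<le> (real (block_count n) * real (block_length n)) * (1 - 3 * real (block_margin n) / real (block_length n))"
      by (intro mult_right_mono nbL LM)
    also have "\<dots> = real (block_count n) * (real (block_length n) - 3 * real (block_margin n))"
      using L1 by (simp add: field_simps)
    finally have Wle: "W n \<le> real (block_count n) * (real (block_length n) - 3 * real (block_margin n))" .
    have W0: "0 \<le> W n" unfolding W_def using elim(3,4) by (intro mult_nonneg_nonneg) auto
    have "(1 / 2 - h) * W n * span_weight_low n \<le> (1 / 2 - h) * (real (block_count n) * (real (block_length n) - 3 * real (block_margin n))) * span_weight n"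
      using elim(5) Wle W0 h by (intro mult_mono mult_left_mono) auto
    moreover have "real (block_count n) * (4 * real (block_length n + 1) ^ 6 * exp (- (ln (real n))\<^sup>2 / 2)) \<le> err n"
      unfolding err_def
    proof (intro mult_mono power_mono)
      have "block_count n \<le> 2 * n - 1" by (simp add: block_count_def)
      then show "real (block_count n) \<le> 2 * real n" by linarith
      have "real n / ln (real n) ^ 8 \<le> real n / 1" using x by (intro divide_left_mono) auto
      then show "real (block_length n + 1) \<le> real n + 1" using L(2) by simp
    qed auto
    ultimately have "(1 / 2 - h) * W n * span_weight_low n - err n \<le> real (block_count n) * block_mean n"
      by (simp add: block_mean_def algebra_simps)
    moreover have "((1 - 2 * h) * loss / pi - h) * (real n * ln (real n)) \<le> (1 / 2 - h) * W n * span_weight_low n - err n"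
    proof -
      have p: "0 < real n * ln (real n)" using x by (intro mult_pos_pos) linarith+
      have "((1 - 2 * h) * loss / pi - h) * (real n * ln (real n)) \<le>
        ((1 / 2 - h) * (W n / real n) * (span_weight_low n / ln (real n)) - err n / (real n * ln (real n))) * (real n * ln (real n))"
        using elim(1) p by (intro mult_right_mono) auto
      also have "\<dots> = (1 / 2 - h) * W n * span_weight_low n - err n"
      proof -
        have gen: "(A * (w / a) * (v / b) - r / (a * b)) * (a * b) = A * w * v - r"
          if "a \<noteq> 0" "b \<noteq> 0" for A w v r a b :: real
          using that by (simp add: field_simps)
        show ?thesis by (rule gen) (use x in linarith)+
      qed
      finally show ?thesis .
    qed
    ultimately show ?case by linarith
  qed
qed

text \<open>The colouring is quantified inside \<open>eventually\<close>: the threshold for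
  \<open>n\<close> must be uniform, because the colouring is random and is averaged out
  afterwards.\<close>

lemma prob_given_lower_tail:
  "eventually (\<lambda>n. \<forall>R. R \<subseteq> {1..2 * n} \<longrightarrow> even (card R) \<longrightarrow> balanced h (span_min n) n R \<longrightarrow>
     measure_pmf.prob (arcs_given R ({1..2 * n} - R)) {M. real (CP_edges M) \<le> real (block_count n) * block_mean n - h * (real n * ln (real n))} \<le>
     4 * (real n + 1)^4 * exp (- h\<^sup>2 * ln (real n) ^ 4 / 16)) sequentially"
proof -
  have "eventually (\<lambda>n. real n / ln (real n) ^ 8 \<le> real n - 1) sequentially" by real_asymp
  then show ?thesis using eventually_span_weight eventually_ln_ge eventually_block_parameters
  proof eventually_elim
    case (elim n)
    define x where "x = ln (real n)"
    have x: "x \<ge> 1" "real n > 0" "n > 0" using elim(3) by (auto simp: x_def)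
    have L: "real (block_length n) \<le> real n / x ^ 8"
      using nat_floor_bounds[of "real n / ln (real n) ^ 8"] x by (simp add: block_length_def x_def)
    have par: "span_min n + 3 * block_margin n \<le> block_length n" "span_min n + 1 \<le> block_margin n" "8 * span_max n + 5 \<le> block_margin n" "1 \<le> span_min n" "1 \<le> span_max n"
      "span_min n \<le> span_max n" "4 \<le> block_margin n" "3 * real (span_max n) \<le> h\<^sup>2 * real (block_margin n div 4)"
      using elim(4) by auto
    have Lpos: "block_length n > 0" using par by linarith
    have Ln: "real (block_length n) \<le> real n - 1" using L elim(1) by (simp add: x_def)
    have "block_length n \<le> 2 * n - 1" using Ln x(3) by linarith
    then have nbpos: "block_count n > 0" using Lpos by (simp add: block_count_def div_greater_zero_iff)
    have nbL: "block_count n * block_length n \<le> 2 * n - 1" by (simp add: block_count_def)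
    \<comment> \<open>The bound of \<open>card_block_le\<close> for \<rho> = ln n.\<close>
    define D where "D = 2 * x\<^sup>2 * real (block_length n) * (ln (real (block_length n)) + 1)"
    have lnL: "0 \<le> ln (real (block_length n))" "ln (real (block_length n)) \<le> x"
      using Lpos Ln unfolding x_def by (auto intro!: ln_mono)
    have Dpos: "D > 0" unfolding D_def using x Lpos lnL by (intro mult_pos_pos add_nonneg_pos) auto
    show ?case
    proof (intro allI impI)
      fix R assume R: "R \<subseteq> {1..2 * n}" "even (card R)" and bal: "balanced h (span_min n) n R"
      define B where "B = {1..2 * n} - R"
      \<comment> \<open>The blocks cover at most the first \<open>2 * n - 1\<close> points, so the
        point of forced colour lies in none of them.\<close>
      define s where "s i = 1 + i * block_length n" for i :: nat
      define e where "e i = s i + block_length n" for i :: nat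
      have disj: "R \<inter> B = {}" by (auto simp: B_def)
      have finRB: "finite R" "finite B" using R finite_subset by (auto simp: B_def)
      have se: "1 \<le> s i" "s i + block_length n \<le> 2 * n" if "i < block_count n" for i
      proof -
        have "(i + 1) * block_length n \<le> block_count n * block_length n" using that by (intro mult_right_mono) auto
        then show "s i + block_length n \<le> 2 * n" using nbL x(3) by (simp add: s_def)
      qed (simp add: s_def)
      have E: "block_mean n \<le> coin_mean {1..2 * n} (\<lambda>u. min (real (card (block_set R B {s i..<e i} u))) D)"
        if "i \<in> {..<block_count n}" for i
      proof -
        have i: "i < block_count n" using that by simp
        have vnn: "0 \<le> sqrt ((1 / 2 - h) / (1 / 2 + h)) * (1 - h) / pi * (ln (real (span_max n) + 2) - ln (real (span_min n) + 1)) - 3 / 2"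
          using elim(2) unfolding span_weight_def loss_def by linarith
        have "(1 / 2 - h) * (real (block_length n) - 3 * real (block_margin n)) *
            (sqrt ((1 / 2 - h) / (1 / 2 + h)) * (1 - h) / pi * (ln (real (span_max n) + 2) - ln (real (span_min n) + 1)) - 3 / 2) \<le>
            coin_mean {1..2 * n} (\<lambda>u. real (card (block_set R B {s i..<s i + block_length n} u)))"
          by (rule expectation_block_balanced[OF R(1) B_def bal h _ _ se[OF i] par vnn]) (use h in auto)
        moreover have "coin_mean {1..2 * n} (\<lambda>u. real (card (block_set R B {s i..<e i} u)))
            - 4 * real (e i - s i + 1) ^ 6 * exp (- x\<^sup>2 / 2) \<le>
          coin_mean {1..2 * n} (\<lambda>u. min (real (card (block_set R B {s i..<e i} u))) D)"
          by (rule expectation_truncated_block) (use R disj x Lpos in \<open>auto simp: B_def e_def D_def\<close>)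
        moreover have "e i - s i = block_length n" by (simp add: e_def)
        ultimately show ?thesis unfolding block_mean_def span_weight_def loss_def x_def[symmetric] e_def by simp
      qed
      have dis: "disjoint_family_on (\<lambda>i. {s i..<e i}) {..<block_count n}"
      proof (unfold disjoint_family_on_def, intro ballI impI)
        have *: "{s i..<e i} \<inter> {s j..<e j} = {}" if "i < j" for i j :: nat
        proof -
          have "(i + 1) * block_length n \<le> j * block_length n" using that by (intro mult_right_mono) auto
          then show ?thesis by (auto simp: s_def e_def)
        qed
        fix i j :: nat assume "i \<noteq> j"
        then show "{s i..<e i} \<inter> {s j..<e j} = {}" using *[of i j] *[of j i] by (cases "i < j") auto
      qed
      define t where "t = h * (real n * x)"
      define F where "F = {u. (\<Sum>i\<in>{..<block_count n}. real (card (block_set R B {s i..<e i} u))) \<le> real (card {..<block_count n}) * block_mean n - t}"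
      have "coin_prob {1..2 * n} F \<le> exp (- 2 * t\<^sup>2 / (real (card {..<block_count n}) * D\<^sup>2))"
        unfolding F_def
      proof (rule blocks_lower_tail[OF _ _ _ _ dis Dpos _ E])
        show "{s i..<e i} \<subseteq> {1..2 * n}" if "i \<in> {..<block_count n}" for i using se[of i] that by (auto simp: e_def)
        show "0 \<le> t" using h x by (simp add: t_def)
      qed (use nbpos in auto)
      \<comment> \<open>With x = ln n and block length at most n / x^8: \<open>D\<close> is at most
        4 x^3 times the block length, so the number of blocks times D^2 is at most 32 n^2 / x^2,
        while t^2 = h^2 n^2 x^2. The quotient has order x^4, well above the order x needed against a
        power of n.\<close>
      also have "\<dots> \<le> exp (- h\<^sup>2 * x ^ 4 / 16)"
      proof -
        have "D \<le> 4 * x ^ 3 * real (block_length n)"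
        proof -
          have "D \<le> 2 * x\<^sup>2 * real (block_length n) * (2 * x)"
            unfolding D_def using lnL x by (intro mult_left_mono) auto
          then show ?thesis by (simp add: power2_eq_square power3_eq_cube mult_ac)
        qed
        then have "D\<^sup>2 \<le> (4 * x ^ 3 * real (block_length n))\<^sup>2" using Dpos by (intro power_mono) auto
        then have "real (block_count n) * D\<^sup>2 \<le> real (block_count n) * (4 * x ^ 3 * real (block_length n))\<^sup>2" by (intro mult_left_mono) auto
        also have "\<dots> = (real (block_count n) * real (block_length n)) * (16 * x ^ 6 * real (block_length n))"
          by (simp add: power2_eq_square power_mult_distrib eval_nat_numeral)
        also have "\<dots> \<le> (2 * real n) * (16 * x ^ 6 * (real n / x ^ 8))"
        proof (rule mult_mono)
          show "16 * x ^ 6 * real (block_length n) \<le> 16 * x ^ 6 * (real n / x ^ 8)"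
            using L x by (intro mult_left_mono) auto
          have "real (block_count n * block_length n) \<le> real (2 * n - 1)" using nbL by (simp only: of_nat_le_iff)
          then show "real (block_count n) * real (block_length n) \<le> 2 * real n" by simp
        qed (use L x in auto)
        also have "\<dots> = 32 * (real n)\<^sup>2 / x\<^sup>2" using x by (simp add: power2_eq_square eval_nat_numeral)
        finally have up: "real (block_count n) * D\<^sup>2 \<le> 32 * (real n)\<^sup>2 / x\<^sup>2" .
        have pos: "0 < real (block_count n) * D\<^sup>2" using nbpos Dpos by simp
        have "h\<^sup>2 * x ^ 4 / 16 = 2 * t\<^sup>2 / (32 * (real n)\<^sup>2 / x\<^sup>2)"
          using x by (simp add: t_def power2_eq_square eval_nat_numeral)
        also have "\<dots> \<le> 2 * t\<^sup>2 / (real (block_count n) * D\<^sup>2)"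
          using up pos x nbpos Dpos by (intro divide_left_mono mult_pos_pos) auto
        finally show ?thesis by simp
      qed
      finally have F: "coin_prob {1..2 * n} F \<le> exp (- h\<^sup>2 * x ^ 4 / 16)" .
      have "card R \<le> 2 * n" "card B = 2 * n - card R"
        using card_mono[OF _ R(1)] R finRB by (auto simp: B_def card_Diff_subset)
      moreover obtain k where k: "card R = 2 * k" using R(2) by blast
      ultimately have cards: "card R = 2 * k" "card B = 2 * (n - k)" "n = k + (n - k)" by auto
      have "measure_pmf.prob (arcs_given R B) {M. real (CP_edges M) \<le> real (block_count n) * block_mean n - t} \<le>
          4 * (real n + 1)^4 * coin_prob {1..2 * n} F"
      proof (rule prob_arcs_given_le_coins[OF R(1) B_def cards])
        fix M N u
        assume M: "catalan_matching R M" "catalan_matching B N" "M \<union> N \<in> {M. real (CP_edges M) \<le> real (block_count n) * block_mean n - t}"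
          and u: "\<And>z. z \<in> R \<Longrightarrow> u z \<longleftrightarrow> z \<in> fst ` M" "\<And>z. z \<in> B \<Longrightarrow> u z \<longleftrightarrow> z \<in> fst ` N"
        have "(\<Sum>i\<in>{..<block_count n}. card (block_set R B {s i..<e i} u)) \<le> CP_edges (M \<union> N)"
          by (rule sum_block_edges_le[OF finRB(1) M(1) finRB(2) M(2) disj u _ _ dis]) auto
        then have "(\<Sum>i\<in>{..<block_count n}. real (card (block_set R B {s i..<e i} u))) \<le> real (CP_edges (M \<union> N))"
          unfolding of_nat_sum[symmetric] of_nat_le_iff .
        then show "u \<in> F" using M(3) by (simp add: F_def)
      qed
      also have "\<dots> \<le> 4 * (real n + 1)^4 * exp (- h\<^sup>2 * x ^ 4 / 16)"
        by (intro mult_left_mono F) auto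
      finally show "measure_pmf.prob (arcs_given R ({1..2 * n} - R)) {M. real (CP_edges M) \<le> real (block_count n) * block_mean n - h * (real n * ln (real n))} \<le>
        4 * (real n + 1)^4 * exp (- h\<^sup>2 * ln (real n) ^ 4 / 16)"
        unfolding t_def B_def x_def .
    qed
  qed
qed

end


text \<open>At h = 0 the right-hand side is 1 / pi. One \<open>h\<close> of the subtracted
  \<open>2 * h\<close> is the slack of \<open>eventually_total_mean\<close>, the other the deviation
  allowed in \<open>prob_given_lower_tail\<close>.\<close>

lemma exists_small_parameter:
  assumes "\<epsilon> > 0"
  obtains h where "0 < h" "h \<le> 1 / 4" "(1 - \<epsilon>) / pi \<le> (1 - 2 * h) * loss h / pi - 2 * h"
proof -
  have "((\<lambda>h. (1 - 2 * h) * (sqrt ((1 / 2 - h) / (1 / 2 + h)) * (1 - h)) / pi - 2 * h) \<longlongrightarrow> (1 - 2 * 0) * (sqrt ((1 / 2 - 0) / (1 / 2 + 0)) * (1 - 0)) / pi - 2 * 0) (at_right (0 :: real))"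
    by (intro tendsto_intros) auto
  then have "eventually (\<lambda>h. (1 - \<epsilon>) / pi < (1 - 2 * h) * (sqrt ((1 / 2 - h) / (1 / 2 + h)) * (1 - h)) / pi - 2 * h) (at_right (0 :: real))"
    by (rule order_tendstoD(1)) (use assms in \<open>simp add: divide_simps\<close>)
  moreover have "eventually (\<lambda>h :: real. h \<in> {0<..<1 / 4}) (at_right 0)"
    by (rule eventually_at_right_real) simp
  ultimately have "eventually (\<lambda>h. (1 - \<epsilon>) / pi < (1 - 2 * h) * (sqrt ((1 / 2 - h) / (1 / 2 + h)) * (1 - h)) / pi - 2 * h \<and> h \<in> {0<..<1 / 4}) (at_right (0 :: real))"
    by eventually_elim simp
  then obtain h where h: "(1 - \<epsilon>) / pi < (1 - 2 * h) * (sqrt ((1 / 2 - h) / (1 / 2 + h)) * (1 - h)) / pi - 2 * h" "h \<in> {0<..<1 / 4}"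
    using eventually_happens'[OF trivial_limit_at_right_real] by blast
  then have "0 < h" "h \<le> 1 / 4" by auto
  then show ?thesis using that[of h] h(1) by (simp add: loss_def)
qed

text \<open>Split according to whether the colouring is balanced. Balance is demanded from length
  \<open>span_min n\<close> on, at least (ln n)^2, so its failure has probability at most 8 n^2 exp
  (- 2 h^2 (ln n)^2). With the first power of the logarithm this bound would not vanish for small
  \<open>h\<close>.\<close>

lemma lower_tail:
  assumes "\<epsilon> > 0"
  shows "(\<lambda>n. CP_prob n {M. real (CP_edges M) \<le> (1 - \<epsilon>) * (real n * ln (real n) / pi)}) \<longlonglongrightarrow> 0"
proof -
  obtain h where h: "0 < h" "h \<le> 1 / 4" and eps: "(1 - \<epsilon>) / pi \<le> (1 - 2 * h) * loss h / pi - 2 * h"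
    using exists_small_parameter[OF assms] .
  let ?b = "\<lambda>n. 8 * real n ^ 2 * exp (- 2 * h\<^sup>2 * ln (real n) ^ 2) + 4 * (real n + 1)^4 * exp (- h\<^sup>2 * ln (real n) ^ 4 / 16)"
  have lim: "?b \<longlonglongrightarrow> 0" using h(1) by real_asymp
  have "eventually (\<lambda>n. CP_prob n {M. real (CP_edges M) \<le> (1 - \<epsilon>) * (real n * ln (real n) / pi)} \<le> ?b n) sequentially"
    using prob_given_lower_tail[OF h] eventually_total_mean[OF h] eventually_ln_ge
  proof eventually_elim
    case (elim n)
    have n: "n > 0" "ln (real n) \<ge> 1" using elim(3) by auto
    let ?Ev = "{M. real (CP_edges M) \<le> (1 - \<epsilon>) * (real n * ln (real n) / pi)}"
    let ?c = "4 * (real n + 1)^4 * exp (- h\<^sup>2 * ln (real n) ^ 4 / 16)"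
    let ?bad = "{c. \<not> balanced h (span_min n) n (red n c)}"
    have K: "ln (real n) ^ 2 \<le> real (span_min n)"
      using nat_ceiling_bounds[of "ln (real n) ^ 2"] by (simp add: span_min_def)
    have "1 \<le> ln (real n) ^ 2" using n(2) by simp
    then have Kpos: "span_min n > 0" using K by linarith
    have thr: "(1 - \<epsilon>) * (real n * ln (real n) / pi) \<le> real (block_count n) * block_mean h n - h * (real n * ln (real n))"
    proof -
      have nx: "0 \<le> real n * ln (real n)" using n by simp
      have "(1 - \<epsilon>) * (real n * ln (real n) / pi) = (1 - \<epsilon>) / pi * (real n * ln (real n))" by simp
      also have "\<dots> \<le> ((1 - 2 * h) * loss h / pi - 2 * h) * (real n * ln (real n))"
        by (intro mult_right_mono eps nx)
      also have "\<dots> = ((1 - 2 * h) * loss h / pi - h) * (real n * ln (real n)) - h * (real n * ln (real n))"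
        by (simp add: algebra_simps)
      finally show ?thesis using elim(2) by linarith
    qed
    have "measure_pmf.prob (arcs_given (red n c) (blue n c)) ?Ev \<le> indicator ?bad c + ?c" for c
    proof (cases "c \<in> ?bad")
      case True
      have "measure_pmf.prob (arcs_given (red n c) (blue n c)) ?Ev \<le> 1" by simp
      moreover have "0 \<le> ?c" by simp
      ultimately show ?thesis using True by (simp add: add_increasing2)
    next
      case False
      have "measure_pmf.prob (arcs_given (red n c) (blue n c)) ?Ev \<le>
          measure_pmf.prob (arcs_given (red n c) (blue n c)) {M. real (CP_edges M) \<le> real (block_count n) * block_mean h n - h * (real n * ln (real n))}"
        using thr by (intro measure_pmf.finite_measure_mono) auto
      also have "\<dots> \<le> ?c"
        unfolding blue_eq
        by (rule elim(1)[rule_format]) (use False card_red_even[OF n(1)] in \<open>auto simp: red_def\<close>)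
      finally show ?thesis using False by simp
    qed
    then have "coin_mean {1..2 * n - 1} (\<lambda>c. measure_pmf.prob (arcs_given (red n c) (blue n c)) ?Ev) \<le>
        coin_mean {1..2 * n - 1} (\<lambda>c. indicator ?bad c + ?c)"
      by (intro integral_mono integrable_measure_pmf_finite finite_set_coins) auto
    also have "\<dots> = coin_prob {1..2 * n - 1} ?bad + ?c"
      by (subst Bochner_Integration.integral_add) (auto intro!: integrable_measure_pmf_finite finite_set_coins)
    also have "coin_prob {1..2 * n - 1} ?bad \<le> 8 * real n ^ 2 * exp (- 2 * h\<^sup>2 * real (span_min n))"
      by (rule prob_not_balanced[OF n(1) h(1) Kpos])
    also have "\<dots> \<le> 8 * real n ^ 2 * exp (- 2 * h\<^sup>2 * ln (real n) ^ 2)"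
    proof -
      have "2 * h\<^sup>2 * ln (real n) ^ 2 \<le> 2 * h\<^sup>2 * real (span_min n)" by (intro mult_left_mono K) auto
      then show ?thesis by (intro mult_left_mono) auto
    qed
    finally have "coin_mean {1..2 * n - 1} (\<lambda>c. measure_pmf.prob (arcs_given (red n c) (blue n c)) ?Ev) \<le> ?b n"
      by simp
    moreover have "CP_prob n ?Ev =
        coin_mean {1..2 * n - 1} (\<lambda>c. measure_pmf.prob (arcs_given (red n c) (blue n c)) ?Ev)"
      using expectation_CP_arcs[OF n(1), of "indicator ?Ev"] by simp
    ultimately show ?case by simp
  qed
  then show ?thesis
    by (intro tendsto_sandwich[OF _ _ tendsto_const lim]) auto
qed

subsection \<open>Concentration of the number of edges\<close>

lemma scale_pos:
  assumes "n > 0" "ln (real n) \<ge> 1"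
  shows "real n * ln (real n) / pi > 0"
proof -
  have "ln (real n) > 0" using assms(2) by linarith
  then show ?thesis using assms(1) by (intro divide_pos_pos mult_pos_pos) auto
qed

text \<open>A variable whose mean is asymptotically at most \<open>\<mu>\<close> and which is rarely much below \<open>\<mu>\<close>
  cannot often be much above \<open>\<mu>\<close>.\<close>
lemma upper_tail:
  assumes "\<epsilon> > 0"
  shows "(\<lambda>n. CP_prob n {M. real (CP_edges M) \<ge> (1 + \<epsilon>) * (real n * ln (real n) / pi)}) \<longlonglongrightarrow> 0"
proof (rule order_tendstoI)
  fix r :: real assume "r < 0"
  then show "eventually (\<lambda>n. r < CP_prob n {M. real (CP_edges M) \<ge> (1 + \<epsilon>) * (real n * ln (real n) / pi)}) sequentially"
    by (intro always_eventually allI less_le_trans[OF _ measure_nonneg]) auto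
next
  fix r :: real assume r: "0 < r"
  \<comment> \<open>The estimate below gives \<epsilon> times the upper tail < 3 \<delta>, which is
    less than \<epsilon> r for this choice.\<close>
  define \<delta> where "\<delta> = \<epsilon> * r / 4"
  have \<delta>: "\<delta> > 0" using assms r by (simp add: \<delta>_def)
  have "(\<lambda>n. 100 * pi / ln (real n)) \<longlonglongrightarrow> 0" by real_asymp
  then have e1: "eventually (\<lambda>n. 100 * pi / ln (real n) < \<delta>) sequentially" using \<delta> by (rule order_tendstoD(2))
  have e2: "eventually (\<lambda>n. CP_prob n {M. real (CP_edges M) \<le> (1 - \<delta>) * (real n * ln (real n) / pi)} < \<delta>) sequentially"
    using lower_tail[OF \<delta>] \<delta> by (rule order_tendstoD(2))
  show "eventually (\<lambda>n. CP_prob n {M. real (CP_edges M) \<ge> (1 + \<epsilon>) * (real n * ln (real n) / pi)} < r) sequentially"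
    using e1 e2 eventually_ln_ge
  proof eventually_elim
    case (elim n)
    have n: "n > 0" "ln (real n) \<ge> 1" using elim(3) by auto
    define \<mu> where "\<mu> = real n * ln (real n) / pi"
    have \<mu>: "\<mu> > 0" unfolding \<mu>_def by (rule scale_pos[OF n])
    let ?up = "{M. real (CP_edges M) \<ge> (1 + \<epsilon>) * \<mu>}" and ?lo = "{M. real (CP_edges M) \<le> (1 - \<delta>) * \<mu>}"
    note int = integrable_measure_pmf_finite[OF finite_set_CP_arcs[OF n(1)]]
    \<comment> \<open>Pointwise, the excess over (1 - \<delta>) \<mu> is at least \<epsilon> \<mu>
      on the upper event and nonnegative between the thresholds. On the lower event it is at least -
      \<mu>, as edge counts are nonnegative, and the indicator of that event repays this.\<close>
    have "measure_pmf.expectation (CP_arcs n) (\<lambda>M. \<epsilon> * \<mu> * indicator ?up M) \<le>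
      measure_pmf.expectation (CP_arcs n) (\<lambda>M. (real (CP_edges M) - (1 - \<delta>) * \<mu>) + \<mu> * indicator ?lo M)"
    proof (rule integral_mono[OF int int])
      fix M
      have d: "\<delta> * \<mu> > 0" "\<epsilon> * \<mu> > 0" using \<delta> \<mu> assms by auto
      have x0: "0 \<le> real (CP_edges M)" by simp
      show "\<epsilon> * \<mu> * indicator ?up M \<le> (real (CP_edges M) - (1 - \<delta>) * \<mu>) + \<mu> * indicator ?lo M"
        using d x0 \<mu> by (auto simp: indicator_def algebra_simps)
    qed
    also have "\<dots> = (mean_edges n - (1 - \<delta>) * \<mu>) + \<mu> * CP_prob n ?lo"
      by (subst Bochner_Integration.integral_add[OF int int], subst Bochner_Integration.integral_diff[OF int int]) simp
    also have "\<dots> < (\<mu> + \<delta> * \<mu> - (1 - \<delta>) * \<mu>) + \<mu> * \<delta>"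
    proof (intro add_le_less_mono diff_right_mono mult_strict_left_mono \<mu>)
      have "0 < ln (real n)" using n(2) by linarith
      then have "100 * pi \<le> \<delta> * ln (real n)" using elim(1) by (simp only: pos_divide_less_eq less_imp_le)
      then have "real n / pi * (100 * pi) \<le> real n / pi * (\<delta> * ln (real n))" by (intro mult_left_mono) auto
      then have "100 * real n \<le> \<delta> * \<mu>" by (simp add: \<mu>_def mult_ac)
      then show "mean_edges n \<le> \<mu> + \<delta> * \<mu>"
        using expectation_edges_upper[OF n(1)] unfolding \<mu>_def by linarith
      show "CP_prob n ?lo < \<delta>" using elim(2) by (simp add: \<mu>_def)
    qed
    also have "\<dots> = \<mu> * (3 * \<delta>)" by (simp add: algebra_simps)
    also have "\<dots> \<le> \<mu> * (\<epsilon> * r)" using \<mu> assms r by (intro mult_left_mono) (auto simp: \<delta>_def)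
    finally have "\<epsilon> * \<mu> * CP_prob n ?up < \<epsilon> * \<mu> * r" by (simp add: mult_ac)
    then have "CP_prob n ?up < r" using assms \<mu> by simp
    then show ?case by (simp add: \<mu>_def)
  qed
qed

text \<open>The upper half is \<open>expectation_edges_upper\<close>. The lower half is Markov's
  inequality: the mean is at least (1 - \<epsilon>) \<mu> times the probability of exceeding that
  value, which tends to 1 by \<open>lower_tail\<close>.\<close>

lemma expectation_edges_asymp:
  "(\<lambda>n. mean_edges n / (real n * ln (real n) / pi)) \<longlonglongrightarrow> 1"
proof (rule order_tendstoI)
  fix r :: real assume "1 < r"
  have "(\<lambda>n. 1 + 100 * pi / ln (real n)) \<longlonglongrightarrow> 1 + 0" by real_asymp
  then have "eventually (\<lambda>n. 1 + 100 * pi / ln (real n) < r) sequentially" using \<open>1 < r\<close> by (intro order_tendstoD(2)) auto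
  then show "eventually (\<lambda>n. mean_edges n / (real n * ln (real n) / pi) < r) sequentially"
    using eventually_ln_ge
  proof eventually_elim
    case (elim n)
    have n: "n > 0" "ln (real n) \<ge> 1" using elim(2) by auto
    have \<mu>: "real n * ln (real n) / pi > 0" by (rule scale_pos[OF n])
    have l0: "ln (real n) \<noteq> 0" using n(2) by linarith
    have "mean_edges n / (real n * ln (real n) / pi) \<le>
        (real n * ln (real n) / pi + 100 * real n) / (real n * ln (real n) / pi)"
      using \<mu> by (intro divide_right_mono expectation_edges_upper n(1)) auto
    also have "\<dots> = 1 + 100 * pi / ln (real n)"
    proof -
      have gen: "(a * b / c + 100 * a) / (a * b / c) = 1 + 100 * c / b"
        if "a \<noteq> 0" "b \<noteq> 0" "c \<noteq> 0" for a b c :: real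
        using that by (simp add: field_simps)
      show ?thesis by (rule gen) (use n l0 in auto)
    qed
    finally show ?case using elim(1) by linarith
  qed
next
  fix r :: real assume r: "r < 1"
  \<comment> \<open>The cap 1 / 2 keeps 1 - \<epsilon> positive for very negative \<open>r\<close>;
    the other value ensures r < 1 - \<epsilon>.\<close>
  define \<epsilon> where "\<epsilon> = min (1 / 2) ((1 - r) / 2)"
  have eps: "0 < \<epsilon>" "\<epsilon> < 1" "r < 1 - \<epsilon>" using r by (auto simp: \<epsilon>_def min_def field_simps)
  have "(\<lambda>n. (1 - \<epsilon>) * (1 - CP_prob n {M. real (CP_edges M) \<le> (1 - \<epsilon>) * (real n * ln (real n) / pi)}))
      \<longlonglongrightarrow> (1 - \<epsilon>) * (1 - 0)"
    by (intro tendsto_intros lower_tail eps(1))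
  then have "eventually (\<lambda>n. r < (1 - \<epsilon>) * (1 - CP_prob n {M. real (CP_edges M) \<le> (1 - \<epsilon>) * (real n * ln (real n) / pi)})) sequentially"
    by (rule order_tendstoD(1)) (use eps in simp)
  then show "eventually (\<lambda>n. r < mean_edges n / (real n * ln (real n) / pi)) sequentially"
    using eventually_ln_ge
  proof eventually_elim
    case (elim n)
    have n: "n > 0" "ln (real n) \<ge> 1" using elim(2) by auto
    define \<mu> where "\<mu> = real n * ln (real n) / pi"
    have \<mu>: "\<mu> > 0" unfolding \<mu>_def by (rule scale_pos[OF n])
    let ?lo = "{M. real (CP_edges M) \<le> (1 - \<epsilon>) * \<mu>}"
    note int = integrable_measure_pmf_finite[OF finite_set_CP_arcs[OF n(1)]]
    have "measure_pmf.expectation (CP_arcs n) (\<lambda>M. (1 - \<epsilon>) * \<mu> * (1 - indicator ?lo M)) \<le>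
        mean_edges n"
      by (rule integral_mono[OF int int]) (auto simp: indicator_def)
    also have "measure_pmf.expectation (CP_arcs n) (\<lambda>M. (1 - \<epsilon>) * \<mu> * (1 - indicator ?lo M)) =
        (1 - \<epsilon>) * \<mu> * (1 - CP_prob n ?lo)"
      by (simp add: Bochner_Integration.integral_diff[OF int int])
    finally have "((1 - \<epsilon>) * (1 - CP_prob n ?lo)) * \<mu> \<le> mean_edges n"
      by (simp add: mult_ac)
    then have "(1 - \<epsilon>) * (1 - CP_prob n ?lo) \<le> mean_edges n / \<mu>"
      using \<mu> by (simp only: pos_le_divide_eq)
    then show ?case using elim(1) unfolding \<mu>_def by linarith
  qed
qed

theorem theorem1p1:
  shows "((\<lambda>n. measure_pmf.expectation (CP_arcs n) (\<lambda>M. real (CP_edges M)))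
           \<sim>[at_top] (\<lambda>n. real n * ln (real n) / pi)) \<and>
         (\<forall>\<epsilon>::real. \<epsilon> > 0 \<longrightarrow>
           (\<lambda>n. measure_pmf.prob (CP_arcs n)
                 {M. \<bar>real (CP_edges M) - real n * ln (real n) / pi\<bar> < \<epsilon> * real n * ln (real n)})
           \<longlonglongrightarrow> 1)"
proof (intro conjI allI impI)
  show "(\<lambda>n. mean_edges n) \<sim>[at_top] (\<lambda>n. real n * ln (real n) / pi)"
    by (rule asymp_equivI'[OF expectation_edges_asymp])
next
  fix \<epsilon> :: real assume "\<epsilon> > 0"
  \<comment> \<open>The deviation here is measured against n ln n, but in the tail lemmas against n
    ln n / pi.\<close>
  define \<delta> where "\<delta> = \<epsilon> * pi"
  have \<delta>: "\<delta> > 0" using \<open>\<epsilon> > 0\<close> by (simp add: \<delta>_def)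
  let ?lo = "\<lambda>n. {M. real (CP_edges M) \<le> (1 - \<delta>) * (real n * ln (real n) / pi)}"
  let ?up = "\<lambda>n. {M. real (CP_edges M) \<ge> (1 + \<delta>) * (real n * ln (real n) / pi)}"
  let ?mid = "\<lambda>n. {M. \<bar>real (CP_edges M) - real n * ln (real n) / pi\<bar> < \<epsilon> * real n * ln (real n)}"
  have "(\<lambda>n. 1 - (CP_prob n (?lo n) + CP_prob n (?up n))) \<longlonglongrightarrow> 1 - (0 + 0)"
    by (intro tendsto_intros lower_tail upper_tail \<delta>)
  then have lim: "(\<lambda>n. 1 - (CP_prob n (?lo n) + CP_prob n (?up n))) \<longlonglongrightarrow> 1" by simp
  have "1 - (CP_prob n (?lo n) + CP_prob n (?up n)) \<le> CP_prob n (?mid n)" for n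
  proof -
    have eq: "\<epsilon> * real n * ln (real n) = \<delta> * (real n * ln (real n) / pi)" by (simp add: \<delta>_def)
    have "UNIV - ?mid n \<subseteq> ?lo n \<union> ?up n"
    proof
      fix M assume "M \<in> UNIV - ?mid n"
      then have "\<not> \<bar>real (CP_edges M) - real n * ln (real n) / pi\<bar> < \<delta> * (real n * ln (real n) / pi)"
        by (simp add: eq)
      then have "real (CP_edges M) \<le> (1 - \<delta>) * (real n * ln (real n) / pi) \<or>
          real (CP_edges M) \<ge> (1 + \<delta>) * (real n * ln (real n) / pi)"
        unfolding left_diff_distrib distrib_right by linarith
      then show "M \<in> ?lo n \<union> ?up n" by blast
    qed
    then have "CP_prob n (UNIV - ?mid n) \<le> CP_prob n (?lo n \<union> ?up n)"
      by (intro measure_pmf.finite_measure_mono) auto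
    also have "\<dots> \<le> CP_prob n (?lo n) + CP_prob n (?up n)"
      by (rule measure_Un_le) auto
    finally show ?thesis using measure_pmf.prob_compl[of "?mid n" "CP_arcs n"] by simp
  qed
  then show "(\<lambda>n. CP_prob n (?mid n)) \<longlonglongrightarrow> 1"
    by (intro tendsto_sandwich[OF _ _ lim tendsto_const] always_eventually allI) auto
qed

end
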